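(* Let $k$ be a field of characteristic $p>0$, let $G$ be a finite subgroup of $GL(d,k)$ acting linearly on the polynomial ring $S=k[x_1,\dots,x_d]$, and assume that $|G|$ is not divisible by $p$ and that $G$ contains no pseudo-reflections. Let $S^G$ be the invariant subring, $\mathfrak n=(x_1,\dots,x_d)S$, $\mathfrak m=\mathfrak n\cap S^G$, and $A=(S^G)_{\mathfrak m}$. Then $$\mathrm{m}_{\mathrm{HK}}(A)=\frac{1}{|G|}.$$
   Context: $G$ acts on $S=\operatorname{Sym}_k(V)$, $V=k^d$, by extending its linear action on $V=\langle x_1,\dots,x_d\rangle_k$ to $k$-algebra automorphisms, and $S^G=\{f\in S: g(f)=f \text{ for all } g\in G\}$. A pseudo-reflection is a non-identity element $g\in G$ whose fixed subspace in $V$ has dimension $d-1$. Minimal Hilbert-Kunz multiplicity of a Noetherian local ring $(A,\mathfrak m)$ of characteristic $p$ and dimension $d$: let ${}^eA$ be $A$ viewed as an $A$-algebra via $a\mapsto a^{p^e}$, and for an $A$-module $M$ let $\mathbf F_A^e(M)={}^eA\otimes_A M$, regarded as an $A$-module by $a'(a\otimes m)=a'a\otimes m$ (so $a'\otimes am=a'a^{p^e}\otimes m$). Let $F_A^e:M\to\mathbf F_A^e(M)$, $x\mapsto 1\otimes x$. Let $E_A=E_A(A/\mathfrak m)$ be the injective hull of the residue field and $z$ a generator of its socle $\{x\in E_A:\mathfrak m x=0\}$. Then, with $\ell_A$ denoting length, $$\mathrm{m}_{\mathrm{HK}}(A)=\liminf_{e\to\infty}\frac{\ell_A\big(A/\operatorname{ann}_A(F_A^e(z))\big)}{p^{ed}}.$$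 *)

theory Defs
  imports
    "HOL-Analysis.Analysis"
    "HOL-Algebra.Algebra"
    "HOL-Algebra.Algebraic_Closure_Type"
    "HOL-Library.Poly_Mapping"
    "HOL-Library.Extended_Nat"
    "HOL-Library.Extended_Real"
    "HOL-Library.Liminf_Limsup"
begin

section \<open>Rings: dimension, characteristic, localization\<close>

definition krull_dim :: "('a, 'r) ring_scheme \<Rightarrow> enat" where
  "krull_dim R = Sup {enat n | n. \<exists>P. (\<forall>i\<le>n. primeideal (P i) R) \<and> (\<forall>i<n. P i \<subset> P (Suc i))}"

text \<open>The characteristic, with the convention that it is 0 if no positive multiple of 1 vanishes.\<close>

definition ring_char :: "('a, 'r) ring_scheme \<Rightarrow> nat" where
  "ring_char R = (if \<exists>n>0. [(n::nat)] \<cdot>\<^bsub>R\<^esub> \<one>\<^bsub>R\<^esub> = \<zero>\<^bsub>R\<^esub>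
     then LEAST n. n > 0 \<and> [(n::nat)] \<cdot>\<^bsub>R\<^esub> \<one>\<^bsub>R\<^esub> = \<zero>\<^bsub>R\<^esub> else 0)"

text \<open>Only meaningful for local rings, where the maximal ideal is unique.\<close>

definition max_ideal :: "('a, 'r) ring_scheme \<Rightarrow> 'a set" where
  "max_ideal R = (THE I. maximalideal I R)"

text \<open>\<open>fraction R P r s\<close> is the fraction \<open>r/s\<close> in the localization of \<open>R\<close> at the prime
  ideal \<open>P\<close>, as an equivalence class of pairs. The ring operations are unions over all
  representatives (as in \<^const>\<open>rcoset_mult\<close>); each such union is a single class.\<close>

definition fraction :: "('a, 'r) ring_scheme \<Rightarrow> 'a set \<Rightarrow> 'a \<Rightarrow> 'a \<Rightarrow> ('a \<times> 'a) set" where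
  "fraction R P r s = {(r', s'). r' \<in> carrier R \<and> s' \<in> carrier R - P \<and>
     (\<exists>t \<in> carrier R - P. t \<otimes>\<^bsub>R\<^esub> (r \<otimes>\<^bsub>R\<^esub> s') = t \<otimes>\<^bsub>R\<^esub> (r' \<otimes>\<^bsub>R\<^esub> s))}"

definition localization :: "('a, 'r) ring_scheme \<Rightarrow> 'a set \<Rightarrow> ('a \<times> 'a) set ring" where
  "localization R P =
    \<lparr>carrier = {fraction R P r s | r s. r \<in> carrier R \<and> s \<in> carrier R - P},
     monoid.mult = (\<lambda>x y. \<Union>(r, s) \<in> x. \<Union>(r', s') \<in> y.
        fraction R P (r \<otimes>\<^bsub>R\<^esub> r') (s \<otimes>\<^bsub>R\<^esub> s')),
     one = fraction R P \<one>\<^bsub>R\<^esub> \<one>\<^bsub>R\<^esub>,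
     ring.zero = fraction R P \<zero>\<^bsub>R\<^esub> \<one>\<^bsub>R\<^esub>,
     add = (\<lambda>x y. \<Union>(r, s) \<in> x. \<Union>(r', s') \<in> y.
        fraction R P ((r \<otimes>\<^bsub>R\<^esub> s') \<oplus>\<^bsub>R\<^esub> (r' \<otimes>\<^bsub>R\<^esub> s)) (s \<otimes>\<^bsub>R\<^esub> s'))\<rparr>"


section \<open>Modules: quotients by ideals, length, injective hulls\<close>

definition quot_module :: "('a, 'r) ring_scheme \<Rightarrow> 'a set \<Rightarrow> ('a, 'a set) module" where
  "quot_module R I =
    \<lparr>carrier = a_rcosets\<^bsub>R\<^esub> I, monoid.mult = rcoset_mult R I, one = I +>\<^bsub>R\<^esub> \<one>\<^bsub>R\<^esub>,
     ring.zero = I, add = set_add R,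
     module.smult = (\<lambda>a C. rcoset_mult R I (I +>\<^bsub>R\<^esub> a) C)\<rparr>"

definition module_length :: "('a, 'r) ring_scheme \<Rightarrow> ('a, 'b, 'm) module_scheme \<Rightarrow> enat" where
  "module_length R M =
     Sup {enat n | n. \<exists>H. (\<forall>i\<le>n. submodule (H i) R M) \<and> (\<forall>i<n. H i \<subset> H (Suc i))}"

definition module_hom ::
    "('a, 'r) ring_scheme \<Rightarrow> ('a, 'b, 'm) module_scheme \<Rightarrow> ('a, 'c, 'n) module_scheme \<Rightarrow> ('b \<Rightarrow> 'c) set"
  where
  "module_hom R M N = {h \<in> hom (add_monoid M) (add_monoid N).
     \<forall>a \<in> carrier R. \<forall>x \<in> carrier M. h (a \<odot>\<^bsub>M\<^esub> x) = a \<odot>\<^bsub>N\<^esub> h x}"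

text \<open>Injectivity is the extension property for all inclusions \<open>H \<subseteq> N\<close> of \<open>R\<close>-modules. A
  definition cannot quantify over types, so the modules \<open>N\<close> are those with elements in the
  type \<open>('a + 'e) set\<close>. This type contains copies of \<open>R\<close>, its quotients and \<open>E\<close>; since it
  contains a copy of \<open>R\<close>, Baer's criterion shows that nothing is lost.\<close>

definition injective_module :: "('a, 'r) ring_scheme \<Rightarrow> ('a, 'e, 'm) module_scheme \<Rightarrow> bool" where
  "injective_module R E \<longleftrightarrow> Module.module R E \<and>
     (\<forall>(N :: ('a, ('a + 'e) set) module) H f.
        Module.module R N \<longrightarrow> submodule H R N \<longrightarrow> f \<in> module_hom R (N\<lparr>carrier := H\<rparr>) E \<longrightarrow>
        (\<exists>g \<in> module_hom R N E. \<forall>x \<in> H. g x = f x))"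

definition injective_hull ::
    "('a, 'r) ring_scheme \<Rightarrow> ('a, 'b, 'm) module_scheme \<Rightarrow> ('a, 'e, 'n) module_scheme \<Rightarrow> bool" where
  "injective_hull R M E \<longleftrightarrow> injective_module R E \<and>
     (\<exists>\<iota> \<in> module_hom R M E. inj_on \<iota> (carrier M) \<and>
        (\<forall>H. submodule H R E \<longrightarrow> H \<noteq> {\<zero>\<^bsub>E\<^esub>} \<longrightarrow> H \<inter> \<iota> ` carrier M \<noteq> {\<zero>\<^bsub>E\<^esub>}))"

definition annihilator :: "('a, 'r) ring_scheme \<Rightarrow> ('a, 'b, 'm) module_scheme \<Rightarrow> 'b \<Rightarrow> 'a set" where
  "annihilator R M x = {a \<in> carrier R. a \<odot>\<^bsub>M\<^esub> x = \<zero>\<^bsub>M\<^esub>}"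

definition socle :: "('a, 'r) ring_scheme \<Rightarrow> ('a, 'b, 'm) module_scheme \<Rightarrow> 'b set" where
  "socle R M = {x \<in> carrier M. \<forall>a \<in> max_ideal R. a \<odot>\<^bsub>M\<^esub> x = \<zero>\<^bsub>M\<^esub>}"

definition socle_generator :: "('a, 'r) ring_scheme \<Rightarrow> ('a, 'b, 'm) module_scheme \<Rightarrow> 'b \<Rightarrow> bool" where
  "socle_generator R M z \<longleftrightarrow> z \<in> socle R M \<and> socle R M = {a \<odot>\<^bsub>M\<^esub> z | a. a \<in> carrier R}"


section \<open>Extension of scalars and the Frobenius functor\<close>

text \<open>For an \<open>R\<close>-algebra \<open>B\<close> (a \<^typ>\<open>('a, 'b) module\<close> record whose ring part is \<open>B\<close> and
  whose scalar multiplication is the \<open>R\<close>-action) and an \<open>R\<close>-module \<open>M\<close>, the tensor product of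
  \<open>B\<close> and \<open>M\<close> over \<open>R\<close> is the free abelian group on \<open>B \<times> M\<close> modulo the bilinearity relations.\<close>

abbreviation tensor_free ::
    "('a, 'b, 'm) module_scheme \<Rightarrow> ('a, 'c, 'n) module_scheme \<Rightarrow> (('b \<times> 'c) \<Rightarrow>\<^sub>0 int) monoid" where
  "tensor_free B M \<equiv> free_Abelian_group (carrier B \<times> carrier M)"

definition tensor_relations ::
    "('a, 'r) ring_scheme \<Rightarrow> ('a, 'b, 'm) module_scheme \<Rightarrow> ('a, 'c, 'n) module_scheme
      \<Rightarrow> (('b \<times> 'c) \<Rightarrow>\<^sub>0 int) set" where
  "tensor_relations R B M = generate (tensor_free B M)
     ({frag_of (b \<oplus>\<^bsub>B\<^esub> b', x) - frag_of (b, x) - frag_of (b', x) | b b' x.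
         b \<in> carrier B \<and> b' \<in> carrier B \<and> x \<in> carrier M} \<union>
      {frag_of (b, x \<oplus>\<^bsub>M\<^esub> x') - frag_of (b, x) - frag_of (b, x') | b x x'.
         b \<in> carrier B \<and> x \<in> carrier M \<and> x' \<in> carrier M} \<union>
      {frag_of (a \<odot>\<^bsub>B\<^esub> b, x) - frag_of (b, a \<odot>\<^bsub>M\<^esub> x) | a b x.
         a \<in> carrier R \<and> b \<in> carrier B \<and> x \<in> carrier M})"

definition pure_tensor ::
    "('a, 'r) ring_scheme \<Rightarrow> ('a, 'b, 'm) module_scheme \<Rightarrow> ('a, 'c, 'n) module_scheme
      \<Rightarrow> 'b \<Rightarrow> 'c \<Rightarrow> (('b \<times> 'c) \<Rightarrow>\<^sub>0 int) set" where
  "pure_tensor R B M b x = tensor_relations R B M #>\<^bsub>tensor_free B M\<^esub> frag_of (b, x)"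

text \<open>The tensor product as a \<open>B\<close>-module: \<open>c\<close> sends the class of \<open>(b, x)\<close> to that of
  \<open>(c b, x)\<close>. The \<open>mult\<close> and \<open>one\<close> fields of a module record carry no information.\<close>

definition extend_scalars ::
    "('a, 'r) ring_scheme \<Rightarrow> ('a, 'b, 'm) module_scheme \<Rightarrow> ('a, 'c, 'n) module_scheme
      \<Rightarrow> ('b, (('b \<times> 'c) \<Rightarrow>\<^sub>0 int) set) module" where
  "extend_scalars R B M =
    (let Q = tensor_free B M Mod tensor_relations R B M in
     \<lparr>carrier = carrier Q, monoid.mult = undefined, one = undefined,
      ring.zero = \<one>\<^bsub>Q\<^esub>, add = monoid.mult Q,
      module.smult = (\<lambda>c U. \<Union>u \<in> U. tensor_relations R B M #>\<^bsub>tensor_free B M\<^esub>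
         frag_extend (\<lambda>(b, x). frag_of (c \<otimes>\<^bsub>B\<^esub> b, x)) u)\<rparr>)"

text \<open>The ring \<open>R\<close> viewed as an \<open>R\<close>-algebra via the \<open>e\<close>-fold Frobenius.\<close>

definition frobenius_algebra :: "('a, 'r) ring_scheme \<Rightarrow> nat \<Rightarrow> ('a, 'a) module" where
  "frobenius_algebra R e =
    \<lparr>carrier = carrier R, monoid.mult = monoid.mult R, one = \<one>\<^bsub>R\<^esub>,
     ring.zero = \<zero>\<^bsub>R\<^esub>, add = add R,
     module.smult = (\<lambda>a b. (a [^]\<^bsub>R\<^esub> (ring_char R ^ e)) \<otimes>\<^bsub>R\<^esub> b)\<rparr>"

definition frobenius_functor ::
    "('a, 'r) ring_scheme \<Rightarrow> nat \<Rightarrow> ('a, 'c, 'n) module_scheme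
      \<Rightarrow> ('a, (('a \<times> 'c) \<Rightarrow>\<^sub>0 int) set) module" where
  "frobenius_functor R e M = extend_scalars R (frobenius_algebra R e) M"

definition frobenius_map ::
    "('a, 'r) ring_scheme \<Rightarrow> nat \<Rightarrow> ('a, 'c, 'n) module_scheme \<Rightarrow> 'c \<Rightarrow> (('a \<times> 'c) \<Rightarrow>\<^sub>0 int) set" where
  "frobenius_map R e M x = pure_tensor R (frobenius_algebra R e) M \<one>\<^bsub>R\<^esub> x"


section \<open>Minimal Hilbert-Kunz multiplicity\<close>

text \<open>The multiplicity of the local ring \<open>R\<close>, computed from an injective hull \<open>E\<close> of its residue
  field and a generator \<open>z\<close> of the socle of \<open>E\<close>; \<open>E\<close> is an argument because it is unique
  only up to isomorphism.\<close>

definition m_HK :: "('a, 'r) ring_scheme \<Rightarrow> ('a, 'e, 'm) module_scheme \<Rightarrow> 'e \<Rightarrow> ereal" where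
  "m_HK R E z = liminf (\<lambda>e.
     ereal_of_enat (module_length R
       (quot_module R (annihilator R (frobenius_functor R e E) (frobenius_map R e E z))))
     / ereal (real (ring_char R ^ (e * the_enat (krull_dim R)))))"


section \<open>Linear group actions on polynomial rings\<close>

type_synonym ('n, 'k) mpoly = "('n \<Rightarrow>\<^sub>0 nat) \<Rightarrow>\<^sub>0 'k"

definition mvar :: "'n \<Rightarrow> ('n, 'k::field) mpoly" where
  "mvar i = Poly_Mapping.single (Poly_Mapping.single i 1) 1"

definition mconst :: "'k \<Rightarrow> ('n, 'k::field) mpoly" where
  "mconst c = Poly_Mapping.single 0 c"

definition GL :: "('k::field ^ 'n::finite ^ 'n) monoid" where
  "GL = \<lparr>carrier = {g. invertible g}, monoid.mult = (**), one = mat 1\<rparr>"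

text \<open>The basis vector \<open>x\<^sub>j\<close> of \<open>V = k\<^sup>d\<close> is sent to the \<open>j\<close>-th column of \<open>g\<close>, and this linear
  map is extended to polynomials by substitution.\<close>

definition act_var :: "'k::field ^ 'n::finite ^ 'n \<Rightarrow> 'n \<Rightarrow> ('n, 'k) mpoly" where
  "act_var g j = (\<Sum>i\<in>UNIV. mconst (g $ i $ j) * mvar i)"

definition act :: "'k::field ^ 'n::finite ^ 'n \<Rightarrow> ('n, 'k) mpoly \<Rightarrow> ('n, 'k) mpoly" where
  "act g f = (\<Sum>m \<in> Poly_Mapping.keys f. mconst (Poly_Mapping.lookup f m) *
     (\<Prod>j\<in>UNIV. act_var g j ^ Poly_Mapping.lookup m j))"

definition pseudo_reflection :: "'k::field ^ 'n::finite ^ 'n \<Rightarrow> bool" where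
  "pseudo_reflection g \<longleftrightarrow> g \<noteq> mat 1 \<and> vec.dim {v. g *v v = v} = CARD('n) - 1"

definition invariant_ring :: "('k::field ^ 'n::finite ^ 'n) set \<Rightarrow> ('n, 'k) mpoly ring" where
  "invariant_ring G = ring_of_type_algebra\<lparr>carrier := {f. \<forall>g\<in>G. act g f = f}\<rparr>"

definition invariant_max_ideal :: "('k::field ^ 'n::finite ^ 'n) set \<Rightarrow> ('n, 'k) mpoly set" where
  "invariant_max_ideal G =
     (Idl\<^bsub>ring_of_type_algebra\<^esub> (range mvar)) \<inter> carrier (invariant_ring G)"

definition invariant_local_ring ::
    "('k::field ^ 'n::finite ^ 'n) set \<Rightarrow> (('n, 'k) mpoly \<times> ('n, 'k) mpoly) set ring" where
  "invariant_local_ring G = localization (invariant_ring G) (invariant_max_ideal G)"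

end

theory Submission
  imports Defs
begin

text \<open>Write S for the polynomial ring, R for its invariants, A for the local ring of R at the origin, d for the
number of variables, E for the injective hull, z for the generator of its socle, and q for a power of p. The
theorem follows from two facts about the contraction of the Frobenius power \<open>(x\<^sub>1\<^sup>q, \<dots>, x\<^sub>d\<^sup>q)\<close> to R: it is the annihilator of
the Frobenius image of z, and its colength grows like \<open>q\<^sup>d / |G|\<close>.

The colength is a count (\<open>ldim_asymptotics\<close>). Up to a fixed nonzero factor, S is generated over R by |G| elements, and it
contains |G| elements which are independent over R, even modulo every Frobenius power. As fixed factors change
dimensions only by \<open>O(q\<^sup>d\<^sup>-\<^sup>1)\<close>, the dimension of S modulo the Frobenius power, which is \<open>q\<^sup>d\<close>, is |G| times the
dimension of the image of R, up to that error. That the dimension is the length over A, and that A has dimension d, are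
\<open>length_quotient\<close> and \<open>krull_dim_A\<close>.

For the annihilator (\<open>annihilator_frobenius\<close>), suppose first that an invariant r is not in the Frobenius power. A Cartier
map, which extracts q-th roots of monomials, followed by the Reynolds operator, gives an additive map \<open>\<Phi>\<close> of A with
\<open>\<Phi>(a\<^sup>q b) = a \<Phi>(b)\<close> that sends r to a unit; it induces a map from the Frobenius functor applied to E back to E, and the
image of r z is not zero there. Conversely, let r be the sum of \<open>s\<^sub>i x\<^sub>i\<^sup>q\<close>. The Reynolds operator reduces the claim that r kills
the Frobenius image of z to the vanishing of \<open>x\<^sub>i \<otimes> z\<close> in the tensor product of S and E over R.

This vanishing (\<open>mvar_tensor_socle_zero\<close>) is the place where pseudo-reflections matter. The trace pairing maps the tensor
product to the R-linear maps from S to E, and it kills \<open>x\<^sub>i \<otimes> z\<close>, since traces of polynomials without constant term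
kill z. It remains to see that the pairing is injective. Its kernel K is killed by every product, over all \<open>g \<noteq> 1\<close>, of linear forms
\<open>g x\<^sub>j - x\<^sub>j\<close>, because such a product is the only nonzero component of an element of the tensor square of S in the product
of its conjugates. Since g is not a pseudo-reflection, two of its forms are coprime. The module E is divisible and the
pairing is surjective, so coprime factors can be removed from the products that kill K, until 1 kills K.\<close>

section \<open>Ring homomorphisms and substitution\<close>

definition ring_map :: "('a::comm_ring_1 \<Rightarrow> 'b::comm_ring_1) \<Rightarrow> bool" where
  "ring_map h \<longleftrightarrow> h 1 = 1 \<and> (\<forall>a b. h (a + b) = h a + h b) \<and> (\<forall>a b. h (a * b) = h a * h b)"

lemma ring_map_0: "ring_map h \<Longrightarrow> h 0 = 0"
proof -
  assume "ring_map h"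
  then have "h 0 + h 0 = h 0" unfolding ring_map_def by (metis add_0)
  then show ?thesis by simp
qed

lemma ring_map_sum: "ring_map h \<Longrightarrow> h (sum f A) = (\<Sum>a\<in>A. h (f a))"
  by (induction A rule: infinite_finite_induct) (auto simp: ring_map_0, auto simp: ring_map_def)

lemma ring_map_prod: "ring_map h \<Longrightarrow> h (prod f A) = (\<Prod>a\<in>A. h (f a))"
  by (induction A rule: infinite_finite_induct) (auto simp: ring_map_def)

lemma ring_map_power: "ring_map h \<Longrightarrow> h (a ^ n) = h a ^ n"
  by (induction n) (auto simp: ring_map_def)

lemma ring_map_minus: "ring_map h \<Longrightarrow> h (- a) = - h a"
proof -
  assume h: "ring_map h"
  then have "h a + h (- a) = h (a + - a)" unfolding ring_map_def by metis
  also have "\<dots> = 0" using ring_map_0[OF h] by simp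
  finally show ?thesis by (simp add: minus_unique)
qed

lemma ring_map_diff: "ring_map h \<Longrightarrow> h (a - b) = h a - h b"
  using ring_map_minus[of h b] by (simp only: diff_conv_add_uminus[of a b] ring_map_def) simp

lemma ring_map_mult: "ring_map h \<Longrightarrow> h (a * b) = h a * h b"
  and ring_map_add: "ring_map h \<Longrightarrow> h (a + b) = h a + h b"
  and ring_map_1: "ring_map h \<Longrightarrow> h 1 = 1"
  by (auto simp: ring_map_def)

text \<open>Both the group action and the embedding into other rings are substitutions: a homomorphism on the coefficients together with a value for each variable.\<close>

definition poly_ev ::
    "('k::field \<Rightarrow> 'r::comm_ring_1) \<Rightarrow> ('n::finite \<Rightarrow> 'r) \<Rightarrow> ('n, 'k) mpoly \<Rightarrow> 'r" where
  "poly_ev \<gamma> \<theta> f = (\<Sum>m\<in>Poly_Mapping.keys f. \<gamma> (Poly_Mapping.lookup f m) *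
     (\<Prod>j\<in>UNIV. \<theta> j ^ Poly_Mapping.lookup m j))"

lemma poly_ev_superset:
  assumes "\<gamma> 0 = 0" "finite K" "Poly_Mapping.keys f \<subseteq> K"
  shows "poly_ev \<gamma> \<theta> f = (\<Sum>m\<in>K. \<gamma> (Poly_Mapping.lookup f m) *
     (\<Prod>j\<in>UNIV. \<theta> j ^ Poly_Mapping.lookup m j))"
  unfolding poly_ev_def
  by (rule sum.mono_neutral_left) (use assms in \<open>auto simp: in_keys_iff\<close>)

lemma mpoly_sum_monomials:
  "(f :: 'a \<Rightarrow>\<^sub>0 'b::comm_monoid_add) = (\<Sum>m\<in>Poly_Mapping.keys f. Poly_Mapping.single m (Poly_Mapping.lookup f m))"
proof (rule poly_mapping_eqI)
  fix k
  have "(\<Sum>m\<in>Poly_Mapping.keys f. Poly_Mapping.lookup (Poly_Mapping.single m (Poly_Mapping.lookup f m)) k)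
     = (\<Sum>m\<in>Poly_Mapping.keys f. if m = k then Poly_Mapping.lookup f k else 0)"
    by (rule sum.cong) (auto simp: lookup_single when_def)
  also have "\<dots> = Poly_Mapping.lookup f k" by (auto simp: sum.delta in_keys_iff)
  finally show "Poly_Mapping.lookup f k = Poly_Mapping.lookup (\<Sum>m\<in>Poly_Mapping.keys f. Poly_Mapping.single m (Poly_Mapping.lookup f m)) k"
    by (simp add: lookup_sum)
qed

lemma mpoly_induct [case_names single add]:
  fixes f :: "'a \<Rightarrow>\<^sub>0 'b::comm_monoid_add"
  assumes "\<And>m c. P (Poly_Mapping.single m c)" "\<And>f g. P f \<Longrightarrow> P g \<Longrightarrow> P (f + g)"
  shows "P f"
proof -
  have "P (\<Sum>m\<in>K. Poly_Mapping.single m (Poly_Mapping.lookup f m))" if "finite K" for K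
    using that
  proof induction
    case empty
    show ?case using assms(1)[of undefined 0] by simp
  qed (auto intro: assms)
  from this[OF finite_keys[of f]] show ?thesis
    by (subst mpoly_sum_monomials[of f])
qed

lemma poly_ev_add:
  assumes "ring_map \<gamma>"
  shows "poly_ev \<gamma> \<theta> (f + g) = poly_ev \<gamma> \<theta> f + poly_ev \<gamma> \<theta> g"
proof -
  let ?K = "Poly_Mapping.keys f \<union> Poly_Mapping.keys g"
  have K: "finite ?K" "Poly_Mapping.keys (f + g) \<subseteq> ?K" by (auto simp: keys_add)
  show ?thesis
    by (subst (1 2 3) poly_ev_superset[where K = ?K])
      (use assms K in \<open>auto simp: ring_map_0 ring_map_add lookup_add sum.distrib algebra_simps keys_add\<close>)
qed

lemma poly_ev_single:
  assumes "ring_map \<gamma>"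
  shows "poly_ev \<gamma> \<theta> (Poly_Mapping.single m c) = \<gamma> c * (\<Prod>j\<in>UNIV. \<theta> j ^ Poly_Mapping.lookup m j)"
  by (cases "c = 0") (auto simp: poly_ev_def ring_map_0[OF assms])

lemma poly_ev_mult:
  assumes "ring_map \<gamma>"
  shows "poly_ev \<gamma> \<theta> (f * g) = poly_ev \<gamma> \<theta> f * poly_ev \<gamma> \<theta> g"
proof (induction f rule: mpoly_induct)
  case (single m c)
  show ?case
  proof (induction g rule: mpoly_induct)
    case (single m' c')
    show ?case
      by (simp add: mult_single poly_ev_single assms lookup_add power_add prod.distrib ring_map_mult algebra_simps)
  qed (simp add: algebra_simps poly_ev_add assms)
qed (simp add: algebra_simps poly_ev_add assms)

lemma ring_map_poly_ev: "ring_map \<gamma> \<Longrightarrow> ring_map (poly_ev \<gamma> \<theta>)"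
  unfolding ring_map_def[of "poly_ev \<gamma> \<theta>"]
  by (auto simp: poly_ev_add poly_ev_mult ring_map_1
      poly_ev_single[of \<gamma> \<theta> 0 1, simplified])

lemma ring_map_mconst: "ring_map (mconst :: 'k::field \<Rightarrow> ('n, 'k) mpoly)"
  by (auto simp: ring_map_def mconst_def single_add mult_single)

lemmas mconst_simps = ring_map_mult[OF ring_map_mconst] ring_map_add[OF ring_map_mconst]
  ring_map_1[OF ring_map_mconst] ring_map_0[OF ring_map_mconst]

lemma prod_if_one:
  "finite A \<Longrightarrow> (\<Prod>j\<in>A. (f j :: 'r::comm_monoid_mult) ^ (if j = i then n else 0)) = (if i \<in> A then f i ^ n else 1)"
  by (subst prod.cong[OF refl, of A _ "\<lambda>j. if j = i then f j ^ n else 1"]) (auto simp: prod.delta)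

lemma poly_ev_mvar: "ring_map \<gamma> \<Longrightarrow> poly_ev \<gamma> \<theta> (mvar i) = \<theta> i"
  using prod_if_one[of UNIV \<theta> i "Suc 0"]
  by (simp add: mvar_def poly_ev_single ring_map_1 lookup_single when_def eq_commute[of i])

lemma poly_ev_mconst: "ring_map \<gamma> \<Longrightarrow> poly_ev \<gamma> \<theta> (mconst c) = \<gamma> c"
  by (simp add: mconst_def poly_ev_single)

lemma single_eq_monomial:
  "Poly_Mapping.single m c = mconst c * (\<Prod>j\<in>UNIV. mvar j ^ Poly_Mapping.lookup m j)"
  for m :: "'n::finite \<Rightarrow>\<^sub>0 nat" and c :: "'k::field"
proof -
  have pw: "mvar j ^ n = (Poly_Mapping.single (Poly_Mapping.single j n) 1 :: ('n,'k) mpoly)" for j n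
    by (induction n) (auto simp: mvar_def mult_single simp flip: single_add)
  have "(\<Prod>j\<in>A. mvar j ^ Poly_Mapping.lookup m j) =
      (Poly_Mapping.single (\<Sum>j\<in>A. Poly_Mapping.single j (Poly_Mapping.lookup m j)) 1 :: ('n,'k) mpoly)"
    if "finite A" for A
    using that by induction (auto simp: pw mult_single)
  moreover have "(\<Sum>j\<in>UNIV. Poly_Mapping.single j (Poly_Mapping.lookup m j)) = m"
    by (rule poly_mapping_eqI) (auto simp: lookup_sum lookup_single when_def)
  ultimately show ?thesis by (simp add: mconst_def mult_single)
qed

lemma ring_map_eqI:
  fixes h h' :: "('n::finite, 'k::field) mpoly \<Rightarrow> 'r::comm_ring_1"
  assumes "ring_map h" "ring_map h'" "\<And>c. h (mconst c) = h' (mconst c)" "\<And>i. h (mvar i) = h' (mvar i)"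
  shows "h f = h' f"
proof (induction f rule: mpoly_induct)
  case (single m c)
  show ?case
    by (simp add: single_eq_monomial assms ring_map_mult[OF assms(1)] ring_map_mult[OF assms(2)]
        ring_map_prod[OF assms(1)] ring_map_prod[OF assms(2)] ring_map_power[OF assms(1)] ring_map_power[OF assms(2)])
next
  case (add f g)
  then show ?case by (simp only: ring_map_add[OF assms(1)] ring_map_add[OF assms(2)])
qed

section \<open>Minimal monomials and the absence of zero divisors\<close>

definition exp_index :: "'n::finite \<Rightarrow> nat" where
  "exp_index = (SOME a. inj a)"

lemma inj_exp_index: "inj (exp_index :: 'n::finite \<Rightarrow> nat)"
proof -
  obtain a :: "'n \<Rightarrow> nat" where "inj a"
    using finite_imp_inj_to_nat_seg[of "UNIV :: 'n set"] by blast
  then show ?thesis unfolding exp_index_def by (rule someI[of inj])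
qed

text \<open>The variables are indexed by a finite type without an order. Numbering them turns exponents into elements of a type that carries a linear order compatible with addition, so that every nonzero polynomial has a minimal monomial.\<close>

definition exp_embed :: "('n::finite \<Rightarrow>\<^sub>0 nat) \<Rightarrow> nat \<Rightarrow>\<^sub>0 nat" where
  "exp_embed m = (\<Sum>i\<in>UNIV. Poly_Mapping.single (exp_index i) (Poly_Mapping.lookup m i))"

lemma exp_embed_add: "exp_embed (m + m') = exp_embed m + exp_embed m'"
  by (simp add: exp_embed_def lookup_add single_add sum.distrib)

lemma lookup_exp_embed: "Poly_Mapping.lookup (exp_embed m) (exp_index i) = Poly_Mapping.lookup m i"
  by (simp add: exp_embed_def lookup_sum lookup_single when_def inj_eq[OF inj_exp_index])

lemma inj_exp_embed: "inj (exp_embed :: ('n::finite \<Rightarrow>\<^sub>0 nat) \<Rightarrow> _)"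
proof (rule injI, rule poly_mapping_eqI)
  fix m m' :: "'n \<Rightarrow>\<^sub>0 nat" and i :: 'n
  assume "exp_embed m = exp_embed m'"
  then have "Poly_Mapping.lookup (exp_embed m) (exp_index i) = Poly_Mapping.lookup (exp_embed m') (exp_index i)"
    by simp
  then show "Poly_Mapping.lookup m i = Poly_Mapping.lookup m' i" by (simp only: lookup_exp_embed)
qed

lemma minimal_monomial:
  fixes f :: "('n::finite, 'k::field) mpoly"
  assumes "f \<noteq> 0"
  obtains m where "Poly_Mapping.lookup f m \<noteq> 0"
    "\<And>m'. Poly_Mapping.lookup f m' \<noteq> 0 \<Longrightarrow> m' \<noteq> m \<Longrightarrow> exp_embed m < exp_embed m'"
proof -
  let ?K = "exp_embed ` Poly_Mapping.keys f"
  have K: "finite ?K" "?K \<noteq> {}" using assms by auto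
  obtain m where m: "m \<in> Poly_Mapping.keys f" "Min ?K = exp_embed m"
    using Min_in[OF K] by (metis imageE)
  show ?thesis
  proof (rule that[of m])
    show "Poly_Mapping.lookup f m \<noteq> 0" using m by (simp add: in_keys_iff)
    fix m' assume "Poly_Mapping.lookup f m' \<noteq> 0" "m' \<noteq> m"
    then have "exp_embed m \<le> exp_embed m'" "exp_embed m \<noteq> exp_embed m'"
      using Min_le[OF K(1), of "exp_embed m'"] m by (auto simp: in_keys_iff inj_eq[OF inj_exp_embed])
    then show "exp_embed m < exp_embed m'" by simp
  qed
qed

text \<open>Any other way of writing \<open>m + n\<close> as a sum of exponents of \<open>f\<close> and \<open>g\<close> would give a strictly larger exponent, so the product of the two minimal terms cannot be cancelled.\<close>

lemma lookup_mult_minimal: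
  fixes f g :: "('n::finite, 'k::field) mpoly"
  assumes f: "\<And>m'. Poly_Mapping.lookup f m' \<noteq> 0 \<Longrightarrow> m' \<noteq> m \<Longrightarrow> exp_embed m < exp_embed m'"
    and g: "\<And>m'. Poly_Mapping.lookup g m' \<noteq> 0 \<Longrightarrow> m' \<noteq> n \<Longrightarrow> exp_embed n < exp_embed m'"
  shows "Poly_Mapping.lookup (f * g) (m + n) = Poly_Mapping.lookup f m * Poly_Mapping.lookup g n"
proof -
  define f' where "f' = f - Poly_Mapping.single m (Poly_Mapping.lookup f m)"
  define g' where "g' = g - Poly_Mapping.single n (Poly_Mapping.lookup g n)"
  have f': "exp_embed m < exp_embed a" if "a \<in> Poly_Mapping.keys f'" for a
    using that f[of a] by (auto simp: f'_def in_keys_iff lookup_minus lookup_single when_def split: if_splits)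
  have g': "exp_embed n < exp_embed a" if "a \<in> Poly_Mapping.keys g'" for a
    using that g[of a] by (auto simp: g'_def in_keys_iff lookup_minus lookup_single when_def split: if_splits)
  have z: "Poly_Mapping.lookup (u * v) (m + n) = 0"
    if "\<And>a b. a \<in> Poly_Mapping.keys u \<Longrightarrow> b \<in> Poly_Mapping.keys v \<Longrightarrow> exp_embed (m + n) < exp_embed (a + b)"
    for u v :: "('n, 'k) mpoly"
  proof (rule ccontr)
    assume "\<not> ?thesis"
    then have "m + n \<in> Poly_Mapping.keys (u * v)" by (simp add: in_keys_iff)
    then obtain a b where "m + n = a + b" "a \<in> Poly_Mapping.keys u" "b \<in> Poly_Mapping.keys v"
      using keys_mult[of u v] by auto
    then show False using that[of a b] by auto
  qed
  have "f * g = Poly_Mapping.single (m + n) (Poly_Mapping.lookup f m * Poly_Mapping.lookup g n) +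
      Poly_Mapping.single m (Poly_Mapping.lookup f m) * g' + f' * Poly_Mapping.single n (Poly_Mapping.lookup g n) + f' * g'"
    by (simp add: f'_def g'_def algebra_simps mult_single)
  moreover have "Poly_Mapping.lookup (Poly_Mapping.single m (Poly_Mapping.lookup f m) * g') (m + n) = 0"
    by (rule z) (auto simp: exp_embed_add intro!: add_strict_left_mono g' split: if_splits)
  moreover have "Poly_Mapping.lookup (f' * Poly_Mapping.single n (Poly_Mapping.lookup g n)) (m + n) = 0"
    by (rule z) (auto simp: exp_embed_add intro!: add_strict_right_mono f' split: if_splits)
  moreover have "Poly_Mapping.lookup (f' * g') (m + n) = 0"
    by (rule z) (auto simp: exp_embed_add intro!: add_strict_mono f' g')
  ultimately show ?thesis by (simp add: lookup_add)
qed

lemma mpoly_mult_eq_0: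
  fixes f g :: "('n::finite, 'k::field) mpoly"
  shows "f * g = 0 \<longleftrightarrow> f = 0 \<or> g = 0"
proof
  assume fg: "f * g = 0"
  show "f = 0 \<or> g = 0"
  proof (rule ccontr)
    assume "\<not> ?thesis"
    then have "f \<noteq> 0" "g \<noteq> 0" by auto
    obtain m where m: "Poly_Mapping.lookup f m \<noteq> 0"
      "\<And>m'. Poly_Mapping.lookup f m' \<noteq> 0 \<Longrightarrow> m' \<noteq> m \<Longrightarrow> exp_embed m < exp_embed m'"
      using minimal_monomial[OF \<open>f \<noteq> 0\<close>] by blast
    obtain n where n: "Poly_Mapping.lookup g n \<noteq> 0"
      "\<And>m'. Poly_Mapping.lookup g m' \<noteq> 0 \<Longrightarrow> m' \<noteq> n \<Longrightarrow> exp_embed n < exp_embed m'"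
      using minimal_monomial[OF \<open>g \<noteq> 0\<close>] by blast
    show False using lookup_mult_minimal[of f m g n, OF m(2) n(2)] m(1) n(1) fg by simp
  qed
qed auto

lemma mpoly_mult_left_cancel:
  fixes f g h :: "('n::finite, 'k::field) mpoly"
  assumes "h \<noteq> 0"
  shows "h * f = h * g \<longleftrightarrow> f = g"
proof -
  have "h * f = h * g \<longleftrightarrow> h * (f - g) = 0" by (simp add: algebra_simps)
  then show ?thesis using assms by (auto simp: mpoly_mult_eq_0)
qed

lemma mpoly_prod_eq_0:
  fixes f :: "'a \<Rightarrow> ('n::finite, 'k::field) mpoly"
  shows "finite A \<Longrightarrow> prod f A = 0 \<longleftrightarrow> (\<exists>a\<in>A. f a = 0)"
  by (induction A rule: finite_induct) (auto simp: mpoly_mult_eq_0)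

section \<open>Constant terms and linear forms\<close>

abbreviation cterm :: "('n::finite, 'k::field) mpoly \<Rightarrow> 'k" where
  "cterm f \<equiv> Poly_Mapping.lookup f 0"

lemma ring_map_id: "ring_map (\<lambda>x. x)" by (simp add: ring_map_def)

lemma cterm_poly_ev: "cterm f = poly_ev (\<lambda>x. x) (\<lambda>_. 0) f"
  for f :: "('n::finite, 'k::field) mpoly"
proof (induction f rule: mpoly_induct)
  case (single m c)
  have "(\<Prod>j\<in>UNIV. (0::'k) ^ Poly_Mapping.lookup m j) = (if m = 0 then 1 else 0)"
    by (auto simp: poly_mapping_eq_iff fun_eq_iff prod_zero_iff)
  then show ?case by (auto simp: poly_ev_single[OF ring_map_id] lookup_single when_def)
qed (simp add: lookup_add poly_ev_add ring_map_id)

lemma ring_map_cterm: "ring_map (cterm :: ('n::finite, 'k::field) mpoly \<Rightarrow> 'k)"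
  unfolding cterm_poly_ev by (rule ring_map_poly_ev[OF ring_map_id])

lemma cterm_mconst [simp]: "cterm (mconst c) = c"
  by (simp add: mconst_def)

lemma cterm_mvar [simp]: "cterm (mvar i) = 0"
  by (auto simp: mvar_def lookup_single when_def)
     (metis lookup_single_eq lookup_zero nat.distinct(1))

definition lin :: "('n::finite \<Rightarrow> 'k) \<Rightarrow> ('n, 'k::field) mpoly" where
  "lin c = (\<Sum>i\<in>UNIV. mconst (c i) * mvar i)"

text \<open>A substitution that changes no variable modulo \<open>l\<close> changes no polynomial modulo \<open>l\<close>.\<close>

lemma poly_ev_congruent_mod:
  fixes \<theta> :: "'n \<Rightarrow> ('n::finite, 'k::field) mpoly"
  assumes "\<And>j. l dvd mvar j - \<theta> j"
  shows "l dvd f - poly_ev mconst \<theta> f"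
proof (induction f rule: mpoly_induct)
  case (single m c)
  have pw: "l dvd mvar j ^ n - \<theta> j ^ n" for j n
    by (metis assms dvd_trans dvd_triv_left power_diff_sumr2)
  have *: "l dvd (\<Prod>j\<in>A. mvar j ^ Poly_Mapping.lookup m j) - (\<Prod>j\<in>A. \<theta> j ^ Poly_Mapping.lookup m j)"
    if "finite A" for A
    using that
  proof induction
    case (insert a A)
    let ?n = "Poly_Mapping.lookup m a"
    let ?P = "\<Prod>j\<in>A. mvar j ^ Poly_Mapping.lookup m j" and ?Q = "\<Prod>j\<in>A. \<theta> j ^ Poly_Mapping.lookup m j"
    have "mvar a ^ ?n * ?P - \<theta> a ^ ?n * ?Q = (mvar a ^ ?n - \<theta> a ^ ?n) * ?P + \<theta> a ^ ?n * (?P - ?Q)"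
      by (simp add: algebra_simps)
    moreover have "l dvd (mvar a ^ ?n - \<theta> a ^ ?n) * ?P" by (rule dvd_mult2[OF pw])
    moreover have "l dvd \<theta> a ^ ?n * (?P - ?Q)" by (rule dvd_mult[OF insert.IH])
    ultimately show ?case by (simp only: prod.insert[OF insert.hyps] dvd_add)
  qed simp
  show ?case
    using dvd_mult[OF *[OF finite_class.finite_UNIV], of "mconst c"]
    unfolding poly_ev_single[OF ring_map_mconst] unfolding single_eq_monomial[of m c] right_diff_distrib .
next
  case (add f g)
  then have "l dvd (f - poly_ev mconst \<theta> f) + (g - poly_ev mconst \<theta> g)" by (rule dvd_add)
  then show ?case by (simp add: poly_ev_add[OF ring_map_mconst] algebra_simps)
qed

lemma mconst_mult_lin: "mconst a * lin c = lin (\<lambda>i. a * c i)"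
  by (simp add: lin_def sum_distrib_left mconst_simps mult.assoc)

lemma lookup_mconst_mult: "Poly_Mapping.lookup (mconst c * f) m = c * Poly_Mapping.lookup f m"
proof (induction f rule: mpoly_induct)
  case (single m' c')
  show ?case by (simp add: mconst_def mult_single lookup_single when_def)
qed (simp add: algebra_simps lookup_add)

lemma lookup_lin: "Poly_Mapping.lookup (lin c) (Poly_Mapping.single i 1) = c i"
  for c :: "'n::finite \<Rightarrow> 'k::field"
proof -
  have "Poly_Mapping.lookup (mvar j) (Poly_Mapping.single i 1) = (if j = i then 1 else (0::'k))" for j
    by (auto simp: mvar_def lookup_single when_def)
      (metis lookup_single_eq lookup_single_not_eq nat.distinct(1))
  then show ?thesis by (simp add: lin_def lookup_sum lookup_mconst_mult if_distrib[of "(*) _"] cong: if_cong)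
qed

lemma lin_eq_iff: "lin c = lin c' \<longleftrightarrow> c = c'"
  for c c' :: "'n::finite \<Rightarrow> 'k::field"
proof
  assume "lin c = lin c'"
  then have "c i = c' i" for i using lookup_lin[of c i] lookup_lin[of c' i] by simp
  then show "c = c'" by (rule ext)
qed simp

text \<open>Solving \<open>lin c = 0\<close> for a variable \<open>x\<^sub>j\<close> with \<open>c j \<noteq> 0\<close> and substituting the solution gives an endomorphism of the polynomial ring that kills exactly the multiples of \<open>lin c\<close>. As the ring has no zero divisors, \<open>lin c\<close> is prime.\<close>

lemma linear_forms_coprime:
  fixes c c' :: "'n::finite \<Rightarrow> 'k::field"
  assumes c: "c \<noteq> (\<lambda>_. 0)" and indep: "\<nexists>a. c' = (\<lambda>i. a * c i)"
    and eq: "lin c' * b = lin c * a"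
  shows "lin c dvd b"
proof -
  obtain j where j: "c j \<noteq> 0" using c by auto
  define \<theta> where "\<theta> i = (if i = j then mvar j - mconst (inverse (c j)) * lin c else mvar i)" for i
  let ?s = "poly_ev mconst \<theta>"
  note h = ring_map_poly_ev[OF ring_map_mconst, of \<theta>]
  have d: "lin c dvd f - ?s f" for f
    by (rule poly_ev_congruent_mod) (auto simp: \<theta>_def)
  have s_lin: "?s (lin e) = lin e - mconst (e j * inverse (c j)) * lin c" for e
  proof -
    have "?s (lin e) = (\<Sum>i\<in>UNIV. mconst (e i) * \<theta> i)"
      by (simp add: lin_def ring_map_sum[OF h] ring_map_mult[OF h] poly_ev_mconst[OF ring_map_mconst] poly_ev_mvar[OF ring_map_mconst])
    also have "\<dots> = (\<Sum>i\<in>UNIV. mconst (e i) * mvar i - (if i = j then mconst (e j * inverse (c j)) * lin c else 0))"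
      by (rule sum.cong) (auto simp: \<theta>_def algebra_simps mconst_simps)
    also have "\<dots> = lin e - mconst (e j * inverse (c j)) * lin c"
      by (simp add: sum_subtractf lin_def)
    finally show ?thesis .
  qed
  have "?s (lin c) = 0" using j by (simp add: s_lin mconst_simps)
  then have "?s (lin c') * ?s b = 0"
    using arg_cong[OF eq, of ?s] by (simp add: ring_map_mult[OF h])
  moreover have "?s (lin c') \<noteq> 0"
  proof
    assume "?s (lin c') = 0"
    then have "lin c' = lin (\<lambda>i. c' j * inverse (c j) * c i)"
      by (simp add: s_lin mconst_mult_lin)
    then show False using indep by (auto simp: lin_eq_iff)
  qed
  ultimately have "?s b = 0" by (simp add: mpoly_mult_eq_0)
  then show ?thesis using d[of b] by simp
qed

section \<open>Frobenius powers of the maximal ideal\<close>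

lemma CHAR_mpoly: "CHAR(('n::finite, 'k::field) mpoly) = CHAR('k)"
proof (rule CHAR_eqI)
  show "of_nat CHAR('k) = (0 :: ('n, 'k) mpoly)"
    by (metis of_nat_CHAR single_of_nat single_zero)
next
  fix x assume "of_nat x = (0 :: ('n, 'k) mpoly)"
  then have "Poly_Mapping.lookup (of_nat x :: ('n, 'k) mpoly) 0 = 0" by simp
  then have "of_nat x = (0 :: 'k)" by (simp add: lookup_of_nat)
  then show "CHAR('k) dvd x" by (simp add: of_nat_eq_0_iff_char_dvd)
qed

lemma frobenius_add:
  fixes f g :: "'a::comm_ring_1"
  assumes "Factorial_Ring.prime CHAR('a)" 
  shows "(f + g) ^ (CHAR('a) ^ e) = f ^ (CHAR('a) ^ e) + g ^ (CHAR('a) ^ e)"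
  by (rule freshmans_dream') (use assms in auto)

lemma frobenius_sum:
  fixes f :: "'b \<Rightarrow> 'a::comm_ring_1"
  assumes "Factorial_Ring.prime CHAR('a)" 
  shows "(\<Sum>x\<in>A. f x) ^ (CHAR('a) ^ e) = (\<Sum>x\<in>A. f x ^ (CHAR('a) ^ e))"
  by (rule freshmans_dream_sum') (use assms in auto)

definition expbox :: "('n::finite \<Rightarrow> nat) \<Rightarrow> ('n \<Rightarrow>\<^sub>0 nat) set" where
  "expbox b = {m. \<forall>i. Poly_Mapping.lookup m i < b i}"

lemma bij_betw_expbox: "bij_betw Poly_Mapping.lookup (expbox b) (\<Pi>\<^sub>E i\<in>UNIV. {..<b i})"
proof (rule bij_betwI')
  fix m m' :: "'a \<Rightarrow>\<^sub>0 nat"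
  show "(Poly_Mapping.lookup m = Poly_Mapping.lookup m') = (m = m')" by (rule poly_mapping_eq_iff[symmetric])
next
  fix m assume "m \<in> expbox b"
  then show "Poly_Mapping.lookup m \<in> (\<Pi>\<^sub>E i\<in>UNIV. {..<b i})" by (auto simp: expbox_def)
next
  fix f assume "f \<in> (\<Pi>\<^sub>E i\<in>UNIV. {..<b i})"
  then show "\<exists>m\<in>expbox b. f = Poly_Mapping.lookup m"
    by (intro bexI[of _ "Abs_poly_mapping f"]) (auto simp: expbox_def Abs_poly_mapping_inverse PiE_iff)
qed

lemma finite_expbox [simp]: "finite (expbox b)"
  using bij_betw_finite[OF bij_betw_expbox[of b]] by (simp add: finite_PiE)

lemma card_expbox: "card (expbox b) = (\<Prod>i\<in>UNIV. b i)"
  using bij_betw_same_card[OF bij_betw_expbox[of b]] by (simp add: card_PiE)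

text \<open>The normal form modulo the Frobenius power of the maximal ideal: it drops every monomial divisible by some \<open>x\<^sub>i\<^sup>q\<close>. It realizes the quotient as a subspace of the polynomial ring.\<close>

definition trunc :: "nat \<Rightarrow> ('n::finite, 'k::field) mpoly \<Rightarrow> ('n, 'k) mpoly" where
  "trunc q f = (\<Sum>m\<in>expbox (\<lambda>_. q). Poly_Mapping.single m (Poly_Mapping.lookup f m))"

lemma lookup_trunc: "Poly_Mapping.lookup (trunc q f) m =
    (if m \<in> expbox (\<lambda>_. q) then Poly_Mapping.lookup f m else 0)"
  by (auto simp: trunc_def lookup_sum lookup_single when_def)

text \<open>The ideal generated by the powers \<open>x\<^sub>i\<^sup>q\<close>, described by its monomials; the two descriptions are linked by \<open>mvar_power_frob_ideal\<close> and \<open>frob_ideal_decomp\<close>.\<close>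

definition frob_ideal :: "nat \<Rightarrow> ('n::finite, 'k::field) mpoly set" where
  "frob_ideal q = {f. \<forall>m\<in>expbox (\<lambda>_. q). Poly_Mapping.lookup f m = 0}"

lemma trunc_eq_iff: "trunc q f = trunc q g \<longleftrightarrow> f - g \<in> frob_ideal q"
  by (auto simp: poly_mapping_eq_iff fun_eq_iff lookup_trunc frob_ideal_def lookup_minus)

lemma trunc_add: "trunc q (f + g) = trunc q f + trunc q g"
  by (rule poly_mapping_eqI) (auto simp: lookup_trunc lookup_add)

lemma trunc_zero [simp]: "trunc q 0 = 0"
  by (rule poly_mapping_eqI) (auto simp: lookup_trunc)

lemma trunc_eq_0_iff: "trunc q f = 0 \<longleftrightarrow> f \<in> frob_ideal q"
  using trunc_eq_iff[of q f 0] by simp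

lemma trunc_scale: "trunc q (mconst c * f) = mconst c * trunc q f"
  by (rule poly_mapping_eqI) (auto simp: lookup_trunc lookup_mconst_mult)

lemma trunc_sum: "trunc q (sum f A) = (\<Sum>a\<in>A. trunc q (f a))"
  by (induction A rule: infinite_finite_induct) (auto simp: trunc_add)

lemma trunc_trunc: "trunc q (trunc q f) = trunc q f"
  by (rule poly_mapping_eqI) (auto simp: lookup_trunc)

lemma frob_ideal_0: "0 \<in> frob_ideal q" by (simp add: frob_ideal_def)

lemma frob_ideal_add: "f \<in> frob_ideal q \<Longrightarrow> g \<in> frob_ideal q \<Longrightarrow> f + g \<in> frob_ideal q"
  by (simp add: frob_ideal_def lookup_add)

lemma frob_ideal_sum: "(\<And>a. a \<in> A \<Longrightarrow> f a \<in> frob_ideal q) \<Longrightarrow> sum f A \<in> frob_ideal q"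
  by (induction A rule: infinite_finite_induct) (auto intro: frob_ideal_0 frob_ideal_add)

lemma frob_ideal_single: "m \<notin> expbox (\<lambda>_. q) \<Longrightarrow> Poly_Mapping.single m c \<in> frob_ideal q"
  by (auto simp: frob_ideal_def lookup_single when_def)

lemma frob_ideal_mult:
  assumes "f \<in> frob_ideal q"
  shows "g * f \<in> frob_ideal q"
proof (induction g rule: mpoly_induct)
  case (single a c)
  have "Poly_Mapping.single a c * f =
      (\<Sum>m\<in>Poly_Mapping.keys f. Poly_Mapping.single (a + m) (c * Poly_Mapping.lookup f m))"
    by (subst mpoly_sum_monomials[of f]) (simp add: sum_distrib_left mult_single)
  also have "\<dots> \<in> frob_ideal q"
  proof (rule frob_ideal_sum, rule frob_ideal_single)
    fix m assume "m \<in> Poly_Mapping.keys f"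
    then have "m \<notin> expbox (\<lambda>_. q)" using assms by (auto simp: frob_ideal_def in_keys_iff)
    then obtain i where "\<not> Poly_Mapping.lookup m i < q" by (auto simp: expbox_def)
    then have "\<not> Poly_Mapping.lookup (a + m) i < q" by (simp add: lookup_add)
    then show "a + m \<notin> expbox (\<lambda>_. q)" unfolding expbox_def by blast
  qed
  finally show ?case .
qed (auto simp: algebra_simps intro: frob_ideal_add)

lemma mvar_power: "mvar j ^ n = (Poly_Mapping.single (Poly_Mapping.single j n) 1 :: ('n::finite,'k::field) mpoly)"
  by (induction n) (auto simp: mvar_def mult_single simp flip: single_add)

lemma mvar_power_frob_ideal: "mvar i ^ q \<in> frob_ideal q"
  unfolding mvar_power by (rule frob_ideal_single) (auto simp: expbox_def lookup_single when_def)

lemma frob_ideal_decomp: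
  fixes f :: "('n::finite, 'k::field) mpoly"
  assumes "f \<in> frob_ideal q"
  obtains s where "f = (\<Sum>i\<in>UNIV. s i * mvar i ^ q)"
proof -
  have "\<exists>s. (\<Sum>m\<in>K. Poly_Mapping.single m (Poly_Mapping.lookup f m)) = (\<Sum>i\<in>UNIV. s i * mvar i ^ q)"
    if "finite K" "K \<subseteq> Poly_Mapping.keys f" for K
    using that
  proof induction
    case empty
    show ?case by (intro exI[of _ "\<lambda>_. 0"]) simp
  next
    case (insert m K)
    then obtain s where s: "(\<Sum>m\<in>K. Poly_Mapping.single m (Poly_Mapping.lookup f m)) = (\<Sum>i\<in>UNIV. s i * mvar i ^ q)"
      by auto
    have "m \<notin> expbox (\<lambda>_. q)" using assms insert.prems by (auto simp: frob_ideal_def in_keys_iff)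
    then obtain i0 where i0: "q \<le> Poly_Mapping.lookup m i0" by (auto simp: expbox_def not_less)
    define t where "t = Poly_Mapping.single (m - Poly_Mapping.single i0 q) (Poly_Mapping.lookup f m)"
    have "m - Poly_Mapping.single i0 q + Poly_Mapping.single i0 q = m"
      using i0 by (intro poly_mapping_eqI) (auto simp: lookup_add lookup_minus lookup_single when_def)
    then have "Poly_Mapping.single m (Poly_Mapping.lookup f m) = t * mvar i0 ^ q"
      by (simp add: t_def mvar_power mult_single)
    then have "(\<Sum>m\<in>insert m K. Poly_Mapping.single m (Poly_Mapping.lookup f m)) =
        (\<Sum>i\<in>UNIV. (s i + (if i = i0 then t else 0)) * mvar i ^ q)"
      using insert s by (simp add: algebra_simps sum.distrib if_distrib[of "\<lambda>x. _ * x"] cong: if_cong)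
    then show ?case by (intro exI[of _ "\<lambda>i. s i + (if i = i0 then t else 0)"])
  qed
  from this[of "Poly_Mapping.keys f"] show ?thesis
    using that by (auto simp flip: mpoly_sum_monomials)
qed

section \<open>Newton interpolation modulo an ideal\<close>

fun vandermonde :: "'a::comm_ring_1 list \<Rightarrow> 'a" where
  "vandermonde [] = 1"
| "vandermonde (a # bs) = (\<Prod>b\<leftarrow>bs. b - a) * vandermonde bs"

text \<open>A polynomial of degree less than the number of given points is determined by its values at them, up to the differences of the points. Dividing by \<open>X - a\<close> for the first point \<open>a\<close> leaves a quotient whose values at the other points, multiplied by the differences \<open>b - a\<close>, again lie in the ideal; this is Newton's form of interpolation, and it works in every commutative ring.\<close>

lemma newton_ideal:
  fixes I :: "'a::comm_ring_1 set"
  assumes I: "0 \<in> I" "\<And>a b. a \<in> I \<Longrightarrow> b \<in> I \<Longrightarrow> a + b \<in> I" "\<And>r a. a \<in> I \<Longrightarrow> r * a \<in> I"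
  shows "\<lbrakk>\<And>i. i \<ge> length xs \<Longrightarrow> Polynomial.coeff U i = 0; \<And>x. x \<in> set xs \<Longrightarrow> poly U x \<in> I\<rbrakk>
    \<Longrightarrow> vandermonde xs * Polynomial.coeff U i \<in> I"
proof (induction xs arbitrary: U i)
  case Nil
  then show ?case using I(1) by simp
next
  case (Cons a bs)
  define U1 where "U1 = synthetic_div U a"
  define c where "c = (\<Prod>b\<leftarrow>bs. b - a)"
  have U: "U = [:- a, 1:] * U1 + [:poly U a:]"
    unfolding U1_def by (rule synthetic_div_correct'[symmetric])
  have diff: "u - v \<in> I" if "u \<in> I" "v \<in> I" for u v
    using I(2)[OF that(1) I(3)[OF that(2), of "-1"]] by simp
  have IH: "vandermonde bs * Polynomial.coeff (Polynomial.smult c U1) i \<in> I" for i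
  proof (rule Cons.IH)
    fix i assume i: "length bs \<le> i"
    have "Polynomial.degree U \<le> length bs"
      using Cons.prems(1) by (intro degree_le) auto
    have "Polynomial.coeff U1 i = 0"
    proof (cases "Polynomial.degree U = 0")
      case True
      then have "U1 = 0" unfolding U1_def by (rule iffD2[OF synthetic_div_eq_0_iff])
      then show ?thesis by simp
    next
      case False
      then have "Polynomial.degree U1 < i"
        using \<open>Polynomial.degree U \<le> length bs\<close> i by (simp add: U1_def degree_synthetic_div)
      then show ?thesis by (rule coeff_eq_0)
    qed
    then show "Polynomial.coeff (Polynomial.smult c U1) i = 0" by simp
  next
    fix b assume b: "b \<in> set bs"
    have "poly U b = (b - a) * poly U1 b + poly U a"
      by (subst U) (simp add: algebra_simps)
    then have "(b - a) * poly U1 b = poly U b - poly U a" by simp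
    then have 1: "(b - a) * poly U1 b \<in> I" using diff Cons.prems(2) b by simp
    have "(b - a) dvd c" unfolding c_def using b by (intro prod_list_dvd) auto
    then obtain c' where c': "c = (b - a) * c'" by (auto elim: dvdE)
    have "c' * ((b - a) * poly U1 b) \<in> I" by (rule I(3)[OF 1])
    then show "poly (Polynomial.smult c U1) b \<in> I" by (simp add: c' algebra_simps)
  qed
  have ci: "Polynomial.coeff U i = (case i of 0 \<Rightarrow> poly U a - a * Polynomial.coeff U1 0 | Suc j \<Rightarrow> Polynomial.coeff U1 j - a * Polynomial.coeff U1 (Suc j))"
    by (subst U) (auto simp: coeff_pCons split: nat.split)
  have s: "vandermonde (a # bs) * (a' * Polynomial.coeff U1 j) \<in> I" for j a'
    using I(3)[OF IH[of j], of a'] by (simp add: c_def algebra_simps)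
  have s1: "vandermonde (a # bs) * Polynomial.coeff U1 j \<in> I" for j using s[of 1] by simp
  have s2: "vandermonde (a # bs) * poly U a \<in> I" using I(3) Cons.prems(2)[of a] by simp
  show ?case
  proof (cases i)
    case 0
    then show ?thesis unfolding ci using diff[OF s2 s[of a 0]] by (simp only: right_diff_distrib nat.case)
  next
    case (Suc j)
    then show ?thesis unfolding ci using diff[OF s1[of j] s[of a "Suc j"]] by (simp only: right_diff_distrib nat.case)
  qed
qed

section \<open>Independent families and kernels\<close>

context vector_space
begin

lemma family_card_le:
  assumes J: "finite J" and indep: "\<And>c. (\<Sum>j\<in>J. scale (c j) (v j)) = 0 \<Longrightarrow> (\<forall>j\<in>J. c j = 0)"
    and sp: "v ` J \<subseteq> span F" and F: "finite F"
  shows "card J \<le> card F"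
proof -
  have inj: "inj_on v J"
  proof (rule inj_onI, rule ccontr)
    fix i j assume ij: "i \<in> J" "j \<in> J" "v i = v j" "i \<noteq> j"
    let ?c = "\<lambda>k. if k = i then 1 else if k = j then -1 else 0"
    have "(\<Sum>k\<in>J. scale (?c k) (v k)) = (\<Sum>k\<in>J. (if k = i then v i else 0) - (if k = j then v i else 0))"
      using ij by (intro sum.cong) auto
    also have "\<dots> = 0" using J ij by (simp add: sum_subtractf)
    finally show False using indep[of ?c] ij by auto
  qed
  have "independent (v ` J)"
  proof (rule independent_if_scalars_zero)
    show "finite (v ` J)" using J by simp
    fix f x assume 0: "(\<Sum>x\<in>v ` J. scale (f x) x) = 0" and x: "x \<in> v ` J"
    have "(\<Sum>j\<in>J. scale (f (v j)) (v j)) = 0" using 0 by (simp add: sum.reindex[OF inj])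
    then show "f x = 0" using indep[of "\<lambda>j. f (v j)"] x by auto
  qed
  then have "card (v ` J) \<le> card F" using independent_span_bound[OF F _ sp] by simp
  then show ?thesis by (simp add: card_image[OF inj])
qed

lemma independent_family:
  assumes "independent A" "finite A" "(\<Sum>a\<in>A. scale (c a) a) = 0" "a \<in> A"
  shows "c a = 0"
  by (rule independentD[OF assms(1,2) subset_refl assms(3,4)])

text \<open>Rank and nullity inside a space that is not assumed finite-dimensional: a basis \<open>N\<close> of the kernel of \<open>T\<close> on \<open>B\<close> is extended by \<open>C\<close> to a basis of \<open>B\<close>, and then \<open>T\<close> is injective on the span of \<open>C\<close>.\<close>

lemma kernel_complement:
  assumes B: "subspace B" and F: "finite F" "B \<subseteq> span F"
    and T: "\<And>x y. T (x + y) = T x + T y" "\<And>c x. T (scale c x) = scale c (T x)"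
  obtains N C where "finite N" "finite C" "N \<inter> C = {}" "N \<union> C \<subseteq> B" "independent (N \<union> C)"
    "card N + card C = dim B" "B \<subseteq> span (N \<union> C)" "\<And>x. x \<in> N \<Longrightarrow> T x = 0"
    "\<And>c. (\<Sum>x\<in>C. scale (c x) (T x)) = 0 \<Longrightarrow> (\<forall>x\<in>C. c x = 0)"
proof -
  let ?Z = "{x \<in> B. T x = 0}"
  have T0: "T 0 = 0" using T(2)[of 0 0] by simp
  have Tsum: "T (\<Sum>x\<in>Y. g x) = (\<Sum>x\<in>Y. T (g x))" for g :: "'b \<Rightarrow> 'b" and Y
    by (induction Y rule: infinite_finite_induct) (auto simp: T0 T)
  obtain N where N: "N \<subseteq> ?Z" "independent N" "?Z \<subseteq> span N"
    using maximal_independent_subset[of ?Z] by blast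
  obtain A where A: "N \<subseteq> A" "A \<subseteq> B" "independent A" "B \<subseteq> span A"
    using maximal_independent_subset_extend[of N B] N by blast
  have fA: "finite A" using independent_span_bound[OF F(1) A(3)] A F by blast
  then have fN: "finite N" using A(1) finite_subset by blast
  have dimA: "card A = dim B" using A basis_card_eq_dim by blast
  show ?thesis
  proof (rule that[of N "A - N"])
    show "card N + card (A - N) = dim B"
      using dimA card_Diff_subset[OF fN A(1)] card_mono[OF fA A(1)] by simp
    fix c assume "(\<Sum>x\<in>A - N. scale (c x) (T x)) = 0"
    then have "T (\<Sum>x\<in>A - N. scale (c x) x) = 0" by (simp add: Tsum T)
    moreover have "(\<Sum>x\<in>A - N. scale (c x) x) \<in> B"
      using A B by (intro subspace_sum subspace_scale) auto
    ultimately have "(\<Sum>x\<in>A - N. scale (c x) x) \<in> span N" using N by auto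
    then obtain d where d: "(\<Sum>x\<in>A - N. scale (c x) x) = (\<Sum>x\<in>N. scale (d x) x)"
      using span_finite[OF fN] by auto
    define e where "e x = (if x \<in> N then - d x else c x)" for x
    have "(\<Sum>x\<in>A. scale (e x) x) = (\<Sum>x\<in>A - N. scale (e x) x) + (\<Sum>x\<in>N. scale (e x) x)"
      using A(1) fA by (metis sum.subset_diff)
    also have "\<dots> = 0" using d by (simp add: e_def sum_negf)
    finally have "(\<Sum>x\<in>A. scale (e x) x) = 0" .
    then have "e x = 0" if "x \<in> A" for x using independent_family A fA that by blast
    then show "\<forall>x\<in>A - N. c x = 0" unfolding e_def by (metis DiffD1 DiffD2)
  qed (use A N fA fN in \<open>auto simp: Un_absorb1\<close>)
qed

end

lemma vector_space_mpoly: "vector_space (\<lambda>c (f :: ('n::finite, 'k::field) mpoly). mconst c * f)"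
  by unfold_locales (auto simp: algebra_simps mconst_simps)

interpretation mp: vector_space "\<lambda>c (f :: ('n::finite, 'k::field) mpoly). mconst c * f"
  by (rule vector_space_mpoly)

definition monomials :: "('n::finite \<Rightarrow>\<^sub>0 nat) set \<Rightarrow> ('n, 'k::field) mpoly set" where
  "monomials M = (\<lambda>m. Poly_Mapping.single m 1) ` M"

lemma card_monomials: "finite M \<Longrightarrow> card (monomials M) \<le> card M"
  unfolding monomials_def by (rule card_image_le)

lemma span_monomials:
  fixes f :: "('n::finite, 'k::field) mpoly"
  assumes "Poly_Mapping.keys f \<subseteq> M"
  shows "f \<in> mp.span (monomials M)"
proof -
  have "(\<Sum>m\<in>Poly_Mapping.keys f. Poly_Mapping.single m (Poly_Mapping.lookup f m)) \<in> mp.span (monomials M)"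
  proof (rule mp.span_sum)
    fix m assume "m \<in> Poly_Mapping.keys f"
    then have "Poly_Mapping.single m 1 \<in> mp.span (monomials M :: ('n, 'k) mpoly set)"
      using assms by (auto intro!: mp.span_base simp: monomials_def)
    from mp.span_scale[OF this, of "Poly_Mapping.lookup f m"]
    show "Poly_Mapping.single m (Poly_Mapping.lookup f m) \<in> mp.span (monomials M)"
      by (simp add: mconst_def mult_single)
  qed
  then show ?thesis by (subst mpoly_sum_monomials)
qed

lemma trunc_in_span: "trunc q f \<in> mp.span (monomials (expbox (\<lambda>_. q)))"
  by (rule span_monomials) (auto simp: in_keys_iff lookup_trunc split: if_splits)

section \<open>The group action and the Reynolds operator\<close>

lemma act_eq_poly_ev: "act g = poly_ev mconst (act_var g)"
  by (rule ext) (simp add: act_def poly_ev_def)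

lemma ring_map_act: "ring_map (act g)"
  unfolding act_eq_poly_ev by (rule ring_map_poly_ev[OF ring_map_mconst])

lemmas act_add = ring_map_add[OF ring_map_act]
  and act_mult = ring_map_mult[OF ring_map_act]
  and act_diff = ring_map_diff[OF ring_map_act]
  and act_minus = ring_map_minus[OF ring_map_act]
  and act_sum = ring_map_sum[OF ring_map_act]
  and act_prod = ring_map_prod[OF ring_map_act]
  and act_power = ring_map_power[OF ring_map_act]
  and act_0 = ring_map_0[OF ring_map_act]
  and act_1 = ring_map_1[OF ring_map_act]

lemma act_mconst: "act g (mconst c) = mconst c"
  by (simp add: act_eq_poly_ev poly_ev_mconst ring_map_mconst)

lemma act_mvar: "act g (mvar i) = act_var g i"
  by (simp add: act_eq_poly_ev poly_ev_mvar ring_map_mconst)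

lemma act_var_eq_lin: "act_var g j = lin (\<lambda>i. g $ i $ j)"
  by (simp add: act_var_def lin_def)

lemma ring_map_compose: "ring_map h \<Longrightarrow> ring_map h' \<Longrightarrow> ring_map (\<lambda>x. h (h' x))"
  by (simp add: ring_map_def)

lemma act_act: "act g (act h f) = act (g ** h) f"
  for g h :: "'k::field ^ 'n::finite ^ 'n"
proof (rule ring_map_eqI[OF ring_map_compose[OF ring_map_act ring_map_act] ring_map_act])
  fix j
  have "act g (act h (mvar j)) = (\<Sum>l\<in>UNIV. \<Sum>i\<in>UNIV. mconst (g $ i $ l * h $ l $ j) * mvar i)"
    by (simp add: act_mvar act_var_def act_sum act_mult act_mconst sum_distrib_left mconst_simps algebra_simps)
  also have "\<dots> = (\<Sum>i\<in>UNIV. \<Sum>l\<in>UNIV. mconst (g $ i $ l * h $ l $ j) * mvar i)"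
    by (rule sum.swap)
  also have "\<dots> = act (g ** h) (mvar j)"
    by (simp add: act_mvar act_var_def matrix_matrix_mult_def sum_distrib_right ring_map_sum[OF ring_map_mconst])
  finally show "act g (act h (mvar j)) = act (g ** h) (mvar j)" .
qed (simp add: act_mconst)

lemma act_mat_1: "act (mat 1) f = (f :: ('n::finite, 'k::field) mpoly)"
proof (rule ring_map_eqI[OF ring_map_act ring_map_id])
  fix j :: 'n
  have "act (mat 1) (mvar j) = (\<Sum>i\<in>UNIV. if i = j then mvar i else (0 :: ('n, 'k) mpoly))"
    unfolding act_mvar act_var_def by (rule sum.cong) (auto simp: mat_def mconst_simps)
  then show "act (mat 1) (mvar j) = (mvar j :: ('n, 'k) mpoly)" by simp
qed (simp add: act_mconst)

lemma cterm_lin [simp]: "cterm (lin c) = 0"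
  by (simp add: lin_def lookup_sum lookup_mconst_mult)

lemma cterm_act: "cterm (act g f) = cterm f"
  by (rule ring_map_eqI[OF ring_map_compose[OF ring_map_cterm ring_map_act] ring_map_cterm])
    (simp_all add: act_mconst act_mvar act_var_eq_lin)

definition invs :: "('k::field ^ 'n::finite ^ 'n) set \<Rightarrow> ('n, 'k) mpoly set" where
  "invs G = {f. \<forall>g\<in>G. act g f = f}"

lemma invs_0: "0 \<in> invs G" and invs_1: "1 \<in> invs G"
  and invs_add: "a \<in> invs G \<Longrightarrow> b \<in> invs G \<Longrightarrow> a + b \<in> invs G"
  and invs_mult: "a \<in> invs G \<Longrightarrow> b \<in> invs G \<Longrightarrow> a * b \<in> invs G"
  and invs_minus: "a \<in> invs G \<Longrightarrow> - a \<in> invs G"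
  and invs_diff: "a \<in> invs G \<Longrightarrow> b \<in> invs G \<Longrightarrow> a - b \<in> invs G"
  and invs_mconst: "mconst c \<in> invs G"
  by (auto simp: invs_def act_0 act_1 act_add act_mult act_minus act_diff act_mconst)

lemma invs_power: "a \<in> invs G \<Longrightarrow> a ^ n \<in> invs G"
  by (induction n) (auto intro: invs_1 invs_mult)

lemma invs_sum: "(\<And>x. x \<in> A \<Longrightarrow> f x \<in> invs G) \<Longrightarrow> sum f A \<in> invs G"
  by (induction A rule: infinite_finite_induct) (auto intro: invs_0 invs_add)

lemma group_GL: "group (GL :: ('k::field ^ 'n::finite ^ 'n) monoid)"
proof (rule groupI)
  fix x :: "'k ^ 'n ^ 'n" assume "x \<in> carrier GL"
  then show "\<exists>y\<in>carrier GL. y \<otimes>\<^bsub>GL\<^esub> x = \<one>\<^bsub>GL\<^esub>"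
    by (auto simp: GL_def invertible_def)
next
  fix x y :: "'k ^ 'n ^ 'n" assume "x \<in> carrier GL" "y \<in> carrier GL"
  then show "x \<otimes>\<^bsub>GL\<^esub> y \<in> carrier GL"
    by (simp add: GL_def invertible_mult)
next
  show "\<one>\<^bsub>GL\<^esub> \<in> carrier (GL :: ('k ^ 'n ^ 'n) monoid)"
    by (auto simp: GL_def invertible_def intro: exI[of _ "mat 1"])
qed (simp_all add: GL_def matrix_mul_assoc)

locale lin_group =
  fixes G :: "('k::field ^ 'n::finite ^ 'n) set" and p :: nat
  assumes p_pos: "p > 0" and char: "CHAR('k) = p"
    and subG: "subgroup G GL" and finG: "finite G" and card_ndvd: "\<not> p dvd card G"
begin

lemma prime_p: "Factorial_Ring.prime p"
  using p_pos char prime_CHAR_semidom[where ?'a = 'k] by simp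

lemma p_gt_1: "p > 1"
  by (rule prime_gt_1_nat[OF prime_p])

lemma prime_CHAR_poly: "Factorial_Ring.prime CHAR(('n, 'k) mpoly)"
  using prime_p char by (simp add: CHAR_mpoly)

lemma frob_add: "(f + g :: ('n, 'k) mpoly) ^ (p ^ e) = f ^ (p ^ e) + g ^ (p ^ e)"
  using frobenius_add[OF prime_CHAR_poly, of f g e] by (simp add: CHAR_mpoly char)

lemma frob_sum: "(\<Sum>x\<in>A. f x :: ('n, 'k) mpoly) ^ (p ^ e) = (\<Sum>x\<in>A. f x ^ (p ^ e))"
  using frobenius_sum[OF prime_CHAR_poly, of f A e] by (simp add: CHAR_mpoly char)

lemma frob_add_field: "(a + b :: 'k) ^ (p ^ e) = a ^ (p ^ e) + b ^ (p ^ e)"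
  using frobenius_add[where ?'a = 'k, of a b e] prime_p by (simp add: char)

lemma frob_inj_field: "(a :: 'k) ^ (p ^ e) = b ^ (p ^ e) \<Longrightarrow> a = b"
proof -
  assume "a ^ (p ^ e) = b ^ (p ^ e)"
  moreover have "(b + (a - b)) ^ (p ^ e) = b ^ (p ^ e) + (a - b) ^ (p ^ e)" by (rule frob_add_field)
  ultimately have "(a - b) ^ (p ^ e) = 0" by simp
  then show ?thesis by simp
qed

lemma mat_1_in: "mat 1 \<in> G"
  using subgroup.one_closed[OF subG] by (simp add: GL_def)

lemma mult_in: "g \<in> G \<Longrightarrow> h \<in> G \<Longrightarrow> g ** h \<in> G"
  using subgroup.m_closed[OF subG] by (simp add: GL_def)

lemma inverse_in:
  assumes "g \<in> G" obtains h where "h \<in> G" "g ** h = mat 1" "h ** g = mat 1"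
proof -
  have "g \<in> carrier GL" using assms subgroup.subset[OF subG] by auto
  then show ?thesis
    using that[of "inv\<^bsub>GL\<^esub> g"] subgroup.m_inv_closed[OF subG assms]
      group.r_inv[OF group_GL, of g] group.l_inv[OF group_GL, of g] by (simp add: GL_def)
qed

lemma card_G_pos: "card G > 0"
  using mat_1_in finG by (auto simp: card_gt_0_iff)

lemma bij_left_mult: "h \<in> G \<Longrightarrow> bij_betw (\<lambda>g. h ** g) G G"
proof -
  assume "h \<in> G"
  then obtain k where k: "k \<in> G" "h ** k = mat 1" "k ** h = mat 1" by (rule inverse_in)
  show ?thesis
    by (rule bij_betw_byWitness[where f' = "\<lambda>g. k ** g"])
      (auto simp: matrix_mul_assoc k mult_in \<open>h \<in> G\<close>)
qed

lemma of_nat_card_G: "of_nat (card G) \<noteq> (0 :: 'k)"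
  using card_ndvd char by (simp add: of_nat_eq_0_iff_char_dvd)

text \<open>The sum over the group; with the division by the group order it gives the Reynolds operator, which is where the order must be prime to \<open>p\<close>.\<close>

definition tr :: "('n, 'k) mpoly \<Rightarrow> ('n, 'k) mpoly" where
  "tr f = (\<Sum>g\<in>G. act g f)"

definition reyn :: "('n, 'k) mpoly \<Rightarrow> ('n, 'k) mpoly" where
  "reyn f = mconst (1 / of_nat (card G)) * tr f"

lemma act_invs: "r \<in> invs G \<Longrightarrow> g \<in> G \<Longrightarrow> act g r = r"
  by (simp add: invs_def)

lemma tr_add: "tr (f + g) = tr f + tr g"
  by (simp add: tr_def act_add sum.distrib)

lemma tr_mult: "r \<in> invs G \<Longrightarrow> tr (r * f) = r * tr f"
  by (simp add: tr_def act_mult act_invs sum_distrib_left)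

lemma tr_0 [simp]: "tr 0 = 0" by (simp add: tr_def act_0)

lemma tr_invs: "tr f \<in> invs G"
proof -
  have "act h (tr f) = tr f" if "h \<in> G" for h
    using sum.reindex_bij_betw[OF bij_left_mult[OF that], of "\<lambda>g. act g f"]
    by (simp add: tr_def act_sum act_act)
  then show ?thesis by (simp add: invs_def)
qed

lemma tr_of_invs: "r \<in> invs G \<Longrightarrow> tr r = mconst (of_nat (card G)) * r"
proof -
  assume "r \<in> invs G"
  then have "tr r = of_nat (card G) * r" by (simp add: tr_def act_invs)
  also have "of_nat (card G) = (mconst (of_nat (card G)) :: ('n, 'k) mpoly)"
    by (simp add: mconst_def)
  finally show ?thesis .
qed

lemma reyn_of_invs: "r \<in> invs G \<Longrightarrow> reyn r = r"
  by (simp add: reyn_def tr_of_invs of_nat_card_G flip: mult.assoc mconst_simps(1))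

lemma reyn_invs: "reyn f \<in> invs G"
  by (simp add: reyn_def tr_invs invs_mult invs_mconst)

lemma reyn_add: "reyn (f + g) = reyn f + reyn g"
  by (simp add: reyn_def tr_add algebra_simps)

lemma reyn_0 [simp]: "reyn 0 = 0" by (simp add: reyn_def)

lemma reyn_sum: "reyn (sum f A) = (\<Sum>a\<in>A. reyn (f a))"
  by (induction A rule: infinite_finite_induct) (auto simp: reyn_add)

lemma reyn_mult: "r \<in> invs G \<Longrightarrow> reyn (r * f) = r * reyn f"
  by (simp add: reyn_def tr_mult mult.left_commute)

lemma cterm_tr: "cterm (tr f) = of_nat (card G) * cterm f"
  by (simp add: tr_def lookup_sum cterm_act)

lemma cterm_reyn: "cterm (reyn f) = cterm f"
  by (simp add: reyn_def lookup_mconst_mult cterm_tr of_nat_card_G)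

lemma lin_power: "lin c ^ (p ^ e) = (\<Sum>i\<in>UNIV. mconst (c i ^ (p ^ e)) * mvar i ^ (p ^ e))"
  for c :: "'n \<Rightarrow> 'k"
  by (simp add: lin_def frob_sum power_mult_distrib ring_map_power[OF ring_map_mconst])

text \<open>The group acts linearly on the variables, and \<open>p\<^sup>e\<close>-th powers are additive, so the power of a linear form is a combination of the powers of the variables.\<close>

lemma frob_ideal_act:
  fixes f :: "('n, 'k) mpoly"
  assumes "f \<in> frob_ideal (p ^ e)"
  shows "act g f \<in> frob_ideal (p ^ e)"
proof -
  obtain s where "f = (\<Sum>i\<in>UNIV. s i * mvar i ^ (p ^ e))" using assms by (rule frob_ideal_decomp)
  then have "act g f = (\<Sum>i\<in>UNIV. act g (s i) * act_var g i ^ (p ^ e))"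
    by (simp add: act_sum act_mult act_power act_mvar)
  also have "\<dots> \<in> frob_ideal (p ^ e)"
    unfolding act_var_eq_lin lin_power
    by (intro frob_ideal_sum frob_ideal_mult mvar_power_frob_ideal)
  finally show ?thesis .
qed

section \<open>A separating element and its trace expansion\<close>

text \<open>Distinct \<open>p\<close>-powers put the conjugates of the variables in different degrees and keep the action on them readable, since raising to a \<open>p\<close>-power is injective on the field. So the group elements are told apart by their values at this single polynomial, over finite fields too.\<close>

definition sep :: "('n, 'k) mpoly" where
  "sep = (\<Sum>i\<in>UNIV. mvar i ^ (p ^ exp_index i))"

lemma lookup_act_sep:
  "Poly_Mapping.lookup (act g sep) (Poly_Mapping.single l (p ^ exp_index j)) = (g $ l $ j) ^ (p ^ exp_index j)"
proof -
  have *: "p ^ exp_index i = p ^ exp_index j \<longleftrightarrow> i = j" for i j :: 'n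
    using p_gt_1 by (simp add: inj_eq[OF inj_exp_index])
  have pos: "p ^ a > 0" for a :: nat using p_pos by simp
  have "Poly_Mapping.lookup (mvar i' ^ (p ^ exp_index i) :: ('n,'k) mpoly) (Poly_Mapping.single l (p ^ exp_index j)) =
     (if i' = l \<and> i = j then 1 else 0)" for i i'
  proof -
    have "Poly_Mapping.single i' (p ^ exp_index i) = Poly_Mapping.single l (p ^ exp_index j) \<longleftrightarrow> i' = l \<and> i = j"
      using pos * by (metis lookup_single_eq lookup_single_not_eq less_irrefl)
    then show ?thesis by (auto simp: mvar_power lookup_single when_def)
  qed
  then have "Poly_Mapping.lookup (act g sep) (Poly_Mapping.single l (p ^ exp_index j)) =
     (\<Sum>i\<in>UNIV. \<Sum>i'\<in>UNIV. if i' = l \<and> i = j then (g $ i' $ i) ^ (p ^ exp_index i) else 0)"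
    by (simp add: sep_def act_sum act_power act_mvar act_var_eq_lin lin_power lookup_sum lookup_mconst_mult
        if_distrib[of "(*) _"] cong: if_cong)
  also have "\<dots> = (\<Sum>i\<in>UNIV. if i = j then (g $ l $ i) ^ (p ^ exp_index i) else 0)"
  proof (rule sum.cong[OF refl])
    fix i
    show "(\<Sum>i'\<in>UNIV. if i' = l \<and> i = j then (g $ i' $ i) ^ (p ^ exp_index i) else 0) =
      (if i = j then (g $ l $ i) ^ (p ^ exp_index i) else 0)"
      by (cases "i = j") auto
  qed
  also have "\<dots> = (g $ l $ j) ^ (p ^ exp_index j)" by simp
  finally show ?thesis .
qed

lemma act_sep_inj: "act g sep = act h sep \<Longrightarrow> g = h"
proof -
  assume "act g sep = act h sep"
  then have "(g $ l $ j) ^ (p ^ exp_index j) = (h $ l $ j) ^ (p ^ exp_index j)" for l j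
    by (metis lookup_act_sep)
  then have "g $ l $ j = h $ l $ j" for l j using frob_inj_field by blast
  then show "g = h" by (simp add: vec_eq_iff)
qed

text \<open>As a polynomial in a new variable it vanishes at all conjugates of \<open>sep\<close> except \<open>sep\<close> itself.\<close>

definition conj_poly :: "('n, 'k) mpoly poly" where
  "conj_poly = (\<Prod>g\<in>G - {mat 1}. [:act g sep, -1:])"

definition diff_prod :: "('n, 'k) mpoly" where
  "diff_prod = (\<Prod>g\<in>G - {mat 1}. act g sep - sep)"

lemma diff_prod_nonzero: "diff_prod \<noteq> 0"
  using act_sep_inj[of _ "mat 1"] finG
  by (auto simp: diff_prod_def mpoly_prod_eq_0 act_mat_1)

lemma poly_conj_poly: "h \<in> G \<Longrightarrow> poly conj_poly (act h sep) = (if h = mat 1 then diff_prod else 0)"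
proof -
  assume h: "h \<in> G"
  have "poly conj_poly (act h sep) = (\<Prod>g\<in>G - {mat 1}. act g sep - act h sep)"
    by (simp add: conj_poly_def poly_prod)
  also have "\<dots> = (if h = mat 1 then diff_prod else 0)"
    using h finG by (auto simp: diff_prod_def act_mat_1 mpoly_prod_eq_0)
  finally show ?thesis .
qed

lemma degree_conj_poly: "Polynomial.degree conj_poly \<le> card G - 1"
proof -
  have "Polynomial.degree conj_poly \<le> (\<Sum>g\<in>G - {mat 1}. Polynomial.degree [:act g sep, -1:])"
    unfolding conj_poly_def
    using degree_prod_sum_le[OF finite_Diff[OF finG], of "\<lambda>g. [:act g sep, -1:]"] by (simp add: o_def)
  also have "\<dots> \<le> (\<Sum>g\<in>G - {mat 1}. 1)" by (rule sum_mono) auto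
  finally show ?thesis using finG mat_1_in by simp
qed

lemma poly_sum_less:
  fixes U :: "'a::comm_ring_1 poly"
  assumes "Polynomial.degree U < n"
  shows "poly U x = (\<Sum>j<n. Polynomial.coeff U j * x ^ j)"
  unfolding poly_altdef
  by (intro sum.mono_neutral_left) (use assms in \<open>auto intro!: le_degree\<close>)

text \<open>Up to the fixed factor \<open>diff_prod\<close>, the polynomial ring is generated over the invariants by as many elements as the group has. Expanding the traces and exchanging the sums produces the values of \<open>conj_poly\<close> at the conjugates of \<open>sep\<close>, and all but one of them vanish.\<close>

lemma diff_prod_mult_expansion:
  "diff_prod * f = (\<Sum>j<card G. Polynomial.coeff conj_poly j * tr (sep ^ j * f))"
proof -
  have deg: "Polynomial.degree conj_poly < card G" using degree_conj_poly card_G_pos by linarith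
  have "(\<Sum>j<card G. Polynomial.coeff conj_poly j * tr (sep ^ j * f)) =
      (\<Sum>j<card G. \<Sum>h\<in>G. Polynomial.coeff conj_poly j * act h sep ^ j * act h f)"
    by (simp add: tr_def act_mult act_power sum_distrib_left mult.assoc)
  also have "\<dots> = (\<Sum>h\<in>G. \<Sum>j<card G. Polynomial.coeff conj_poly j * act h sep ^ j * act h f)"
    by (rule sum.swap)
  also have "\<dots> = (\<Sum>h\<in>G. poly conj_poly (act h sep) * act h f)"
    by (simp add: poly_sum_less[OF deg] sum_distrib_right)
  also have "\<dots> = (\<Sum>h\<in>G. if h = mat 1 then diff_prod * f else 0)"
    by (rule sum.cong) (auto simp: poly_conj_poly act_mat_1)
  also have "\<dots> = diff_prod * f" using finG mat_1_in by simp
  finally show ?thesis by simp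
qed

lemma vandermonde_nonzero:
  fixes xs :: "('n, 'k) mpoly list"
  shows "distinct xs \<Longrightarrow> vandermonde xs \<noteq> 0"
proof (induction xs)
  case (Cons a bs)
  have "(\<Prod>b\<leftarrow>bs. b - a) \<noteq> 0 " if "a \<notin> set bs" for bs :: "('n, 'k) mpoly list"
    using that by (induction bs) (auto simp: mpoly_mult_eq_0)
  then show ?case using Cons by (auto simp: mpoly_mult_eq_0)
qed simp

text \<open>Conversely, the powers of \<open>sep\<close> are independent over the invariants modulo every Frobenius power, up to a fixed factor: the invariance of the coefficients and of the ideal turns the single relation at \<open>sep\<close> into one at each conjugate, and Newton interpolation recovers the coefficients.\<close>

lemma discriminant:
  obtains D :: "('n, 'k) mpoly" where "D \<noteq> 0"
    "\<And>e r j. \<lbrakk>\<And>j. j < card G \<Longrightarrow> r j \<in> invs G; (\<Sum>j<card G. r j * sep ^ j) \<in> frob_ideal (p ^ e); j < card G\<rbrakk>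
      \<Longrightarrow> D * r j \<in> frob_ideal (p ^ e)"
proof -
  obtain gs where gs: "set gs = G" "distinct gs" using finite_distinct_list[OF finG] by blast
  have len: "length gs = card G" using gs distinct_card by metis
  define xs where "xs = map (\<lambda>g. act g sep) gs"
  have "distinct xs"
    unfolding xs_def distinct_map using gs by (auto intro!: inj_onI act_sep_inj)
  show ?thesis
  proof (rule that[of "vandermonde xs"])
    show "vandermonde xs \<noteq> 0" by (rule vandermonde_nonzero) fact
    fix e r j
    assume r: "\<And>j. j < card G \<Longrightarrow> r j \<in> invs G"
      and I: "(\<Sum>j<card G. r j * sep ^ j) \<in> frob_ideal (p ^ e)" and j: "j < card G"
    define U where "U = (\<Sum>j<card G. Polynomial.monom (r j) j)"
    have cU: "Polynomial.coeff U i = (if i < card G then r i else 0)" for i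
      by (simp add: U_def coeff_sum sum.delta' if_distrib)
    have pU: "poly U x = (\<Sum>j<card G. r j * x ^ j)" for x
      by (simp add: U_def poly_sum poly_monom)
    have "vandermonde xs * Polynomial.coeff U j \<in> frob_ideal (p ^ e)"
    proof (rule newton_ideal)
      show "Polynomial.coeff U i = 0" if "i \<ge> length xs" for i
        using that by (simp add: cU xs_def len)
      fix x assume "x \<in> set xs"
      then obtain g where g: "g \<in> G" "x = act g sep" by (auto simp: xs_def gs)
      have "poly U x = act g (\<Sum>j<card G. r j * sep ^ j)"
        unfolding pU act_sum act_mult act_power g(2)
        by (rule sum.cong) (use r g act_invs in auto)
      then show "poly U x \<in> frob_ideal (p ^ e)" using frob_ideal_act[OF I] by simp
    qed (auto intro: frob_ideal_0 frob_ideal_add frob_ideal_mult)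
    then show "vandermonde xs * r j \<in> frob_ideal (p ^ e)" using j by (simp add: cU)
  qed
qed

end

section \<open>Counting invariants modulo a Frobenius power\<close>

text \<open>The monomials that stay among the normal forms after multiplication by \<open>x\<^sup>\<mu>\<close>. For fixed \<open>\<mu>\<close> almost all of the \<open>q\<^sup>d\<close> normal monomials have this property.\<close>

definition shifted_box :: "nat \<Rightarrow> ('n::finite \<Rightarrow>\<^sub>0 nat) \<Rightarrow> ('n \<Rightarrow>\<^sub>0 nat) set" where
  "shifted_box q \<mu> = expbox (\<lambda>i. q - Poly_Mapping.lookup \<mu> i)"

lemma finite_shifted_box [simp]: "finite (shifted_box q \<mu>)"
  by (simp add: shifted_box_def)

lemma shifted_box_iff: "m \<in> shifted_box q \<mu> \<longleftrightarrow> \<mu> + m \<in> expbox (\<lambda>_. q)"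
  by (auto simp: shifted_box_def expbox_def lookup_add less_diff_conv add.commute)

lemma shifted_box_subset: "shifted_box q \<mu> \<subseteq> expbox (\<lambda>_. q)"
  by (auto simp: shifted_box_def expbox_def intro: less_le_trans)

lemma card_shifted_box: "card (shifted_box q \<mu>) = (\<Prod>i\<in>UNIV. q - Poly_Mapping.lookup \<mu> i)"
  by (simp add: shifted_box_def card_expbox)

text \<open>The product of the minimal terms of \<open>D\<close> and \<open>g\<close> survives reduction modulo the Frobenius power. So multiplication by a fixed nonzero polynomial is injective on a subspace of almost full dimension.\<close>

lemma mult_shifted_box_eq_0:
  fixes D g :: "('n::finite, 'k::field) mpoly"
  assumes \<mu>: "Poly_Mapping.lookup D \<mu> \<noteq> 0"
    "\<And>m'. Poly_Mapping.lookup D m' \<noteq> 0 \<Longrightarrow> m' \<noteq> \<mu> \<Longrightarrow> exp_embed \<mu> < exp_embed m'"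
    and g: "Poly_Mapping.keys g \<subseteq> shifted_box q \<mu>" and I: "D * g \<in> frob_ideal q"
  shows "g = 0"
proof (rule ccontr)
  assume "g \<noteq> 0"
  then obtain n where n: "Poly_Mapping.lookup g n \<noteq> 0"
    "\<And>m'. Poly_Mapping.lookup g m' \<noteq> 0 \<Longrightarrow> m' \<noteq> n \<Longrightarrow> exp_embed n < exp_embed m'"
    using minimal_monomial by blast
  have "Poly_Mapping.lookup (D * g) (\<mu> + n) = Poly_Mapping.lookup D \<mu> * Poly_Mapping.lookup g n"
    by (rule lookup_mult_minimal[OF \<mu>(2) n(2)])
  moreover have "n \<in> shifted_box q \<mu>" using g n(1) by (auto simp: in_keys_iff)
  ultimately show False using I \<mu>(1) n(1) by (auto simp: shifted_box_iff frob_ideal_def)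
qed

lemma trunc_mult_trunc: "trunc q (a * trunc q t) = trunc q (a * t)"
proof -
  have "trunc q t - t \<in> frob_ideal q" using trunc_trunc trunc_eq_iff by blast
  then have "a * (trunc q t - t) \<in> frob_ideal q" by (rule frob_ideal_mult)
  then show ?thesis by (simp add: trunc_eq_iff algebra_simps)
qed

lemma monomial_combination_eq_0:
  fixes c :: "('n::finite \<Rightarrow>\<^sub>0 nat) \<Rightarrow> 'k::field"
  assumes "finite M" "(\<Sum>m\<in>M. mconst (c m) * Poly_Mapping.single m 1) = 0" "m \<in> M"
  shows "c m = 0"
proof -
  have "Poly_Mapping.lookup (\<Sum>m\<in>M. mconst (c m) * Poly_Mapping.single m 1) m = c m"
    using assms(1,3) by (simp add: lookup_sum lookup_mconst_mult lookup_single when_def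
        if_distrib[of "(*) _"] cong: if_cong)
  then show ?thesis using assms(2) by simp
qed

lemma keys_monomial_combination:
  "Poly_Mapping.keys (\<Sum>m\<in>M. mconst (c m) * Poly_Mapping.single m 1) \<subseteq> M"
  for c :: "('n::finite \<Rightarrow>\<^sub>0 nat) \<Rightarrow> 'k::field"
proof (cases "finite M")
  case True
  then show ?thesis
    by (auto simp: in_keys_iff lookup_sum lookup_mconst_mult lookup_single when_def
        if_distrib[of "(*) _"] split: if_splits cong: if_cong)
qed simp

context lin_group
begin

text \<open>The dimension of the invariants modulo the Frobenius power, which will be shown to be the length in the definition of the multiplicity.\<close>

definition ldim :: "nat \<Rightarrow> nat" where
  "ldim e = mp.dim (trunc (p ^ e) ` invs G)"

lemma subspace_trunc_invs: "mp.subspace (trunc q ` invs G)"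
  unfolding mp.subspace_def
proof (intro conjI ballI allI)
  show "0 \<in> trunc q ` invs G" by (rule image_eqI[of _ _ 0]) (auto simp: invs_0)
  fix x assume "x \<in> trunc q ` invs G"
  then obtain r where r: "r \<in> invs G" "x = trunc q r" by auto
  show "mconst c * x \<in> trunc q ` invs G" for c
    by (rule image_eqI[of _ _ "mconst c * r"]) (simp_all add: r trunc_scale invs_mult invs_mconst)
  fix y assume "y \<in> trunc q ` invs G"
  then obtain s where s: "s \<in> invs G" "y = trunc q s" by auto
  show "x + y \<in> trunc q ` invs G"
    by (rule image_eqI[of _ _ "r + s"]) (simp_all add: r s trunc_add invs_add)
qed

lemma trunc_image_span: "trunc q ` X' \<subseteq> mp.span (monomials (expbox (\<lambda>_. q)))"
  using trunc_in_span by blast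

lemma finite_monomials: "finite M \<Longrightarrow> finite (monomials M)"
  by (simp add: monomials_def)

lemma trunc_invs_basis:
  obtains B where "finite B" "B \<subseteq> trunc q ` invs G" "mp.independent B" "trunc q ` invs G \<subseteq> mp.span B"
    "card B = mp.dim (trunc q ` invs G)"
proof -
  obtain B where B: "B \<subseteq> trunc q ` invs G" "mp.independent B" "trunc q ` invs G \<subseteq> mp.span B"
    "card B = mp.dim (trunc q ` invs G)"
    using mp.basis_exists[of "trunc q ` invs G"] by blast
  have "B \<subseteq> mp.span (monomials (expbox (\<lambda>_. q)))" using B(1) trunc_image_span by blast
  from mp.independent_span_bound[OF finite_monomials[OF finite_expbox] B(2) this]
  have "finite B" ..
  then show ?thesis using that B by blast
qed

text \<open>The multiples of \<open>diff_prod\<close> have almost full dimension modulo the Frobenius power, and \<open>diff_prod_mult_expansion\<close> puts them into a sum of \<open>card G\<close> images of the space of invariants.\<close>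

lemma ldim_lower:
  obtains \<mu> :: "'n \<Rightarrow>\<^sub>0 nat" where "\<And>e. card (shifted_box (p ^ e) \<mu>) \<le> card G * ldim e"
proof -
  obtain \<mu> where \<mu>: "Poly_Mapping.lookup diff_prod \<mu> \<noteq> 0"
    "\<And>m'. Poly_Mapping.lookup diff_prod m' \<noteq> 0 \<Longrightarrow> m' \<noteq> \<mu> \<Longrightarrow> exp_embed \<mu> < exp_embed m'"
    using minimal_monomial[OF diff_prod_nonzero] by blast
  have "card (shifted_box (p ^ e) \<mu>) \<le> card G * ldim e" for e
  proof -
    define q where "q = p ^ e"
    let ?a = "\<lambda>j. Polynomial.coeff conj_poly j"
    obtain B where B: "finite B" "trunc q ` invs G \<subseteq> mp.span B" "card B = mp.dim (trunc q ` invs G)"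
      using trunc_invs_basis by metis
    define F where "F = (\<lambda>(j, b). trunc q (?a j * b)) ` ({..<card G} \<times> B)"
    define v :: "('n \<Rightarrow>\<^sub>0 nat) \<Rightarrow> ('n, 'k) mpoly" where "v m = trunc q (diff_prod * Poly_Mapping.single m 1)" for m
    have F: "finite F" "card F \<le> card G * card B"
      using B(1) card_image_le[of "{..<card G} \<times> B" "\<lambda>(j, b). trunc q (?a j * b)"] by (auto simp: F_def)
    have step: "trunc q (?a j * t) \<in> mp.span F" if j: "j < card G" and t: "t \<in> invs G" for j t
    proof -
      have "trunc q t \<in> mp.span B" using B(2) t by blast
      then obtain c where c: "trunc q t = (\<Sum>b\<in>B. mconst (c b) * b)"
        using mp.span_finite[OF B(1)] by auto
      have "trunc q (?a j * t) = trunc q (?a j * trunc q t)" by (simp add: trunc_mult_trunc)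
      also have "\<dots> = (\<Sum>b\<in>B. mconst (c b) * trunc q (?a j * b))"
        by (simp add: c sum_distrib_left trunc_sum mult.left_commute[of "?a j"] trunc_scale)
      also have "\<dots> \<in> mp.span F"
        using j by (intro mp.span_sum mp.span_scale mp.span_base) (auto simp: F_def)
      finally show ?thesis .
    qed
    have "card (shifted_box q \<mu>) \<le> card F"
    proof (rule mp.family_card_le[where v = v])
      show "v ` shifted_box q \<mu> \<subseteq> mp.span F"
        by (auto simp: v_def diff_prod_mult_expansion trunc_sum tr_invs intro!: mp.span_sum step)
      fix c assume "(\<Sum>m\<in>shifted_box q \<mu>. mconst (c m) * v m) = 0"
      then have "trunc q (diff_prod * (\<Sum>m\<in>shifted_box q \<mu>. mconst (c m) * Poly_Mapping.single m 1)) = 0"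
        by (simp add: v_def sum_distrib_left trunc_sum mult.left_commute[of diff_prod] trunc_scale)
      then have "(\<Sum>m\<in>shifted_box q \<mu>. mconst (c m) * Poly_Mapping.single m 1) = 0"
        by (intro mult_shifted_box_eq_0[OF \<mu> keys_monomial_combination]) (simp_all add: trunc_eq_0_iff)
      then show "\<forall>m\<in>shifted_box q \<mu>. c m = 0" using monomial_combination_eq_0[OF finite_shifted_box] by blast
    qed (simp_all add: F)
    then show ?thesis using F B(3) by (simp add: q_def ldim_def)
  qed
  then show ?thesis by (rule that)
qed

text \<open>The products of invariants with the powers of \<open>sep\<close> are independent as soon as the invariants remain independent after multiplication by the factor \<open>D\<close> of \<open>discriminant\<close>. Only few invariants are lost this way, because \<open>D\<close> is injective on almost all normal monomials.\<close>

lemma ldim_upper: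
  obtains \<mu> :: "'n \<Rightarrow>\<^sub>0 nat" where "\<And>e. card G * ldim e \<le> (p ^ e) ^ CARD('n) + card G * ((p ^ e) ^ CARD('n) - card (shifted_box (p ^ e) \<mu>))"
proof -
  obtain D :: "('n, 'k) mpoly" where D0: "D \<noteq> 0" and
    D: "\<And>e r j. \<lbrakk>\<And>j. j < card G \<Longrightarrow> r j \<in> invs G; (\<Sum>j<card G. r j * sep ^ j) \<in> frob_ideal (p ^ e); j < card G\<rbrakk>
      \<Longrightarrow> D * r j \<in> frob_ideal (p ^ e)"
    using discriminant by blast
  obtain \<mu> where \<mu>: "Poly_Mapping.lookup D \<mu> \<noteq> 0"
    "\<And>m'. Poly_Mapping.lookup D m' \<noteq> 0 \<Longrightarrow> m' \<noteq> \<mu> \<Longrightarrow> exp_embed \<mu> < exp_embed m'"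
    using minimal_monomial[OF D0] by blast
  have "card G * ldim e \<le> (p ^ e) ^ CARD('n) + card G * ((p ^ e) ^ CARD('n) - card (shifted_box (p ^ e) \<mu>))" for e
  proof -
    define q where "q = p ^ e"
    let ?M = "monomials (expbox (\<lambda>_. q)) :: ('n, 'k) mpoly set"
    let ?good = "shifted_box q \<mu>"
    have M: "finite ?M" "card ?M \<le> q ^ CARD('n)"
      using card_monomials[OF finite_expbox, of "\<lambda>_. q"] by (auto simp: finite_monomials card_expbox)
    obtain N C where NC: "finite N" "finite C" "N \<inter> C = {}" "N \<union> C \<subseteq> trunc q ` invs G" "mp.independent (N \<union> C)"
      "card N + card C = mp.dim (trunc q ` invs G)" "\<And>x. x \<in> N \<Longrightarrow> trunc q (D * x) = 0"
      "\<And>c. (\<Sum>x\<in>C. mconst (c x) * trunc q (D * x)) = 0 \<Longrightarrow> (\<forall>x\<in>C. c x = 0)"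
      by (rule mp.kernel_complement[OF subspace_trunc_invs M(1) trunc_image_span, of "\<lambda>x. trunc q (D * x)"])
        (auto simp: distrib_left trunc_add mult.left_commute[of D] trunc_scale)
    have indN: "mp.independent N" using NC(5) mp.independent_mono by blast
    have "card (N <+> ?good) \<le> card ?M"
    proof (rule mp.family_card_le[where v = "case_sum (\<lambda>a. a) (\<lambda>m. Poly_Mapping.single m 1)"])
      show "finite (N <+> ?good)" using NC by simp
      show "finite ?M" by (rule M)
      show "case_sum (\<lambda>a. a) (\<lambda>m. Poly_Mapping.single m 1) ` (N <+> ?good) \<subseteq> mp.span ?M"
      proof -
        have "N \<subseteq> mp.span ?M" using NC(4) trunc_image_span[of q "invs G"] by blast
        moreover have "Poly_Mapping.single m 1 \<in> mp.span ?M" if "m \<in> ?good" for m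
          using that shifted_box_subset[of q \<mu>] by (intro mp.span_base) (auto simp: monomials_def)
        ultimately show ?thesis by auto
      qed
      fix c assume 0: "(\<Sum>j\<in>N <+> ?good. mconst (c j) * case_sum (\<lambda>a. a) (\<lambda>m. Poly_Mapping.single m 1) j) = 0"
      let ?g = "\<Sum>m\<in>?good. mconst (c (Inr m)) * Poly_Mapping.single m (1::'k)"
      have 1: "(\<Sum>a\<in>N. mconst (c (Inl a)) * a) + ?g = 0"
        using 0 NC(1) by (simp add: sum.Plus)
      have "trunc q (D * (\<Sum>a\<in>N. mconst (c (Inl a)) * a)) = 0"
        by (simp add: sum_distrib_left trunc_sum mult.left_commute[of D] trunc_scale NC(7))
      then have "trunc q (D * ?g) = 0"
        using arg_cong[OF 1, of "\<lambda>x. trunc q (D * x)"] by (simp add: distrib_left trunc_add)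
      then have g: "?g = 0"
        by (intro mult_shifted_box_eq_0[OF \<mu> keys_monomial_combination]) (simp_all add: trunc_eq_0_iff)
      then have "c (Inr m) = 0" if "m \<in> ?good" for m
        using monomial_combination_eq_0[OF finite_shifted_box, of "\<lambda>m. c (Inr m)"] that by blast
      moreover have "c (Inl a) = 0" if "a \<in> N" for a
        using mp.independent_family[OF indN NC(1), of "\<lambda>a. c (Inl a)"] 1 g that by simp
      ultimately show "\<forall>j\<in>N <+> ?good. c j = 0" by auto
    qed
    then have 1: "card N + card ?good \<le> q ^ CARD('n)" using M NC(1) by (simp add: card_Plus)
    have "\<forall>b\<in>C. \<exists>r. r \<in> invs G \<and> trunc q r = b" using NC(4) by blast
    then obtain r where r: "\<And>b. b \<in> C \<Longrightarrow> r b \<in> invs G" "\<And>b. b \<in> C \<Longrightarrow> trunc q (r b) = b" by metis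
    have "card (C \<times> {..<card G}) \<le> card ?M"
    proof (rule mp.family_card_le[where v = "\<lambda>(b, j). trunc q (r b * sep ^ j)"])
      show "finite (C \<times> {..<card G})" using NC by simp
      show "finite ?M" by (rule M)
      show "(\<lambda>(b, j). trunc q (r b * sep ^ j)) ` (C \<times> {..<card G}) \<subseteq> mp.span ?M"
        using trunc_in_span by auto
      fix c assume 0: "(\<Sum>x\<in>C \<times> {..<card G}. mconst (c x) * (case x of (b, j) \<Rightarrow> trunc q (r b * sep ^ j))) = 0"
      define R where "R j = (\<Sum>b\<in>C. mconst (c (b, j)) * r b)" for j
      have "trunc q (\<Sum>j<card G. R j * sep ^ j) = (\<Sum>j<card G. \<Sum>b\<in>C. mconst (c (b, j)) * trunc q (r b * sep ^ j))"
        by (simp add: R_def sum_distrib_right trunc_sum mult.assoc trunc_scale)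
      also have "\<dots> = (\<Sum>b\<in>C. \<Sum>j<card G. mconst (c (b, j)) * trunc q (r b * sep ^ j))" by (rule sum.swap)
      also have "\<dots> = 0" using 0 by (simp add: sum.cartesian_product split_def)
      finally have I: "(\<Sum>j<card G. R j * sep ^ j) \<in> frob_ideal (p ^ e)" by (simp add: trunc_eq_0_iff q_def)
      have "c (b, j) = 0" if "b \<in> C" "j < card G" for b j
      proof -
        have "D * R j \<in> frob_ideal (p ^ e)"
          by (rule D[OF _ I that(2)]) (auto simp: R_def intro!: invs_sum invs_mult invs_mconst r)
        then have "0 = trunc q (D * R j)" by (simp add: trunc_eq_0_iff q_def)
        also have "\<dots> = (\<Sum>b\<in>C. mconst (c (b, j)) * trunc q (D * r b))"
          by (simp add: R_def sum_distrib_left trunc_sum mult.left_commute[of D] trunc_scale)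
        also have "\<dots> = (\<Sum>b\<in>C. mconst (c (b, j)) * trunc q (D * b))"
          by (rule sum.cong[OF refl]) (metis r(2) trunc_mult_trunc)
        finally show ?thesis using NC(8)[of "\<lambda>b. c (b, j)"] that by simp
      qed
      then show "\<forall>x\<in>C \<times> {..<card G}. c x = 0" by auto
    qed
    then have 2: "card C * card G \<le> q ^ CARD('n)" using M by (simp add: card_cartesian_product)
    have "ldim e = card N + card C" using NC(6) by (simp add: ldim_def q_def)
    then have "card G * ldim e = card C * card G + card G * card N" by (simp add: algebra_simps)
    also have "\<dots> \<le> q ^ CARD('n) + card G * (q ^ CARD('n) - card ?good)"
      using 1 2 by (intro add_mono mult_left_mono) auto
    finally show ?thesis by (simp add: q_def)
  qed
  then show ?thesis by (rule that)
qed

lemma shifted_box_asymptotics: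
  "(\<lambda>e. real (card (shifted_box (p ^ e) \<mu>)) / real ((p ^ e) ^ CARD('n))) \<longlonglongrightarrow> 1"
  for \<mu> :: "'n \<Rightarrow>\<^sub>0 nat"
proof -
  have "(\<lambda>e. real (p ^ e - c) / real (p ^ e)) \<longlonglongrightarrow> 1" for c
  proof (rule tendsto_sandwich)
    have "(\<lambda>e. (1 / real p) ^ e) \<longlonglongrightarrow> 0"
      using p_gt_1 by (intro LIMSEQ_realpow_zero) (auto simp: field_simps)
    then have "(\<lambda>e. 1 - real c * (1 / real p) ^ e) \<longlonglongrightarrow> 1 - real c * 0"
      by (intro tendsto_diff tendsto_mult tendsto_const)
    then show "(\<lambda>e. 1 - real c * (1 / real p) ^ e) \<longlonglongrightarrow> 1" by simp
    show "\<forall>\<^sub>F e in sequentially. 1 - real c * (1 / real p) ^ e \<le> real (p ^ e - c) / real (p ^ e)"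
    proof (rule always_eventually, rule allI)
      fix e
      have pe: "real p ^ e > 0" using p_pos by simp
      have "real (p ^ e) - real c \<le> real (p ^ e - c)" by linarith
      then have "(real (p ^ e) - real c) / real (p ^ e) \<le> real (p ^ e - c) / real (p ^ e)"
        by (rule divide_right_mono) simp
      then show "1 - real c * (1 / real p) ^ e \<le> real (p ^ e - c) / real (p ^ e)"
        using pe by (simp add: field_simps)
    qed
    show "\<forall>\<^sub>F e in sequentially. real (p ^ e - c) / real (p ^ e) \<le> 1"
      using p_pos by (intro always_eventually allI) (simp add: field_simps)
  qed auto
  then have "(\<lambda>e. \<Prod>i\<in>UNIV. real (p ^ e - Poly_Mapping.lookup \<mu> i) / real (p ^ e)) \<longlonglongrightarrow> (\<Prod>i\<in>(UNIV::'n set). 1)"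
    by (intro tendsto_prod) auto
  then show ?thesis by (simp add: card_shifted_box prod_dividef power_mult flip: of_nat_power)
qed

theorem ldim_asymptotics:
  "(\<lambda>e. real (ldim e) / real (p ^ (e * CARD('n)))) \<longlonglongrightarrow> 1 / real (card G)"
proof -
  obtain \<mu> :: "'n \<Rightarrow>\<^sub>0 nat" where lo: "\<And>e. card (shifted_box (p ^ e) \<mu>) \<le> card G * ldim e" using ldim_lower by metis
  obtain \<nu> :: "'n \<Rightarrow>\<^sub>0 nat" where up: "\<And>e. card G * ldim e \<le> (p ^ e) ^ CARD('n) + card G * ((p ^ e) ^ CARD('n) - card (shifted_box (p ^ e) \<nu>))"
    using ldim_upper by metis
  let ?Q = "\<lambda>e. real ((p ^ e) ^ CARD('n))"
  let ?n = "real (card G)"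
  have Q: "?Q e > 0" for e using p_pos by simp
  have n: "?n > 0" using card_G_pos by simp
  have le: "card (shifted_box q (\<kappa> :: 'n \<Rightarrow>\<^sub>0 nat)) \<le> q ^ CARD('n)" for q \<kappa>
    using card_mono[OF finite_expbox shifted_box_subset[of q \<kappa>]] by (simp add: card_expbox)
  have "(\<lambda>e. real (ldim e) / ?Q e) \<longlonglongrightarrow> 1 / ?n"
  proof (rule tendsto_sandwich)
    have "(\<lambda>e. (real (card (shifted_box (p ^ e) \<mu>)) / ?Q e) / ?n) \<longlonglongrightarrow> 1 / ?n"
      using n by (intro tendsto_divide shifted_box_asymptotics tendsto_const) auto
    then show "(\<lambda>e. (real (card (shifted_box (p ^ e) \<mu>)) / ?Q e) / ?n) \<longlonglongrightarrow> 1 / ?n" .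
    have "(\<lambda>e. (1 + ?n * (1 - real (card (shifted_box (p ^ e) \<nu>)) / ?Q e)) / ?n) \<longlonglongrightarrow> (1 + ?n * (1 - 1)) / ?n"
      using n by (intro tendsto_divide tendsto_add tendsto_mult tendsto_diff tendsto_const shifted_box_asymptotics) auto
    then show "(\<lambda>e. (1 + ?n * (1 - real (card (shifted_box (p ^ e) \<nu>)) / ?Q e)) / ?n) \<longlonglongrightarrow> 1 / ?n" by simp
    show "\<forall>\<^sub>F e in sequentially. (real (card (shifted_box (p ^ e) \<mu>)) / ?Q e) / ?n \<le> real (ldim e) / ?Q e"
    proof (rule always_eventually, rule allI)
      fix e
      have "real (card (shifted_box (p ^ e) \<mu>)) \<le> ?n * real (ldim e)"
        using lo[of e] by (simp only: of_nat_le_iff flip: of_nat_mult)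
      then show "(real (card (shifted_box (p ^ e) \<mu>)) / ?Q e) / ?n \<le> real (ldim e) / ?Q e"
        using Q[of e] n by (simp add: field_simps)
    qed
    show "\<forall>\<^sub>F e in sequentially. real (ldim e) / ?Q e \<le> (1 + ?n * (1 - real (card (shifted_box (p ^ e) \<nu>)) / ?Q e)) / ?n"
    proof (rule always_eventually, rule allI)
      fix e
      have "?n * real (ldim e) \<le> ?Q e + ?n * (?Q e - real (card (shifted_box (p ^ e) \<nu>)))"
        using up[of e] by (simp only: of_nat_le_iff flip: of_nat_mult of_nat_add of_nat_diff[OF le])
      moreover have "L / Q \<le> (1 + n * (1 - B / Q)) / n" if "n * L \<le> Q + n * (Q - B)" "Q > 0" "n > 0"
        for L Q B n :: real
        using that by (simp add: field_simps)
      ultimately show "real (ldim e) / ?Q e \<le> (1 + ?n * (1 - real (card (shifted_box (p ^ e) \<nu>)) / ?Q e)) / ?n"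
        using Q[of e] n by blast
    qed
  qed
  then show ?thesis by (simp add: power_mult)
qed

end

section \<open>Pseudo-reflections\<close>

text \<open>The column of \<open>g - 1\<close> with index \<open>j\<close>, that is, the coefficients of the linear form \<open>g x\<^sub>j - x\<^sub>j\<close>.\<close>

definition refl_col :: "'k::field ^ 'n::finite ^ 'n \<Rightarrow> 'n \<Rightarrow> 'n \<Rightarrow> 'k" where
  "refl_col g j i = g $ i $ j - mat 1 $ i $ j"

text \<open>If all columns of \<open>g - 1\<close> were multiples of a single one, then \<open>g - 1\<close> would have rank one and its kernel, the fixed space of \<open>g\<close>, would be a hyperplane. So an element which is neither the identity nor a pseudo-reflection yields two independent linear forms \<open>g x\<^sub>j - x\<^sub>j\<close>.\<close>

lemma not_pseudo_reflection_columns: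
  fixes g :: "'k::field ^ 'n::finite ^ 'n"
  assumes np: "\<not> pseudo_reflection g" and g1: "g \<noteq> mat 1"
  obtains j j' where "refl_col g j \<noteq> (\<lambda>_. 0)" "\<nexists>a. refl_col g j' = (\<lambda>i. a * refl_col g j i)"
proof -
  define M where "M i j = g $ i $ j - mat 1 $ i $ j" for i j
  have "\<exists>j. (\<lambda>i. M i j) \<noteq> (\<lambda>_. 0)"
    using g1 by (auto simp: M_def vec_eq_iff fun_eq_iff)
  then obtain j where j: "(\<lambda>i. M i j) \<noteq> (\<lambda>_. 0)" by blast
  have "\<exists>j'. \<nexists>a. (\<lambda>i. M i j') = (\<lambda>i. a * M i j)"
  proof (rule ccontr)
    assume "\<not> ?thesis"
    then have "\<forall>j'. \<exists>a. \<forall>i. M i j' = a * M i j" by (simp add: fun_eq_iff)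
    then obtain a where a: "\<And>i j'. M i j' = a j' * M i j" by metis
    obtain i0 where i0: "M i0 j \<noteq> 0" using j by auto
    have aj: "a j = 1" using a[of i0 j] i0 by simp
    define \<phi> where "\<phi> v = (\<Sum>j'\<in>UNIV. a j' * v $ j')" for v :: "'k ^ 'n"
    have gv: "(g *v v) $ i = v $ i + \<phi> v * M i j" for v i
    proof -
      have "(g *v v) $ i = (\<Sum>j'\<in>UNIV. (if j' = i then v $ j' else 0) + a j' * M i j * v $ j')"
        unfolding matrix_vector_mult_def vec_lambda_beta
      proof (rule sum.cong[OF refl])
        fix j'
        have "g $ i $ j' = mat 1 $ i $ j' + a j' * M i j" using a[of i j'] by (simp add: M_def algebra_simps)
        then show "g $ i $ j' * v $ j' = (if j' = i then v $ j' else 0) + a j' * M i j * v $ j'"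
          by (simp add: mat_def algebra_simps)
      qed
      then show ?thesis by (simp add: sum.distrib \<phi>_def sum_distrib_left sum_distrib_right algebra_simps)
    qed
    let ?K = "{v. g *v v = v}"
    have K: "?K = {v. \<phi> v = 0}"
      using i0 by (auto simp: vec_eq_iff gv)
    have \<phi>_add: "\<phi> (v + w) = \<phi> v + \<phi> w" and \<phi>_scale: "\<phi> (c *s v) = c * \<phi> v" for v w c
      by (simp_all add: \<phi>_def sum.distrib sum_distrib_left algebra_simps)
    have sub: "vec.subspace ?K"
      unfolding K vec.subspace_def by (auto simp: \<phi>_add \<phi>_scale) (simp add: \<phi>_def)
    have \<phi>j: "\<phi> (axis j 1) = 1"
      using aj by (simp add: \<phi>_def axis_def if_distrib cong: if_cong)
    have "axis j 1 \<notin> vec.span ?K"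
    proof -
      have *: "vec.span ?K = ?K" using sub by (simp only: vec.span_eq_iff)
      show ?thesis unfolding * unfolding K using \<phi>j by simp
    qed
    then have 1: "vec.dim (insert (axis j 1) ?K) = vec.dim ?K + 1"
      by (simp add: vec.dim_insert)
    have "v \<in> vec.span (insert (axis j 1) ?K)" for v
    proof -
      have "\<phi> (v - \<phi> v *s axis j 1) = 0"
        using \<phi>_add[of "v - \<phi> v *s axis j 1" "\<phi> v *s axis j 1"] by (simp add: \<phi>_scale \<phi>j)
      then have "v - \<phi> v *s axis j 1 \<in> vec.span (insert (axis j 1) ?K)"
        by (intro vec.span_base) (simp add: K)
      moreover have "\<phi> v *s axis j 1 \<in> vec.span (insert (axis j 1) ?K)"
        by (intro vec.span_scale vec.span_base) simp
      ultimately have "(v - \<phi> v *s axis j 1) + \<phi> v *s axis j 1 \<in> vec.span (insert (axis j 1) ?K)"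
        by (rule vec.span_add)
      then show ?thesis by simp
    qed
    then have "vec.span (insert (axis j 1) ?K) = UNIV" by auto
    then have "vec.dim (insert (axis j 1) ?K) = CARD('n)"
      by (metis vec.dim_span vec_dim_card)
    then show False using 1 np g1 by (simp add: pseudo_reflection_def)
  qed
  then obtain j' where j': "\<nexists>a. (\<lambda>i. M i j') = (\<lambda>i. a * M i j)" by blast
  have M: "refl_col g j = (\<lambda>i. M i j)" for j by (simp add: M_def refl_col_def fun_eq_iff)
  show ?thesis by (rule that[of j j']) (use j j' in \<open>simp_all only: M not_False_eq_True\<close>)
qed

section \<open>The tensor product over the invariants\<close>

text \<open>The target of a balanced map is a group given by generators and relations. It is represented as an additive type together with the subgroup \<open>N\<close> of relations, and equations are read modulo \<open>N\<close>.\<close>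

definition additive_subgroup_set :: "'x::ab_group_add set \<Rightarrow> bool" where
  "additive_subgroup_set N \<longleftrightarrow> 0 \<in> N \<and> (\<forall>a\<in>N. \<forall>b\<in>N. a + b \<in> N) \<and> (\<forall>a\<in>N. - a \<in> N)"

lemma additive_subgroup_setD:
  assumes "additive_subgroup_set N"
  shows "0 \<in> N" "a \<in> N \<Longrightarrow> b \<in> N \<Longrightarrow> a + b \<in> N" "a \<in> N \<Longrightarrow> - a \<in> N"
    "a \<in> N \<Longrightarrow> b \<in> N \<Longrightarrow> a - b \<in> N"
proof -
  show 1: "0 \<in> N" "a \<in> N \<Longrightarrow> b \<in> N \<Longrightarrow> a + b \<in> N" "a \<in> N \<Longrightarrow> - a \<in> N" for a b
    using assms by (auto simp: additive_subgroup_set_def)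
  show "a \<in> N \<Longrightarrow> b \<in> N \<Longrightarrow> a - b \<in> N" using 1(2)[of a "- b"] 1(3)[of b] by simp
qed

text \<open>An element of the tensor product of the polynomial ring with a module is represented by a list of pairs \<open>(s, e)\<close>, standing for the sum of the tensors of \<open>s\<close> and \<open>e\<close>. The polynomial ring acts on the first components, and a balanced map \<open>\<beta>\<close> is evaluated by \<open>bsum\<close>.\<close>

definition scal :: "'a::comm_ring_1 \<Rightarrow> ('a \<times> 'e) list \<Rightarrow> ('a \<times> 'e) list" where
  "scal P u = map (\<lambda>(s, e). (P * s, e)) u"

definition bsum :: "('a \<Rightarrow> 'e \<Rightarrow> 'x::ab_group_add) \<Rightarrow> ('a \<times> 'e) list \<Rightarrow> 'x" where
  "bsum \<beta> u = (\<Sum>(s, e)\<leftarrow>u. \<beta> s e)"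

lemma bsum_simps [simp]: "bsum \<beta> [] = 0" "bsum \<beta> ((s, e) # u) = \<beta> s e + bsum \<beta> u"
  "bsum \<beta> (u @ v) = bsum \<beta> u + bsum \<beta> v"
  by (simp_all add: bsum_def)

lemma scal_simps [simp]: "scal P [] = []" "scal P ((s, e) # u) = (P * s, e) # scal P u"
  "scal P (u @ v) = scal P u @ scal P v"
  by (simp_all add: scal_def)

lemma scal_scal: "scal P (scal Q u) = scal (P * Q) u"
  by (auto simp: scal_def mult.assoc)

lemma bsum_scal: "bsum \<beta> (scal P u) = bsum (\<lambda>s. \<beta> (P * s)) u"
  by (induction u) auto

text \<open>A module over the invariants, given by its scalar multiplication \<open>sm\<close> on an abelian group record.\<close>

locale inv_module = lin_group G p + abelian_group E
  for G :: "('k::field ^ 'n::finite ^ 'n) set" and p :: nat and E :: "('e, 'm) ring_scheme" (structure) +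
  fixes sm :: "('n, 'k) mpoly \<Rightarrow> 'e \<Rightarrow> 'e"
  assumes sm_closed: "r \<in> invs G \<Longrightarrow> x \<in> carrier E \<Longrightarrow> sm r x \<in> carrier E"
    and sm_add_left: "r \<in> invs G \<Longrightarrow> s \<in> invs G \<Longrightarrow> x \<in> carrier E \<Longrightarrow> sm (r + s) x = sm r x \<oplus> sm s x"
    and sm_add_right: "r \<in> invs G \<Longrightarrow> x \<in> carrier E \<Longrightarrow> y \<in> carrier E \<Longrightarrow> sm r (x \<oplus> y) = sm r x \<oplus> sm r y"
    and sm_mult: "r \<in> invs G \<Longrightarrow> s \<in> invs G \<Longrightarrow> x \<in> carrier E \<Longrightarrow> sm (r * s) x = sm r (sm s x)"
    and sm_one: "x \<in> carrier E \<Longrightarrow> sm 1 x = x"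
begin

definition lin_map :: "('n, 'k) mpoly set \<Rightarrow> (('n, 'k) mpoly \<Rightarrow> 'e) \<Rightarrow> bool" where
  "lin_map H f \<longleftrightarrow> (\<forall>a\<in>H. f a \<in> carrier E) \<and> (\<forall>a\<in>H. \<forall>b\<in>H. f (a + b) = f a \<oplus> f b) \<and>
     (\<forall>r\<in>invs G. \<forall>a\<in>H. f (r * a) = sm r (f a))"

definition submod :: "('n, 'k) mpoly set \<Rightarrow> bool" where
  "submod H \<longleftrightarrow> 0 \<in> H \<and> (\<forall>a\<in>H. \<forall>b\<in>H. a + b \<in> H) \<and> (\<forall>r\<in>invs G. \<forall>a\<in>H. r * a \<in> H)"

lemma lin_map_UNIV:
  assumes "lin_map UNIV f"
  shows "f a \<in> carrier E" "f (a + b) = f a \<oplus> f b" "r \<in> invs G \<Longrightarrow> f (r * a) = sm r (f a)" "f 0 = \<zero>"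
proof -
  show 1: "f a \<in> carrier E" "f (a + b) = f a \<oplus> f b" "r \<in> invs G \<Longrightarrow> f (r * a) = sm r (f a)" for a b
    using assms by (auto simp: lin_map_def)
  have "f 0 \<oplus> f 0 = f 0 \<oplus> \<zero>" using 1(2)[of 0 0] 1(1)[of 0] by simp
  then show "f 0 = \<zero>" using 1(1)[of 0] by (simp only: add.l_cancel zero_closed)
qed

lemma sm_zero: "r \<in> invs G \<Longrightarrow> sm r \<zero> = \<zero>"
proof -
  assume r: "r \<in> invs G"
  have "sm r \<zero> \<oplus> sm r \<zero> = sm r \<zero> \<oplus> \<zero>"
    using sm_add_right[OF r zero_closed zero_closed] sm_closed[OF r zero_closed] by simp
  then show ?thesis using sm_closed[OF r zero_closed] by (simp only: add.l_cancel zero_closed)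
qed

text \<open>The pairing of a tensor with a polynomial \<open>t\<close> by the trace: the tensor of \<open>s\<close> and \<open>e\<close> is sent to \<open>tr (s t) e\<close>. It maps the tensor product to the linear maps from the polynomial ring to the module.\<close>

fun tau :: "(('n, 'k) mpoly \<times> 'e) list \<Rightarrow> ('n, 'k) mpoly \<Rightarrow> 'e" where
  "tau [] t = \<zero>"
| "tau ((s, e) # u) t = sm (tr (s * t)) e \<oplus> tau u t"

definition valid :: "(('n, 'k) mpoly \<times> 'e) list \<Rightarrow> bool" where
  "valid u \<longleftrightarrow> snd ` set u \<subseteq> carrier E"

lemma valid_simps [simp]: "valid []" "valid ((s, e) # u) \<longleftrightarrow> e \<in> carrier E \<and> valid u"
  "valid (u @ v) \<longleftrightarrow> valid u \<and> valid v"
  by (auto simp: valid_def)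

lemma valid_scal [simp]: "valid (scal P u) \<longleftrightarrow> valid u"
  by (induction u) auto

lemma tau_closed: "valid u \<Longrightarrow> tau u t \<in> carrier E"
  by (induction u) (auto simp: sm_closed tr_invs)

lemma tau_append: "valid u \<Longrightarrow> valid v \<Longrightarrow> tau (u @ v) t = tau u t \<oplus> tau v t"
  by (induction u) (auto simp: tau_closed sm_closed tr_invs a_assoc)

lemma tau_scal: "tau (scal P u) t = tau u (P * t)"
  by (induction u) (auto simp: mult.assoc mult.left_commute)

lemma tau_lin_map: "valid u \<Longrightarrow> lin_map UNIV (tau u)"
proof (induction u)
  case Nil
  then show ?case by (simp add: lin_map_def sm_zero)
next
  case (Cons x u)
  obtain s e where x: "x = (s, e)" by fastforce
  note IH = lin_map_UNIV[OF Cons.IH]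
  have e: "e \<in> carrier E" and u: "valid u" using Cons.prems by (auto simp: x)
  show ?case
    unfolding lin_map_def
  proof (intro conjI ballI)
    fix a b
    show "tau (x # u) a \<in> carrier E" using Cons.prems by (rule tau_closed)
    have "sm (tr (s * (a + b))) e = sm (tr (s * a)) e \<oplus> sm (tr (s * b)) e"
      by (simp add: distrib_left tr_add sm_add_left tr_invs e)
    moreover have "(w \<oplus> x) \<oplus> (y \<oplus> v) = (w \<oplus> y) \<oplus> (x \<oplus> v)"
      if "w \<in> carrier E" "x \<in> carrier E" "y \<in> carrier E" "v \<in> carrier E" for w x y v
      using that by (simp add: a_ac)
    ultimately show "tau (x # u) (a + b) = tau (x # u) a \<oplus> tau (x # u) b"
      using e u by (simp add: x IH(2) sm_closed tr_invs tau_closed)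
  next
    fix r a assume r: "r \<in> invs G"
    have "sm (tr (s * (r * a))) e = sm r (sm (tr (s * a)) e)"
      by (simp add: mult.left_commute[of s] tr_mult r sm_mult tr_invs e)
    then show "tau (x # u) (r * a) = sm r (tau (x # u) a)"
      using e u r by (simp add: x IH(3) sm_closed tr_invs tau_closed sm_add_right)
  qed
qed

definition kern :: "(('n, 'k) mpoly \<times> 'e) list \<Rightarrow> bool" where
  "kern u \<longleftrightarrow> valid u \<and> (\<forall>t. tau u t = \<zero>)"

definition balanced :: "'x::ab_group_add set \<Rightarrow> (('n, 'k) mpoly \<Rightarrow> 'e \<Rightarrow> 'x) \<Rightarrow> bool" where
  "balanced N \<beta> \<longleftrightarrow>
     (\<forall>s s'. \<forall>e\<in>carrier E. \<beta> (s + s') e - (\<beta> s e + \<beta> s' e) \<in> N) \<and>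
     (\<forall>s. \<forall>e\<in>carrier E. \<forall>e'\<in>carrier E. \<beta> s (e \<oplus> e') - (\<beta> s e + \<beta> s e') \<in> N) \<and>
     (\<forall>r\<in>invs G. \<forall>s. \<forall>e\<in>carrier E. \<beta> (r * s) e - \<beta> s (sm r e) \<in> N)"

lemma balancedD:
  assumes "balanced N \<beta>" "e \<in> carrier E"
  shows "\<beta> (s + s') e - (\<beta> s e + \<beta> s' e) \<in> N"
    "e' \<in> carrier E \<Longrightarrow> \<beta> s (e \<oplus> e') - (\<beta> s e + \<beta> s e') \<in> N"
    "r \<in> invs G \<Longrightarrow> \<beta> (r * s) e - \<beta> s (sm r e) \<in> N"
  using assms unfolding balanced_def by blast+

lemma balanced_mult: "balanced N \<beta> \<Longrightarrow> balanced N (\<lambda>s. \<beta> (P * s))"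
  unfolding balanced_def by (simp add: distrib_left mult.left_commute)

text \<open>By the universal property, a tensor vanishes if every balanced map kills it. Quantifying over the maps into a fixed target replaces the construction of the tensor product.\<close>

definition tensor_zero :: "'x::ab_group_add set \<Rightarrow> (('n, 'k) mpoly \<times> 'e) list \<Rightarrow> bool" where
  "tensor_zero N u \<longleftrightarrow> (\<forall>\<beta>. balanced N \<beta> \<longrightarrow> bsum \<beta> u \<in> N)"

text \<open>The list \<open>T\<close> represents an element of the tensor square of the polynomial ring over the invariants. Its image in the product of one copy of the polynomial ring for each \<open>h\<close>, where the tensor of \<open>a\<close> and \<open>b\<close> has the components \<open>a h(b)\<close>, is to be \<open>P\<close> at the identity and zero elsewhere.\<close>

definition supported_at_one :: "(('n, 'k) mpoly \<times> ('n, 'k) mpoly) list \<Rightarrow> ('n, 'k) mpoly \<Rightarrow> bool" where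
  "supported_at_one T P \<longleftrightarrow>
     (\<forall>h\<in>G. (\<Sum>(a, b)\<leftarrow>T. a * act h b) = (if h = mat 1 then P else 0))"

lemma sum_list_sum_swap: "(\<Sum>x\<leftarrow>T. \<Sum>h\<in>A. f x h) = (\<Sum>h\<in>A. \<Sum>x\<leftarrow>T. (f x h :: 'z::comm_monoid_add))"
  by (induction T) (auto simp: sum.distrib)

lemma supported_at_one_left:
  assumes "supported_at_one T P"
  shows "(\<Sum>(a, b)\<leftarrow>T. tr (s * b) * a) = P * s"
proof -
  have "(\<Sum>(a, b)\<leftarrow>T. tr (s * b) * a) = (\<Sum>x\<leftarrow>T. \<Sum>h\<in>G. act h s * (case x of (a, b) \<Rightarrow> a * act h b))"
    by (rule arg_cong[where f = sum_list], rule map_cong[OF refl])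
      (auto simp: tr_def act_mult sum_distrib_right sum_distrib_left ac_simps intro!: sum.cong)
  also have "\<dots> = (\<Sum>h\<in>G. act h s * (\<Sum>(a, b)\<leftarrow>T. a * act h b))"
    by (simp add: sum_list_sum_swap sum_list_const_mult)
  also have "\<dots> = (\<Sum>h\<in>G. if h = mat 1 then P * s else 0)"
    by (rule sum.cong[OF refl]) (use assms in \<open>auto simp: supported_at_one_def act_mat_1\<close>)
  finally show ?thesis using finG mat_1_in by simp
qed

lemma supported_at_one_right:
  assumes "supported_at_one T P"
  shows "(\<Sum>(a, b)\<leftarrow>T. tr (a * t) * b) = P * t"
proof -
  have "(\<Sum>(a, b)\<leftarrow>T. act h a * b) = (if h = mat 1 then P else 0)" if h: "h \<in> G" for h
  proof -
    obtain k where k: "k \<in> G" "h ** k = mat 1" "k ** h = mat 1" using inverse_in[OF h] by blast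
    have sl: "act h (\<Sum>x\<leftarrow>T. f x) = (\<Sum>x\<leftarrow>T. act h (f x))" for f :: "_ \<Rightarrow> ('n, 'k) mpoly"
      by (induction T) (auto simp: act_0 act_add)
    have "(\<Sum>(a, b)\<leftarrow>T. act h a * b) = act h (\<Sum>(a, b)\<leftarrow>T. a * act k b)"
      unfolding sl by (rule arg_cong[where f = sum_list], rule map_cong[OF refl])
        (auto simp: act_mult act_act k act_mat_1)
    also have "\<dots> = act h (if k = mat 1 then P else 0)"
      using assms k by (simp add: supported_at_one_def)
    also have "\<dots> = (if h = mat 1 then P else 0)"
    proof (cases "k = mat 1")
      case True
      then have "h = mat 1" using k by simp
      then show ?thesis using True by (simp add: act_mat_1)
    next
      case False
      then have "h \<noteq> mat 1" using k by auto
      then show ?thesis using False by (simp add: act_0)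
    qed
    finally show ?thesis .
  qed
  note * = this
  have "(\<Sum>(a, b)\<leftarrow>T. tr (a * t) * b) = (\<Sum>x\<leftarrow>T. \<Sum>h\<in>G. act h t * (case x of (a, b) \<Rightarrow> act h a * b))"
    by (rule arg_cong[where f = sum_list], rule map_cong[OF refl])
      (auto simp: tr_def act_mult sum_distrib_right sum_distrib_left ac_simps intro!: sum.cong)
  also have "\<dots> = (\<Sum>h\<in>G. act h t * (\<Sum>(a, b)\<leftarrow>T. act h a * b))"
    by (simp add: sum_list_sum_swap sum_list_const_mult)
  also have "\<dots> = (\<Sum>h\<in>G. if h = mat 1 then P * t else 0)"
    by (rule sum.cong[OF refl]) (auto simp: * act_mat_1)
  finally show ?thesis using finG mat_1_in by simp
qed

text \<open>In the tensor product, \<open>P\<close> times the tensor of \<open>s\<close> and \<open>e\<close> is the sum over \<open>(a, b)\<close> in \<open>T\<close> of the tensors of \<open>a tr(s b)\<close> and \<open>e\<close>. Moving the invariant \<open>tr(s b)\<close> to the other side, the sum becomes an expression in the values of \<open>tau\<close>.\<close>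

lemma kern_killed:
  assumes T: "supported_at_one T P" and u: "kern u" and N: "additive_subgroup_set N"
  shows "tensor_zero N (scal P u)"
  unfolding tensor_zero_def
proof (intro allI impI)
  fix \<beta> assume \<beta>: "balanced N \<beta>"
  note N = additive_subgroup_setD[OF N]
  have zero: "\<beta> a \<zero> \<in> N" for a
    using N(3)[OF balancedD(2)[OF \<beta> zero_closed zero_closed, of a]] by simp
  have zero1: "\<beta> 0 e \<in> N" if "e \<in> carrier E" for e
    using N(3)[OF balancedD(1)[OF \<beta> that, of 0 0]] by simp
  have Tzero: "(\<Sum>(a, b)\<leftarrow>T'. \<beta> a \<zero>) \<in> N" for T' :: "(('n, 'k) mpoly \<times> ('n, 'k) mpoly) list"
    by (induction T') (auto intro: N zero)
  have key: "bsum \<beta> (scal P u) - (\<Sum>(a, b)\<leftarrow>T. \<beta> a (tau u b)) \<in> N" if "valid u" for u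
    using that
  proof (induction u)
    case Nil
    then show ?case using N(3)[OF Tzero[of T]] by simp
  next
    case (Cons x u)
    obtain s e where x: "x = (s, e)" by fastforce
    have e: "e \<in> carrier E" and u: "valid u" using Cons.prems by (auto simp: x)
    have 1: "\<beta> (\<Sum>(a, b)\<leftarrow>T'. tr (s * b) * a) e + (\<Sum>(a, b)\<leftarrow>T'. \<beta> a (tau u b)) -
        (\<Sum>(a, b)\<leftarrow>T'. \<beta> a (tau (x # u) b)) \<in> N" for T'
    proof (induction T')
      case Nil
      then show ?case using zero1[OF e] by simp
    next
      case (Cons ab T')
      obtain a b where ab: "ab = (a, b)" by fastforce
      let ?y = "\<Sum>(a, b)\<leftarrow>T'. tr (s * b) * a"
      have A: "\<beta> (tr (s * b) * a + ?y) e - (\<beta> (tr (s * b) * a) e + \<beta> ?y e) \<in> N"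
        by (rule balancedD(1)[OF \<beta> e])
      have B: "\<beta> (tr (s * b) * a) e - \<beta> a (sm (tr (s * b)) e) \<in> N"
        by (rule balancedD(3)[OF \<beta> e tr_invs])
      have C: "\<beta> a (sm (tr (s * b)) e \<oplus> tau u b) - (\<beta> a (sm (tr (s * b)) e) + \<beta> a (tau u b)) \<in> N"
        by (rule balancedD(2)[OF \<beta> sm_closed[OF tr_invs e] tau_closed[OF u]])
      from N(4)[OF N(2)[OF N(2)[OF A B] Cons.IH] C] show ?case by (simp add: ab x algebra_simps)
    qed
    have "\<beta> (P * s) e + (\<Sum>(a, b)\<leftarrow>T. \<beta> a (tau u b)) - (\<Sum>(a, b)\<leftarrow>T. \<beta> a (tau (x # u) b)) \<in> N"
      using 1[of T] supported_at_one_left[OF T, of s] by simp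
    from N(2)[OF this Cons.IH[OF u]] show ?case by (simp add: x algebra_simps)
  qed
  have "(\<Sum>(a, b)\<leftarrow>T. \<beta> a (tau u b)) \<in> N"
    using u Tzero[of T] by (simp add: kern_def)
  moreover have "valid u" using u by (simp add: kern_def)
  ultimately show "bsum \<beta> (scal P u) \<in> N"
    using N(2)[OF key, of u "\<Sum>(a, b)\<leftarrow>T. \<beta> a (tau u b)"] by (simp only: diff_add_cancel)
qed

text \<open>The same list \<open>T\<close> provides preimages under \<open>tau\<close>, up to the factor \<open>P\<close>.\<close>

lemma tau_section:
  assumes T: "supported_at_one T P" and \<xi>: "lin_map UNIV \<xi>"
  shows "tau (map (\<lambda>(a, b). (a, \<xi> b)) T) t = \<xi> (P * t)"
proof -
  note x = lin_map_UNIV[OF \<xi>]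
  have "tau (map (\<lambda>(a, b). (a, \<xi> b)) T') t = \<xi> (\<Sum>(a, b)\<leftarrow>T'. tr (a * t) * b)" for T'
    by (induction T') (auto simp: x tr_invs)
  then show ?thesis using supported_at_one_right[OF T] by simp
qed

end

section \<open>Injectivity of the trace pairing\<close>

text \<open>Injectivity over the invariants, in the form of the extension of linear maps from submodules of the polynomial ring to the whole ring.\<close>

locale inv_injective_module = inv_module G p E sm
  for G :: "('k::field ^ 'n::finite ^ 'n) set" and p :: nat and E :: "('e, 'm) ring_scheme" (structure) and sm +
  assumes extension: "submod H \<Longrightarrow> lin_map H f \<Longrightarrow> \<exists>F. lin_map UNIV F \<and> (\<forall>a\<in>H. F a = f a)"
begin

text \<open>Multiplication by \<open>P\<close> is injective, so \<open>\<xi>\<close> can be transported to the multiples of \<open>P\<close> and then extended.\<close>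

lemma divide_map:
  assumes P: "P \<noteq> 0" and \<xi>: "lin_map UNIV \<xi>"
  obtains \<xi>' where "lin_map UNIV \<xi>'" "\<And>t. \<xi>' (P * t) = \<xi> t"
proof -
  note x = lin_map_UNIV[OF \<xi>]
  define f where "f y = \<xi> (THE a. y = P * a)" for y
  have f: "f (P * a) = \<xi> a" for a
    unfolding f_def using P by (simp add: mpoly_mult_left_cancel)
  have f_add: "f (P * a + P * b) = \<xi> a \<oplus> \<xi> b" for a b
    using f[of "a + b"] by (simp add: distrib_left x)
  have f_mult: "f (r * (P * a)) = sm r (\<xi> a)" if "r \<in> invs G" for r a
    using f[of "r * a"] that by (simp add: mult.left_commute x)
  have "submod (range ((*) P))"
    unfolding submod_def
    by (auto simp: image_iff) (metis mult_zero_right, metis distrib_left, metis mult.left_commute)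
  moreover have "lin_map (range ((*) P)) f"
    unfolding lin_map_def by (auto simp: f f_add f_mult x)
  ultimately obtain F where F: "lin_map UNIV F" "\<And>a. a \<in> range ((*) P) \<Longrightarrow> F a = f a"
    using extension[of "range ((*) P)" f] by blast
  show ?thesis by (rule that[OF F(1)]) (simp add: F(2) f)
qed

lemma divide_element:
  assumes P: "P \<noteq> 0" "P \<in> invs G" and e: "e \<in> carrier E"
  obtains y where "y \<in> carrier E" "sm P y = e"
proof -
  let ?H = "(\<lambda>r. P * r) ` invs G"
  define f where "f y = sm (THE a. y = P * a) e" for y
  have f: "f (P * a) = sm a e" for a
    unfolding f_def using P by (simp add: mpoly_mult_left_cancel)
  have f_add: "f (P * a + P * b) = sm a e \<oplus> sm b e" if "a \<in> invs G" "b \<in> invs G" for a b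
    using f[of "a + b"] that by (simp add: distrib_left sm_add_left e)
  have f_mult: "f (r * (P * a)) = sm r (sm a e)" if "r \<in> invs G" "a \<in> invs G" for r a
    using f[of "r * a"] that by (simp add: mult.left_commute sm_mult e)
  have "submod ?H"
    unfolding submod_def
  proof (intro conjI ballI)
    show "0 \<in> ?H" by (rule image_eqI[of _ _ 0]) (auto intro: invs_0)
    fix a b assume "a \<in> ?H" "b \<in> ?H"
    then show "a + b \<in> ?H" by (auto simp flip: distrib_left intro: invs_add)
  next
    fix r a assume "r \<in> invs G" "a \<in> ?H"
    then show "r * a \<in> ?H" by (auto simp: mult.left_commute[of r P] intro: invs_mult)
  qed
  moreover have "lin_map ?H f"
    unfolding lin_map_def by (auto simp: f f_add f_mult sm_closed e)
  ultimately obtain F where F: "lin_map UNIV F" "\<And>a. a \<in> ?H \<Longrightarrow> F a = f a"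
    using extension[of ?H f] by blast
  have "sm P (F 1) = F (P * 1)" using lin_map_UNIV(3)[OF F(1) P(2), of 1] by simp
  also have "\<dots> = f (P * 1)" by (intro F(2) imageI invs_1)
  also have "\<dots> = e" using f[of 1] sm_one[OF e] by simp
  finally show ?thesis using that lin_map_UNIV(1)[OF F(1)] by blast
qed

text \<open>The value \<open>\<xi> b\<close> at \<open>lin c * a + lin c' * b\<close> is well defined: \<open>b\<close> is determined modulo \<open>lin c\<close> because the two linear forms are coprime, and \<open>\<xi>\<close> kills the multiples of \<open>lin c\<close>.\<close>

lemma split_map:
  assumes c: "c \<noteq> (\<lambda>_. 0)" and indep: "\<nexists>a. c' = (\<lambda>i. a * c i)"
    and \<xi>: "lin_map UNIV \<xi>" and kill: "\<And>t. \<xi> (lin c * t) = \<zero>"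
  obtains \<xi>' where "lin_map UNIV \<xi>'" "\<And>t. \<xi>' (lin c * t) = \<zero>" "\<And>t. \<xi>' (lin c' * t) = \<xi> t"
proof -
  note x = lin_map_UNIV[OF \<xi>]
  let ?l = "lin c" and ?l' = "lin c'"
  let ?H = "{?l * a + ?l' * b | a b. True}"
  define f where "f y = \<xi> (SOME b. \<exists>a. y = ?l * a + ?l' * b)" for y
  have f: "f (?l * a + ?l' * b) = \<xi> b" for a b
  proof -
    define b' where "b' = (SOME b'. \<exists>a'. ?l * a + ?l' * b = ?l * a' + ?l' * b')"
    have "\<exists>a'. ?l * a + ?l' * b = ?l * a' + ?l' * b'"
      unfolding b'_def by (rule someI[of _ b]) blast
    then obtain a' where "?l * a + ?l' * b = ?l * a' + ?l' * b'" by blast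
    then have "?l' * (b - b') = ?l * (a' - a)" by (simp add: algebra_simps)
    then have "?l dvd b - b'" by (rule linear_forms_coprime[OF c indep])
    then obtain d where "b - b' = ?l * d" by (auto elim: dvdE)
    then have "b = b' + ?l * d" by (simp add: algebra_simps)
    then have "\<xi> b = \<xi> b'" using x(1)[of b'] by (simp add: x(2) kill)
    then show ?thesis by (simp add: f_def b'_def)
  qed
  have add: "(?l * a + ?l' * b) + (?l * a2 + ?l' * b2) = ?l * (a + a2) + ?l' * (b + b2)" for a b a2 b2
    by (simp add: algebra_simps)
  have mul: "r * (?l * a + ?l' * b) = ?l * (r * a) + ?l' * (r * b)" for r a b
    by (simp add: algebra_simps)
  have "submod ?H"
    unfolding submod_def
  proof (intro conjI ballI)
    show "0 \<in> ?H" by (intro CollectI exI[of _ 0]) simp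
    fix y y2 assume "y \<in> ?H" "y2 \<in> ?H"
    then obtain a b a2 b2 where "y = ?l * a + ?l' * b" "y2 = ?l * a2 + ?l' * b2" by blast
    then have "y + y2 = ?l * (a + a2) + ?l' * (b + b2)" by (simp only: add)
    then show "y + y2 \<in> ?H" by blast
  next
    fix r y assume "y \<in> ?H"
    then obtain a b where "y = ?l * a + ?l' * b" by blast
    then have "r * y = ?l * (r * a) + ?l' * (r * b)" by (simp only: mul)
    then show "r * y \<in> ?H" by blast
  qed
  moreover have "lin_map ?H f"
    unfolding lin_map_def by (auto simp: add mul f x)
  ultimately obtain F where F: "lin_map UNIV F" "\<And>y. y \<in> ?H \<Longrightarrow> F y = f y"
    using extension[of ?H f] by blast
  show ?thesis
  proof (rule that[OF F(1)])
    fix t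
    have "F (?l * t + ?l' * 0) = f (?l * t + ?l' * 0)" by (rule F(2)) blast
    then show "F (?l * t) = \<zero>" using f[of t 0] x(4) by simp
    have "F (?l * 0 + ?l' * t) = f (?l * 0 + ?l' * t)" by (rule F(2)) blast
    then show "F (?l' * t) = \<xi> t" using f[of 0 t] by simp
  qed
qed

text \<open>If \<open>Q\<close> times each of two coprime linear forms \<open>l\<close> and \<open>l'\<close> kills the kernel of \<open>tau\<close>, then so does \<open>Q\<close>. Given \<open>u\<close> in the kernel, write \<open>u = l \<mu>\<close>, which is possible because the module is divisible. Then \<open>\<xi> = tau \<mu>\<close> is killed by \<open>l\<close>, so \<open>split_map\<close> writes it as \<open>l' \<xi>'\<close> with \<open>l \<xi>' = 0\<close>, and \<open>\<xi>' = tau \<nu>\<close> because \<open>tau\<close> is surjective. Now \<open>\<mu> - l' \<nu>\<close> and \<open>l \<nu>\<close> lie in the kernel, whence \<open>Q u = Q l \<mu> = Q l l' \<nu> = Q l' (l \<nu>) = 0\<close>.\<close>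

lemma coprime_step:
  assumes T: "supported_at_one T P" "P \<noteq> 0"
    and c: "c \<noteq> (\<lambda>_. 0)" and indep: "\<nexists>a. c' = (\<lambda>i. a * c i)"
    and N: "additive_subgroup_set N"
    and 1: "\<And>u. kern u \<Longrightarrow> tensor_zero N (scal (lin c * Q) u)"
    and 2: "\<And>u. kern u \<Longrightarrow> tensor_zero N (scal (lin c' * Q) u)"
    and u: "kern u"
  shows "tensor_zero N (scal Q u)"
proof -
  let ?l = "lin c" and ?l' = "lin c'"
  note N = additive_subgroup_setD[OF N]
  have l0: "?l \<noteq> 0" using c lin_eq_iff[of c "\<lambda>_. 0"] by (simp add: lin_def mconst_simps)
  \<comment> \<open>the norm of the linear form is an invariant multiple of it\<close>
  define nl where "nl = (\<Prod>g\<in>G. act g ?l)"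
  define ls where "ls = (\<Prod>g\<in>G - {mat 1}. act g ?l)"
  have nl: "nl = ?l * ls"
    unfolding nl_def ls_def by (subst prod.remove[OF finG mat_1_in]) (simp add: act_mat_1)
  have nl_inv: "nl \<in> invs G"
  proof -
    have "act h nl = nl" if "h \<in> G" for h
      using prod.reindex_bij_betw[OF bij_left_mult[OF that], of "\<lambda>g. act g ?l"]
      by (simp add: nl_def act_prod act_act)
    then show ?thesis by (simp add: invs_def)
  qed
  have nl0: "nl \<noteq> 0"
  proof
    assume "nl = 0"
    then obtain g where g: "g \<in> G" "act g ?l = 0" using finG by (auto simp: nl_def mpoly_prod_eq_0)
    obtain h where "h ** g = mat 1" using inverse_in[OF g(1)] by blast
    then have "?l = act h (act g ?l)" by (simp add: act_act act_mat_1)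
    then show False using g l0 by (simp add: act_0)
  qed
  have uv: "valid u" using u by (simp add: kern_def)
  have "\<forall>e\<in>carrier E. \<exists>y. y \<in> carrier E \<and> sm nl y = e"
    using divide_element[OF nl0 nl_inv] by metis
  then obtain dv where dv: "\<And>e. e \<in> carrier E \<Longrightarrow> dv e \<in> carrier E" "\<And>e. e \<in> carrier E \<Longrightarrow> sm nl (dv e) = e"
    by metis
  define \<mu> where "\<mu> = map (\<lambda>(s, e). (ls * s, dv e)) u"
  have \<mu>v: "valid \<mu>" using uv dv(1) by (auto simp: \<mu>_def valid_def)
  have tau_\<mu>: "tau (scal ?l \<mu>) t = tau u t" for t
    using uv unfolding \<mu>_def
  proof (induction u)
    case (Cons x u)
    obtain s e where x: "x = (s, e)" by fastforce
    have e: "e \<in> carrier E" using Cons.prems by (simp add: x)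
    have "sm (tr (?l * (ls * s) * t)) (dv e) = sm (tr (nl * (s * t))) (dv e)"
      by (simp add: nl mult.assoc)
    also have "\<dots> = sm (tr (s * t) * nl) (dv e)" by (simp add: tr_mult nl_inv mult.commute)
    also have "\<dots> = sm (tr (s * t)) e" by (simp add: sm_mult tr_invs nl_inv dv e)
    finally show ?case using Cons by (simp add: x)
  qed simp
  have bsum_\<mu>: "bsum \<beta> (scal ?l \<mu>) - bsum \<beta> u \<in> N" if \<beta>: "balanced N \<beta>" for \<beta>
    using uv unfolding \<mu>_def
  proof (induction u)
    case Nil
    then show ?case by (simp add: N)
  next
    case (Cons x u)
    obtain s e where x: "x = (s, e)" by fastforce
    have e: "e \<in> carrier E" using Cons.prems by (simp add: x)
    have "\<beta> (nl * s) (dv e) - \<beta> s (sm nl (dv e)) \<in> N"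
      by (rule balancedD(3)[OF \<beta> dv(1)[OF e] nl_inv])
    then have "\<beta> (?l * (ls * s)) (dv e) - \<beta> s e \<in> N"
      by (simp add: dv(2)[OF e]) (simp add: nl mult.assoc)
    from N(2)[OF this Cons.IH] show ?case using Cons.prems by (simp add: x algebra_simps)
  qed
  define \<xi> where "\<xi> = tau \<mu>"
  have \<xi>: "lin_map UNIV \<xi>" unfolding \<xi>_def by (rule tau_lin_map[OF \<mu>v])
  have "\<xi> (?l * t) = \<zero>" for t
    using tau_\<mu>[of t] u by (simp add: \<xi>_def tau_scal kern_def)
  then obtain \<xi>' where \<xi>': "lin_map UNIV \<xi>'" "\<And>t. \<xi>' (?l * t) = \<zero>" "\<And>t. \<xi>' (?l' * t) = \<xi> t"
    using split_map[OF c indep \<xi>] by blast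
  obtain \<xi>'' where \<xi>'': "lin_map UNIV \<xi>''" "\<And>t. \<xi>'' (P * t) = \<xi>' t"
    using divide_map[OF T(2) \<xi>'(1)] by blast
  define \<nu> where "\<nu> = map (\<lambda>(a, b). (a, \<xi>'' b)) T"
  have \<nu>v: "valid \<nu>" by (auto simp: \<nu>_def valid_def lin_map_UNIV(1)[OF \<xi>''(1)])
  have tau_\<nu>: "tau \<nu> t = \<xi>' t" for t
    using tau_section[OF T(1) \<xi>''(1)] \<xi>''(2) by (simp add: \<nu>_def)
  have k1: "kern (\<mu> @ scal (- ?l') \<nu>)"
  proof -
    have "\<xi>' (- ?l' * t) = \<xi> (- t)" for t using \<xi>'(3)[of "- t"] by simp
    moreover have "\<xi> t \<oplus> \<xi> (- t) = \<zero>" for t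
      using lin_map_UNIV(2)[OF \<xi>, of t "- t"] lin_map_UNIV(4)[OF \<xi>] by simp
    ultimately show ?thesis
      by (simp add: kern_def \<mu>v \<nu>v tau_append tau_scal tau_\<nu> flip: \<xi>_def)
  qed
  have k2: "kern (scal ?l \<nu>)"
    by (simp add: kern_def \<nu>v tau_scal tau_\<nu> \<xi>'(2))
  show ?thesis
    unfolding tensor_zero_def
  proof (intro allI impI)
    fix \<beta> assume \<beta>: "balanced N \<beta>"
    have A: "bsum \<beta> (scal (?l * Q) (\<mu> @ scal (- ?l') \<nu>)) \<in> N"
      using 1[OF k1] \<beta> by (simp add: tensor_zero_def)
    have B: "bsum (\<lambda>s. \<beta> (- 1 * s)) (scal (?l' * Q) (scal ?l \<nu>)) \<in> N"
      using 2[OF k2] balanced_mult[OF \<beta>] unfolding tensor_zero_def by blast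
    have B': "bsum (\<lambda>s. \<beta> (- 1 * s)) (scal (?l' * Q) (scal ?l \<nu>)) = bsum \<beta> (scal (?l * Q) (scal (- ?l') \<nu>))"
      unfolding bsum_scal[symmetric] scal_scal by (rule arg_cong[where f = "\<lambda>x. bsum \<beta> (scal x \<nu>)"]) simp
    have C: "bsum \<beta> (scal (?l * Q) \<mu>) \<in> N"
      using N(4)[OF A B] unfolding B' by simp
    have D: "bsum (\<lambda>s. \<beta> (Q * s)) (scal ?l \<mu>) - bsum (\<lambda>s. \<beta> (Q * s)) u \<in> N"
      by (rule bsum_\<mu>[OF balanced_mult[OF \<beta>]])
    have E: "bsum (\<lambda>s. \<beta> (Q * s)) (scal ?l \<mu>) = bsum \<beta> (scal (?l * Q) \<mu>)"
      unfolding bsum_scal[symmetric] scal_scal by (simp add: mult.commute)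
    show "bsum \<beta> (scal Q u) \<in> N"
      using N(4)[OF C D] unfolding E by (simp add: bsum_scal)
  qed
qed

definition refl_form :: "'k ^ 'n ^ 'n \<Rightarrow> 'n \<Rightarrow> ('n, 'k) mpoly" where
  "refl_form g j = act g (mvar j) - mvar j"

lemma refl_form_eq_lin: "refl_form g j = lin (refl_col g j)"
proof -
  have "act (mat 1) (mvar j) = (mvar j :: ('n, 'k) mpoly)" by (rule act_mat_1)
  then have "mvar j = lin (\<lambda>i. (mat 1 :: 'k ^ 'n ^ 'n) $ i $ j)" by (simp add: act_mvar act_var_eq_lin)
  then show ?thesis
    unfolding refl_form_def act_mvar act_var_eq_lin
    by (simp add: refl_col_def lin_def left_diff_distrib sum_subtractf ring_map_diff[OF ring_map_mconst])
qed

text \<open>For each \<open>g \<noteq> 1\<close> and each linear form \<open>f\<close>, the element \<open>g(f) \<otimes> 1 - 1 \<otimes> f\<close> has the component \<open>g(f) - h(f)\<close> at \<open>h\<close>, which vanishes for \<open>h = g\<close>. The product over all \<open>g \<noteq> 1\<close> is supported at the identity.\<close>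

lemma supported_at_one_exists:
  "\<exists>T. supported_at_one T (\<Prod>g\<in>G - {mat 1}. refl_form g (c g))"
proof -
  have "\<exists>T. \<forall>h\<in>G. (\<Sum>(a, b)\<leftarrow>T. a * act h b) = (\<Prod>g\<in>F. act g (mvar (c g)) - act h (mvar (c g)))"
    if "finite F" for F
    using that
  proof induction
    case empty
    show ?case by (intro exI[of _ "[(1, 1)]"]) (simp add: act_1)
  next
    case (insert g F)
    then obtain T where T: "\<And>h. h \<in> G \<Longrightarrow> (\<Sum>(a, b)\<leftarrow>T. a * act h b) = (\<Prod>g\<in>F. act g (mvar (c g)) - act h (mvar (c g)))"
      by blast
    let ?T = "map (\<lambda>(a, b). (act g (mvar (c g)) * a, b)) T @ map (\<lambda>(a, b). (- a, mvar (c g) * b)) T"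
    have *: "(\<Sum>(a, b)\<leftarrow>?T. a * act h b) = (act g (mvar (c g)) - act h (mvar (c g))) * (\<Sum>(a, b)\<leftarrow>T. a * act h b)" for h
      by (simp add: left_diff_distrib comp_def split_def act_mult flip: sum_list_const_mult uminus_sum_list_map)
        (induction T, auto simp: algebra_simps)
    show ?case
      by (intro exI[of _ ?T] ballI, subst *) (simp add: T insert.hyps)
  qed
  from this[of "G - {mat 1}"] finG obtain T where
    T: "\<And>h. h \<in> G \<Longrightarrow> (\<Sum>(a, b)\<leftarrow>T. a * act h b) = (\<Prod>g\<in>G - {mat 1}. act g (mvar (c g)) - act h (mvar (c g)))"
    by auto
  have "(\<Prod>g\<in>G - {mat 1}. act g (mvar (c g)) - act h (mvar (c g))) = 0" if "h \<in> G" "h \<noteq> mat 1" for h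
    using that finG by (auto simp: mpoly_prod_eq_0)
  then have "supported_at_one T (\<Prod>g\<in>G - {mat 1}. refl_form g (c g))"
    by (auto simp: supported_at_one_def T act_mat_1 refl_form_def)
  then show ?thesis by blast
qed

text \<open>Without pseudo-reflections the pairing \<open>tau\<close> is injective. The kernel is killed by every product of linear forms \<open>g x\<^sub>j - x\<^sub>j\<close>, one for each \<open>g \<noteq> 1\<close>. Each \<open>g\<close> offers two independent forms, so \<open>coprime_step\<close> removes the factors one after the other. This is the algebraic content of the fact that the extension of the invariants is unramified in codimension one.\<close>

lemma kern_tensor_zero:
  assumes np: "\<forall>g\<in>G. \<not> pseudo_reflection g" and N: "additive_subgroup_set N" and u: "kern u"
  shows "tensor_zero N u"
proof -
  let ?F = "G - {mat 1}"
  have "\<exists>j j'. refl_col g j \<noteq> (\<lambda>_. 0) \<and> (\<nexists>a. refl_col g j' = (\<lambda>i. a * refl_col g j i))" if "g \<in> ?F" for g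
  proof -
    have "\<not> pseudo_reflection g" "g \<noteq> mat 1" using that np by auto
    then show ?thesis by (rule not_pseudo_reflection_columns) blast
  qed
  then obtain j j' where j: "\<And>g. g \<in> ?F \<Longrightarrow> refl_col g (j g) \<noteq> (\<lambda>_. 0)"
    and j': "\<And>g. g \<in> ?F \<Longrightarrow> \<nexists>a. refl_col g (j' g) = (\<lambda>i. a * refl_col g (j g) i)"
    by metis
  obtain T where T: "supported_at_one T (\<Prod>g\<in>?F. refl_form g (j g))" using supported_at_one_exists by blast
  have P0: "(\<Prod>g\<in>?F. refl_form g (j g)) \<noteq> 0"
  proof -
    have "refl_form g (j g) \<noteq> 0" if "g \<in> ?F" for g
    proof
      assume "refl_form g (j g) = 0"
      then have "lin (refl_col g (j g)) = lin (\<lambda>_. 0)"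
        by (simp add: refl_form_eq_lin) (simp add: lin_def mconst_simps)
      then show False using j[OF that] by (simp only: lin_eq_iff)
    qed
    then show ?thesis using finG by (auto simp: mpoly_prod_eq_0)
  qed
  have "\<forall>c. \<forall>u. kern u \<longrightarrow> tensor_zero N (scal (\<Prod>g\<in>?F - D. refl_form g (c g)) u)"
    if "finite D" "D \<subseteq> ?F" for D
    using that
  proof induction
    case empty
    show ?case using supported_at_one_exists kern_killed N by (metis Diff_empty)
  next
    case (insert g D)
    have g: "g \<in> ?F" using insert.prems by blast
    have F: "?F - D = insert g (?F - insert g D)" using g insert.hyps by blast
    show ?case
    proof (intro allI impI)
      fix c u assume u: "kern u"
      let ?Q = "\<Prod>g\<in>?F - insert g D. refl_form g (c g)"
      have *: "tensor_zero N (scal (refl_form g i * ?Q) u)" if "kern u" for i u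
      proof -
        have "(\<Prod>h\<in>?F - D. refl_form h ((c(g := i)) h)) = refl_form g i * (\<Prod>h\<in>?F - insert g D. refl_form h ((c(g := i)) h))"
          unfolding F using finG by (subst prod.insert) auto
        also have "(\<Prod>h\<in>?F - insert g D. refl_form h ((c(g := i)) h)) = ?Q"
          by (rule prod.cong) auto
        finally have eq: "(\<Prod>h\<in>?F - D. refl_form h ((c(g := i)) h)) = refl_form g i * ?Q" .
        have "D \<subseteq> ?F" using insert.prems by simp
        then have "tensor_zero N (scal (\<Prod>h\<in>?F - D. refl_form h ((c(g := i)) h)) u)"
          by (intro insert.IH[rule_format] that)
        then show ?thesis by (simp only: eq)
      qed
      show "tensor_zero N (scal ?Q u)"
        by (rule coprime_step[OF T P0 j[OF g] j'[OF g] N _ _ u])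
          (use * in \<open>simp_all flip: refl_form_eq_lin\<close>)
    qed
  qed
  from this[of ?F] finG u have "tensor_zero N (scal 1 u)" by simp
  moreover have "scal 1 u = u" by (induction u) auto
  ultimately show ?thesis by simp
qed

text \<open>The pairing of \<open>x\<^sub>i \<otimes> z\<close> with \<open>t\<close> is \<open>tr (x\<^sub>i t) z\<close>, and the trace of a polynomial without constant term acts as zero on the socle.\<close>

theorem mvar_tensor_socle_zero:
  assumes np: "\<forall>g\<in>G. \<not> pseudo_reflection g" and N: "additive_subgroup_set N"
    and z: "z \<in> carrier E" "\<And>r. r \<in> invs G \<Longrightarrow> cterm r = 0 \<Longrightarrow> sm r z = \<zero>"
    and \<beta>: "balanced N \<beta>"
  shows "\<beta> (mvar i) z \<in> N"
proof -
  have "kern [(mvar i, z)]"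
    using z by (auto simp: kern_def tr_invs cterm_tr ring_map_mult[OF ring_map_cterm])
  from kern_tensor_zero[OF np N this] \<beta> show ?thesis
    by (simp add: tensor_zero_def)
qed

end

section \<open>The local ring of invariants\<close>

context lin_group
begin

text \<open>The invariants outside the maximal ideal, which are the denominators of the local ring.\<close>

definition den :: "('n, 'k) mpoly set" where
  "den = {s \<in> invs G. cterm s \<noteq> 0}"

lemma den_invs: "s \<in> den \<Longrightarrow> s \<in> invs G" by (simp add: den_def)

lemma den_mult: "s \<in> den \<Longrightarrow> t \<in> den \<Longrightarrow> s * t \<in> den"
  by (simp add: den_def invs_mult ring_map_mult[OF ring_map_cterm])

lemma den_1: "1 \<in> den"
  by (simp add: den_def invs_1 ring_map_1[OF ring_map_cterm])

lemma den_nonzero: "s \<in> den \<Longrightarrow> s \<noteq> 0"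
  by (auto simp: den_def)

lemma den_power: "s \<in> den \<Longrightarrow> s ^ n \<in> den"
  by (induction n) (auto simp: den_1 den_mult)

lemma carrier_invariant_ring: "carrier (invariant_ring G) = invs G"
  by (simp add: invariant_ring_def invs_def)

lemma invariant_ring_simps:
  "x \<otimes>\<^bsub>invariant_ring G\<^esub> y = x * y" "x \<oplus>\<^bsub>invariant_ring G\<^esub> y = x + y"
  "\<one>\<^bsub>invariant_ring G\<^esub> = 1" "\<zero>\<^bsub>invariant_ring G\<^esub> = 0"
  by (simp_all add: invariant_ring_def ring_of_type_algebra_def)

text \<open>Modulo the first powers of the variables only the constant term survives.\<close>

lemma genideal_mvar:
  "Idl\<^bsub>ring_of_type_algebra\<^esub> (range mvar) = {f :: ('n, 'k) mpoly. cterm f = 0}"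
proof -
  let ?S = "ring_of_type_algebra :: ('n, 'k) mpoly ring"
  interpret S: cring ?S by (rule cring_from_type_algebra)
  have S: "carrier ?S = UNIV" "x \<otimes>\<^bsub>?S\<^esub> y = x * y" "x \<oplus>\<^bsub>?S\<^esub> y = x + y" "\<zero>\<^bsub>?S\<^esub> = 0" for x y
    by (simp_all add: ring_of_type_algebra_def)
  have neg: "\<ominus>\<^bsub>?S\<^esub> x = - x" for x
    by (rule S.minus_equality) (simp_all add: S)
  have "ideal {f. cterm f = 0} ?S"
  proof (rule idealI[OF S.ring_axioms])
    show "subgroup {f. cterm f = 0} (add_monoid ?S)"
      by (rule S.add.subgroupI)
        (auto simp: S neg lookup_add intro: exI[of _ 0])
  qed (simp_all add: S ring_map_mult[OF ring_map_cterm])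
  then have 1: "Idl\<^bsub>?S\<^esub> (range mvar) \<subseteq> {f. cterm f = 0}"
    by (rule S.genideal_minimal) auto
  have I: "ideal (Idl\<^bsub>?S\<^esub> (range mvar)) ?S"
    by (rule S.genideal_ideal) (simp add: S)
  have "f \<in> Idl\<^bsub>?S\<^esub> (range mvar)" if "cterm f = 0" for f
  proof -
    have "f \<in> frob_ideal 1"
      using that by (auto simp: frob_ideal_def expbox_def poly_mapping_eq_iff fun_eq_iff)
        (metis lookup_zero poly_mapping_eqI)
    then obtain s where s: "f = (\<Sum>i\<in>UNIV. s i * mvar i ^ 1)" by (rule frob_ideal_decomp)
    have "(\<Sum>i\<in>B. s i * mvar i) \<in> Idl\<^bsub>?S\<^esub> (range mvar)" if "finite B" for B
      using that
    proof induction
      case empty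
      then show ?case using additive_subgroup.zero_closed[OF ideal.axioms(1)[OF I]] by (simp add: S)
    next
      case (insert i B)
      have "mvar i \<in> Idl\<^bsub>?S\<^esub> (range mvar)" using S.genideal_self[of "range mvar"] by (auto simp: S)
      then have "s i * mvar i \<in> Idl\<^bsub>?S\<^esub> (range mvar)"
        using ideal.I_l_closed[OF I, of "mvar i" "s i"] by (simp add: S)
      then show ?case
        using insert additive_subgroup.a_closed[OF ideal.axioms(1)[OF I]] by (simp add: S)
    qed
    then show ?thesis using s by simp
  qed
  then show ?thesis using 1 by blast
qed

lemma invariant_max_ideal_eq: "invariant_max_ideal G = {f \<in> invs G. cterm f = 0}"
  by (auto simp: invariant_max_ideal_def genideal_mvar carrier_invariant_ring)

lemma den_eq: "carrier (invariant_ring G) - invariant_max_ideal G = den"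
  by (auto simp: invariant_max_ideal_eq carrier_invariant_ring den_def)

text \<open>The fraction \<open>r / s\<close> of the local ring. There are no zero divisors, so equality of fractions is equality of the cross products.\<close>

definition lfrac :: "('n, 'k) mpoly \<Rightarrow> ('n, 'k) mpoly \<Rightarrow> (('n, 'k) mpoly \<times> ('n, 'k) mpoly) set" where
  "lfrac r s = {(r', s'). r' \<in> invs G \<and> s' \<in> den \<and> r * s' = r' * s}"

lemma fraction_eq_lfrac: "fraction (invariant_ring G) (invariant_max_ideal G) r s = lfrac r s"
  unfolding fraction_def lfrac_def den_eq
  unfolding carrier_invariant_ring invariant_ring_simps
  using den_1 by (auto simp: mpoly_mult_left_cancel den_nonzero)

abbreviation A where "A \<equiv> invariant_local_ring G"

lemma lfrac_eq_iff:
  assumes "r \<in> invs G" "s \<in> den" "r' \<in> invs G" "s' \<in> den"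
  shows "lfrac r s = lfrac r' s' \<longleftrightarrow> r * s' = r' * s"
proof
  assume "lfrac r s = lfrac r' s'"
  moreover have "(r', s') \<in> lfrac r' s'" using assms by (simp add: lfrac_def)
  ultimately show "r * s' = r' * s" by (auto simp: lfrac_def)
next
  assume eq: "r * s' = r' * s"
  have "r * t = u * s \<longleftrightarrow> r' * t = u * s'" for u t
  proof -
    have "r * t = u * s \<longleftrightarrow> s' * (r * t) = s' * (u * s)"
      using den_nonzero[OF assms(4)] by (simp add: mpoly_mult_left_cancel)
    also have "\<dots> \<longleftrightarrow> s * (r' * t) = s * (u * s')"
    proof -
      have "s' * (r * t) = (r * s') * t" by (simp add: ac_simps)
      also have "\<dots> = s * (r' * t)" unfolding eq by (simp add: ac_simps)
      finally have 1: "s' * (r * t) = s * (r' * t)" .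
      have 2: "s' * (u * s) = s * (u * s')" by (simp add: ac_simps)
      show ?thesis by (simp only: 1 2)
    qed
    also have "\<dots> \<longleftrightarrow> r' * t = u * s'"
      using den_nonzero[OF assms(2)] by (simp add: mpoly_mult_left_cancel)
    finally show ?thesis .
  qed
  then show "lfrac r s = lfrac r' s'" by (simp add: lfrac_def)
qed

lemma lfrac_rep: "(r', s') \<in> lfrac r s \<Longrightarrow> r' \<in> invs G \<and> s' \<in> den \<and> r * s' = r' * s"
  by (simp add: lfrac_def)

lemma lfrac_self: "r \<in> invs G \<Longrightarrow> s \<in> den \<Longrightarrow> (r, s) \<in> lfrac r s"
  by (simp add: lfrac_def)

lemma carrier_A: "carrier A = {lfrac r s | r s. r \<in> invs G \<and> s \<in> den}"
  unfolding invariant_local_ring_def localization_def fraction_eq_lfrac den_eq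
  by (simp add: carrier_invariant_ring)

lemma lfrac_in_A: "r \<in> invs G \<Longrightarrow> s \<in> den \<Longrightarrow> lfrac r s \<in> carrier A"
  by (auto simp: carrier_A)

lemma A_cases:
  assumes "x \<in> carrier A"
  obtains r s where "x = lfrac r s" "r \<in> invs G" "s \<in> den"
  using assms by (auto simp: carrier_A)

lemma one_A: "\<one>\<^bsub>A\<^esub> = lfrac 1 1" and zero_A: "\<zero>\<^bsub>A\<^esub> = lfrac 0 1"
  by (simp_all add: invariant_local_ring_def localization_def fraction_eq_lfrac invariant_ring_simps)

lemma UN_pairs_const:
  assumes "\<And>a b c d. (a, b) \<in> Y \<Longrightarrow> (c, d) \<in> Z \<Longrightarrow> F a b c d = W"
    and "(a0, b0) \<in> Y" "(c0, d0) \<in> Z"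
  shows "(\<Union>(a, b)\<in>Y. \<Union>(c, d)\<in>Z. F a b c d) = W"
proof (intro equalityI subsetI)
  fix x assume "x \<in> (\<Union>(a, b)\<in>Y. \<Union>(c, d)\<in>Z. F a b c d)"
  then obtain a b c d where "(a, b) \<in> Y" "(c, d) \<in> Z" "x \<in> F a b c d" by auto
  then show "x \<in> W" using assms(1) by blast
next
  fix x assume "x \<in> W"
  then have "x \<in> F a0 b0 c0 d0" using assms by simp
  then show "x \<in> (\<Union>(a, b)\<in>Y. \<Union>(c, d)\<in>Z. F a b c d)" using assms(2,3) by blast
qed

lemma mult_A:
  assumes "r \<in> invs G" "s \<in> den" "r' \<in> invs G" "s' \<in> den"
  shows "lfrac r s \<otimes>\<^bsub>A\<^esub> lfrac r' s' = lfrac (r * r') (s * s')"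
proof -
  have "lfrac r s \<otimes>\<^bsub>A\<^esub> lfrac r' s' = (\<Union>(a, b)\<in>lfrac r s. \<Union>(c, d)\<in>lfrac r' s'. lfrac (a * c) (b * d))"
    by (simp add: invariant_local_ring_def localization_def fraction_eq_lfrac invariant_ring_simps)
  also have "\<dots> = lfrac (r * r') (s * s')"
  proof (rule UN_pairs_const[OF _ lfrac_self lfrac_self])
    fix a b c d assume "(a, b) \<in> lfrac r s" "(c, d) \<in> lfrac r' s'"
    then have x: "a \<in> invs G" "b \<in> den" "r * b = a * s" and y: "c \<in> invs G" "d \<in> den" "r' * d = c * s'"
      by (auto dest!: lfrac_rep)
    have "(a * c) * (s * s') = (a * s) * (c * s')" by (simp add: ac_simps)
    also have "\<dots> = (r * b) * (r' * d)" by (simp only: x(3) y(3))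
    also have "\<dots> = (r * r') * (b * d)" by (simp add: ac_simps)
    finally show "lfrac (a * c) (b * d) = lfrac (r * r') (s * s')"
      using assms x y by (subst lfrac_eq_iff) (auto intro: invs_mult invs_add den_mult dest: den_invs)
  qed (use assms in auto)
  finally show ?thesis .
qed

lemma add_A:
  assumes "r \<in> invs G" "s \<in> den" "r' \<in> invs G" "s' \<in> den"
  shows "lfrac r s \<oplus>\<^bsub>A\<^esub> lfrac r' s' = lfrac (r * s' + r' * s) (s * s')"
proof -
  have "lfrac r s \<oplus>\<^bsub>A\<^esub> lfrac r' s' = (\<Union>(a, b)\<in>lfrac r s. \<Union>(c, d)\<in>lfrac r' s'. lfrac (a * d + c * b) (b * d))"
    by (simp add: invariant_local_ring_def localization_def fraction_eq_lfrac invariant_ring_simps)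
  also have "\<dots> = lfrac (r * s' + r' * s) (s * s')"
  proof (rule UN_pairs_const[OF _ lfrac_self lfrac_self])
    fix a b c d assume "(a, b) \<in> lfrac r s" "(c, d) \<in> lfrac r' s'"
    then have x: "a \<in> invs G" "b \<in> den" "r * b = a * s" and y: "c \<in> invs G" "d \<in> den" "r' * d = c * s'"
      by (auto dest!: lfrac_rep)
    have "(a * d + c * b) * (s * s') = (a * s) * (d * s') + (c * s') * (b * s)" by (simp add: algebra_simps)
    also have "\<dots> = (r * b) * (d * s') + (r' * d) * (b * s)" by (simp only: x(3) y(3))
    also have "\<dots> = (r * s' + r' * s) * (b * d)" by (simp add: algebra_simps)
    finally show "lfrac (a * d + c * b) (b * d) = lfrac (r * s' + r' * s) (s * s')"
      using assms x y by (subst lfrac_eq_iff) (auto intro: invs_mult invs_add den_mult dest: den_invs)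
  qed (use assms in auto)
  finally show ?thesis .
qed

lemmas inv_closed = invs_mult invs_add invs_minus invs_diff invs_0 invs_1 den_mult den_1 den_invs

lemma cring_A: "cring A"
proof (rule cringI)
  show "abelian_group A"
  proof (rule abelian_groupI)
    fix x assume "x \<in> carrier A"
    then obtain r s where x: "x = lfrac r s" "r \<in> invs G" "s \<in> den" by (rule A_cases)
    show "\<exists>y\<in>carrier A. y \<oplus>\<^bsub>A\<^esub> x = \<zero>\<^bsub>A\<^esub>"
      by (rule bexI[of _ "lfrac (- r) s"])
        (simp_all add: x add_A zero_A lfrac_eq_iff inv_closed lfrac_in_A)
    show "\<zero>\<^bsub>A\<^esub> \<oplus>\<^bsub>A\<^esub> x = x"
      by (simp add: x add_A zero_A lfrac_eq_iff inv_closed)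
  qed (auto elim!: A_cases simp: add_A zero_A lfrac_eq_iff inv_closed lfrac_in_A algebra_simps)
  show "Group.comm_monoid A"
    by (rule comm_monoidI)
      (auto elim!: A_cases simp: mult_A one_A lfrac_eq_iff inv_closed lfrac_in_A algebra_simps)
next
  fix x y w assume "x \<in> carrier A" "y \<in> carrier A" "w \<in> carrier A"
  then obtain r s r' s' r'' s'' where x: "x = lfrac r s" "r \<in> invs G" "s \<in> den"
    and y: "y = lfrac r' s'" "r' \<in> invs G" "s' \<in> den" and w: "w = lfrac r'' s''" "r'' \<in> invs G" "s'' \<in> den"
    by (elim A_cases)
  have "lfrac ((r * s' + r' * s) * r'') ((s * s') * s'') =
      lfrac ((r * r'') * (s' * s'') + (r' * r'') * (s * s'')) ((s * s'') * (s' * s''))"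
    using den_invs[OF x(3)] den_invs[OF y(3)] den_invs[OF w(3)] x y w
    by (subst lfrac_eq_iff) (auto intro!: invs_mult invs_add den_mult simp: algebra_simps)
  then show "(x \<oplus>\<^bsub>A\<^esub> y) \<otimes>\<^bsub>A\<^esub> w = x \<otimes>\<^bsub>A\<^esub> w \<oplus>\<^bsub>A\<^esub> y \<otimes>\<^bsub>A\<^esub> w"
    using x y w by (simp add: mult_A add_A inv_closed)
qed

lemma minus_A: "r \<in> invs G \<Longrightarrow> s \<in> den \<Longrightarrow> \<ominus>\<^bsub>A\<^esub> lfrac r s = lfrac (- r) s"
proof -
  assume *: "r \<in> invs G" "s \<in> den"
  interpret A: cring A by (rule cring_A)
  show ?thesis
    by (rule A.minus_equality) (simp_all add: * add_A zero_A lfrac_eq_iff inv_closed lfrac_in_A)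
qed

lemma power_A: "r \<in> invs G \<Longrightarrow> s \<in> den \<Longrightarrow> lfrac r s [^]\<^bsub>A\<^esub> (n::nat) = lfrac (r ^ n) (s ^ n)"
proof (induction n)
  case 0
  then show ?case by (simp add: one_A)
next
  case (Suc n)
  then show ?case by (simp add: mult_A invs_power den_power mult.commute)
qed

definition r_ideal :: "('n, 'k) mpoly set \<Rightarrow> bool" where
  "r_ideal J \<longleftrightarrow> J \<subseteq> invs G \<and> 0 \<in> J \<and> (\<forall>a\<in>J. \<forall>b\<in>J. a + b \<in> J) \<and> (\<forall>r\<in>invs G. \<forall>a\<in>J. r * a \<in> J)"

text \<open>The extension of an ideal of the invariants to the local ring.\<close>

definition loc :: "('n, 'k) mpoly set \<Rightarrow> (('n, 'k) mpoly \<times> ('n, 'k) mpoly) set set" where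
  "loc J = {lfrac r s | r s. r \<in> J \<and> s \<in> den}"

lemma r_idealD:
  assumes "r_ideal J"
  shows "a \<in> J \<Longrightarrow> a \<in> invs G" "0 \<in> J" "a \<in> J \<Longrightarrow> b \<in> J \<Longrightarrow> a + b \<in> J"
    "r \<in> invs G \<Longrightarrow> a \<in> J \<Longrightarrow> r * a \<in> J" "a \<in> J \<Longrightarrow> - a \<in> J"
proof -
  show 1: "a \<in> J \<Longrightarrow> a \<in> invs G" "0 \<in> J" "a \<in> J \<Longrightarrow> b \<in> J \<Longrightarrow> a + b \<in> J"
    "r \<in> invs G \<Longrightarrow> a \<in> J \<Longrightarrow> r * a \<in> J" for a b r
    using assms by (auto simp: r_ideal_def)
  show "a \<in> J \<Longrightarrow> - a \<in> J" using 1(4)[of "-1" a] by (simp add: inv_closed)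
qed

lemma ideal_loc: "r_ideal J \<Longrightarrow> ideal (loc J) A"
proof -
  assume J: "r_ideal J"
  interpret A: cring A by (rule cring_A)
  note J = r_idealD[OF J]
  have mul: "x \<otimes>\<^bsub>A\<^esub> a \<in> loc J" if aJ: "a \<in> loc J" and xA: "x \<in> carrier A" for a x
  proof -
    obtain r s where x: "x = lfrac r s" "r \<in> invs G" "s \<in> den" using xA by (rule A_cases)
    obtain b t where a: "a = lfrac b t" "b \<in> J" "t \<in> den" using aJ by (auto simp: loc_def)
    have "x \<otimes>\<^bsub>A\<^esub> a = lfrac (r * b) (s * t)" using x a J(1) by (simp add: mult_A)
    then show ?thesis using J(4)[OF x(2) a(2)] den_mult[OF x(3) a(3)] by (auto simp: loc_def)
  qed
  have sub: "loc J \<subseteq> carrier A" using J(1) lfrac_in_A by (auto simp: loc_def)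
  show ?thesis
  proof (rule idealI[OF A.ring_axioms])
    show "subgroup (loc J) (add_monoid A)"
    proof (rule A.add.subgroupI)
      show "loc J \<subseteq> carrier A" by (rule sub)
      show "loc J \<noteq> {}" using J(2) den_1 by (auto simp: loc_def)
      fix a b assume a: "a \<in> loc J" and b: "b \<in> loc J"
      obtain r s where a: "a = lfrac r s" "r \<in> J" "s \<in> den" using a by (auto simp: loc_def)
      obtain r' s' where b: "b = lfrac r' s'" "r' \<in> J" "s' \<in> den" using b by (auto simp: loc_def)
      have "r * s' + r' * s \<in> J"
        using J(3)[OF J(4)[OF den_invs[OF b(3)] a(2)] J(4)[OF den_invs[OF a(3)] b(2)]] by (simp add: mult.commute)
      then show "a \<oplus>\<^bsub>A\<^esub> b \<in> loc J"
        using a b J(1) den_mult[OF a(3) b(3)] by (auto simp: add_A loc_def)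
    next
      fix a assume "a \<in> loc J"
      then obtain r s where a: "a = lfrac r s" "r \<in> J" "s \<in> den" by (auto simp: loc_def)
      then show "\<ominus>\<^bsub>A\<^esub> a \<in> loc J" using J(5)[OF a(2)] by (auto simp: minus_A J(1) loc_def)
    qed
    fix a x assume *: "a \<in> loc J" "x \<in> carrier A"
    show "x \<otimes>\<^bsub>A\<^esub> a \<in> loc J" by (rule mul[OF *])
    then show "a \<otimes>\<^bsub>A\<^esub> x \<in> loc J" using A.m_comm[of a x] * sub by auto
  qed
qed

definition inv_max :: "('n, 'k) mpoly set" where "inv_max = {f \<in> invs G. cterm f = 0}"

lemma r_ideal_inv_max: "r_ideal inv_max"
  by (auto simp: r_ideal_def inv_max_def inv_closed lookup_add ring_map_mult[OF ring_map_cterm])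

lemma frac_in_loc_inv_max: "r \<in> invs G \<Longrightarrow> s \<in> den \<Longrightarrow> lfrac r s \<in> loc inv_max \<longleftrightarrow> cterm r = 0"
proof
  assume *: "r \<in> invs G" "s \<in> den" "lfrac r s \<in> loc inv_max"
  then obtain r' s' where **: "lfrac r s = lfrac r' s'" "r' \<in> inv_max" "s' \<in> den" by (auto simp: loc_def)
  then have "r * s' = r' * s" using * by (simp add: lfrac_eq_iff inv_max_def)
  then have "cterm r * cterm s' = cterm r' * cterm s" by (metis ring_map_mult[OF ring_map_cterm])
  then show "cterm r = 0" using ** by (auto simp: inv_max_def den_def)
next
  assume "r \<in> invs G" "s \<in> den" "cterm r = 0"
  then show "lfrac r s \<in> loc inv_max" by (auto simp: loc_def inv_max_def)
qed

lemma ideal_with_unit: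
  assumes I: "ideal I A" and x: "x \<in> I" "x \<notin> loc inv_max"
  shows "I = carrier A"
proof -
  have sub: "I \<subseteq> carrier A" using I additive_subgroup.a_subset ideal.axioms(1) by blast
  obtain r s where r: "x = lfrac r s" "r \<in> invs G" "s \<in> den" using A_cases x sub by blast
  have rd: "r \<in> den" using x r frac_in_loc_inv_max by (auto simp: den_def)
  have "lfrac s r \<otimes>\<^bsub>A\<^esub> x \<in> I"
    by (rule ideal.I_l_closed[OF I x(1)]) (simp add: lfrac_in_A rd r inv_closed)
  moreover have "lfrac s r \<otimes>\<^bsub>A\<^esub> x = \<one>\<^bsub>A\<^esub>"
    using r rd by (simp add: mult_A one_A lfrac_eq_iff inv_closed mult.commute)
  ultimately show ?thesis using ideal.one_imp_carrier[OF I] by simp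
qed

lemma loc_inv_max_proper: "loc inv_max \<noteq> carrier A"
proof
  assume "loc inv_max = carrier A"
  then have "lfrac 1 1 \<in> loc inv_max" by (simp add: lfrac_in_A inv_closed)
  then show False by (simp add: frac_in_loc_inv_max inv_closed ring_map_1[OF ring_map_cterm])
qed

lemma max_ideal_A: "max_ideal A = loc inv_max"
  unfolding max_ideal_def
proof (rule the_equality)
  note I = ideal_loc[OF r_ideal_inv_max]
  show "maximalideal (loc inv_max) A"
  proof (rule maximalidealI[OF I])
    show "carrier A \<noteq> loc inv_max" using loc_inv_max_proper by simp
    fix J assume "ideal J A" "loc inv_max \<subseteq> J"
    then show "J = loc inv_max \<or> J = carrier A" using ideal_with_unit by blast
  qed
  fix J assume J: "maximalideal J A"
  then have iJ: "ideal J A" and ne: "carrier A \<noteq> J" by (auto simp: maximalideal_def maximalideal_axioms_def)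
  have "J \<subseteq> loc inv_max" using ideal_with_unit[OF iJ] ne by blast
  moreover have "loc inv_max \<subseteq> carrier A" using I additive_subgroup.a_subset ideal.axioms(1) by blast
  ultimately show "J = loc inv_max"
    using maximalideal.I_maximal[OF J I] loc_inv_max_proper by blast
qed

lemma of_nat_A: "add_pow A (n::nat) \<one>\<^bsub>A\<^esub> = lfrac (of_nat n) 1"
proof -
  interpret A: cring A by (rule cring_A)
  have inv: "of_nat n \<in> invs G" for n by (induction n) (auto intro: inv_closed)
  show ?thesis
  proof (induction n)
    case 0
    then show ?case by (simp add: zero_A)
  next
    case (Suc n)
    have "add_pow A (Suc n) \<one>\<^bsub>A\<^esub> = add_pow A n \<one>\<^bsub>A\<^esub> \<oplus>\<^bsub>A\<^esub> \<one>\<^bsub>A\<^esub>" by simp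
    also have "\<dots> = lfrac (of_nat n) 1 \<oplus>\<^bsub>A\<^esub> lfrac 1 1" by (subst Suc) (simp only: one_A)
    also have "\<dots> = lfrac (of_nat (Suc n)) 1" using inv by (simp add: add_A inv_closed add.commute)
    finally show ?case .
  qed
qed

lemma ring_char_A: "ring_char A = p"
proof -
  have inv: "of_nat n \<in> invs G" for n by (induction n) (auto intro: inv_closed)
  have "lfrac (of_nat n) 1 = lfrac 0 1 \<longleftrightarrow> p dvd n" for n
    using inv[of n] by (simp add: lfrac_eq_iff inv_closed of_nat_eq_0_iff_char_dvd CHAR_mpoly char)
  then have *: "add_pow A (n::nat) \<one>\<^bsub>A\<^esub> = \<zero>\<^bsub>A\<^esub> \<longleftrightarrow> p dvd n" for n
    by (simp only: of_nat_A zero_A)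
  have "(LEAST n. n > 0 \<and> p dvd n) = p"
    by (rule Least_equality) (auto simp: p_pos dvd_imp_le)
  then show ?thesis using p_pos by (auto simp: ring_char_def *)
qed

end

section \<open>Krull dimension\<close>

lemma map_poly_mult_ring_map:
  fixes h :: "'a::comm_ring_1 \<Rightarrow> 'b::comm_ring_1"
  assumes h: "ring_map h"
  shows "map_poly h (f * g) = map_poly h f * map_poly h g"
proof (rule poly_eqI)
  fix n
  have 0: "h 0 = 0" by (rule ring_map_0[OF h])
  show "Polynomial.coeff (map_poly h (f * g)) n = Polynomial.coeff (map_poly h f * map_poly h g) n"
    by (simp add: coeff_map_poly[of h, OF 0] Polynomial.coeff_mult ring_map_sum[OF h] ring_map_mult[OF h])
qed

lemma map_poly_prod_ring_map:
  fixes h :: "'a::comm_ring_1 \<Rightarrow> 'b::comm_ring_1"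
  assumes h: "ring_map h"
  shows "map_poly h (prod f B) = (\<Prod>b\<in>B. map_poly h (f b))"
  by (induction B rule: infinite_finite_induct)
    (simp_all add: map_poly_mult_ring_map[OF h] ring_map_1[OF h] ring_map_0[OF h] map_poly_1')

fun mon_eval :: "'a::comm_ring_1 list \<Rightarrow> nat list \<Rightarrow> 'a" where
  "mon_eval (y # ys) (n # ns) = y ^ n * mon_eval ys ns"
| "mon_eval ys ns = 1"

definition exps_le :: "nat \<Rightarrow> ('n::finite, 'k::field) mpoly \<Rightarrow> bool" where
  "exps_le B f \<longleftrightarrow> (\<forall>m\<in>Poly_Mapping.keys f. \<forall>i. Poly_Mapping.lookup m i \<le> B)"

lemma exps_le_mono: "exps_le B f \<Longrightarrow> B \<le> C \<Longrightarrow> exps_le C f"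
  unfolding exps_le_def using le_trans by blast

lemma exps_le_1: "exps_le B 1"
  by (auto simp: exps_le_def)

lemma exps_le_mult: "exps_le B f \<Longrightarrow> exps_le C g \<Longrightarrow> exps_le (B + C) (f * g)"
  unfolding exps_le_def
proof (intro ballI allI)
  fix m i
  assume B: "\<forall>m\<in>Poly_Mapping.keys f. \<forall>i. Poly_Mapping.lookup m i \<le> B"
    and C: "\<forall>m\<in>Poly_Mapping.keys g. \<forall>i. Poly_Mapping.lookup m i \<le> C"
    and m: "m \<in> Poly_Mapping.keys (f * g)"
  obtain a b where "m = a + b" "a \<in> Poly_Mapping.keys f" "b \<in> Poly_Mapping.keys g"
    using keys_mult[of f g] m by auto
  then show "Poly_Mapping.lookup m i \<le> B + C" using B C by (simp add: lookup_add add_mono)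
qed

lemma exps_le_power: "exps_le B f \<Longrightarrow> exps_le (n * B) (f ^ n)"
  by (induction n) (auto simp: exps_le_1 intro: exps_le_mult)

lemma exps_le_exists: "\<exists>B. exps_le B f"
proof -
  let ?B = "\<Sum>m\<in>Poly_Mapping.keys f. \<Sum>i\<in>UNIV. Poly_Mapping.lookup m i"
  have "Poly_Mapping.lookup m i \<le> ?B" if m: "m \<in> Poly_Mapping.keys f" for m i
  proof -
    have "Poly_Mapping.lookup m i \<le> (\<Sum>i\<in>UNIV. Poly_Mapping.lookup m i)"
      by (rule member_le_sum) auto
    also have "\<dots> \<le> ?B" using m by (intro member_le_sum[of m]) auto
    finally show ?thesis .
  qed
  then show ?thesis by (auto simp: exps_le_def)
qed

lemma exps_le_mono_list:
  assumes "\<And>y. y \<in> set ys \<Longrightarrow> exps_le D y" "length ns = length ys" "\<And>n. n \<in> set ns \<Longrightarrow> n < N"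
  shows "exps_le (length ys * (N * D)) (mon_eval ys ns)"
  using assms
proof (induction ys ns rule: mon_eval.induct)
  case (1 y ys n ns)
  have "exps_le (n * D) (y ^ n)" using 1 by (intro exps_le_power) auto
  then have "exps_le (N * D) (y ^ n)" using 1 by (elim exps_le_mono) (auto intro!: mult_right_mono less_imp_le)
  moreover have "exps_le (length ys * (N * D)) (mon_eval ys ns)" using 1 by auto
  ultimately show ?case using exps_le_mult by fastforce
qed (auto simp: exps_le_1)

text \<open>There are \<open>N\<^sup>d\<^sup>+\<^sup>1\<close> monomials in the \<open>d + 1\<close> given polynomials with exponents less than \<open>N\<close>, but their exponents in the variables grow linearly in \<open>N\<close>, so they lie in a space of dimension at most a constant times \<open>N\<^sup>d\<close>.\<close>

lemma algebraic_dependence: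
  fixes ys :: "('n::finite, 'k::field) mpoly list"
  assumes len: "length ys = CARD('n) + 1"
  obtains M c where "finite M" "\<And>a. a \<in> M \<Longrightarrow> length a = length ys"
    "(\<Sum>a\<in>M. mconst (c a) * mon_eval ys a) = 0" "\<exists>a\<in>M. c a \<noteq> 0"
proof -
  let ?d = "CARD('n)"
  have "\<exists>D. \<forall>y\<in>set ys. exps_le D y"
  proof (induction ys)
    case (Cons y ys)
    then obtain D where D: "\<forall>y\<in>set ys. exps_le D y" by blast
    obtain B where B: "exps_le B y" using exps_le_exists by blast
    show ?case
      using D B by (intro exI[of _ "max B D"]) (auto intro: exps_le_mono max.cobounded1 max.cobounded2)
  qed simp
  then obtain D where D: "\<And>y. y \<in> set ys \<Longrightarrow> exps_le D y" by blast
  define C where "C = (?d + 1) * D + 1"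
  \<comment> \<open>large enough that \<open>(C N)\<^sup>d < N\<^sup>d\<^sup>+\<^sup>1\<close>\<close>
  define N where "N = C ^ ?d + 1"
  define M where "M = {a. set a \<subseteq> {..<N} \<and> length a = ?d + 1}"
  have M: "finite M" "card M = N ^ (?d + 1)"
    unfolding M_def using finite_lists_length_eq[of "{..<N}"] card_lists_length_eq[of "{..<N}"] by auto
  let ?F = "monomials (expbox (\<lambda>_. C * N)) :: ('n, 'k) mpoly set"
  have F: "finite ?F" "card ?F \<le> (C * N) ^ ?d"
    using card_monomials[OF finite_expbox, of "\<lambda>_. C * N"] by (auto simp: monomials_def card_expbox)
  have "mon_eval ys a \<in> mp.span ?F" if a: "a \<in> M" for a
  proof (rule span_monomials, rule subsetI)
    fix m assume m: "m \<in> Poly_Mapping.keys (mon_eval ys a)"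
    have "exps_le (length ys * (N * D)) (mon_eval ys a)"
      using a len by (intro exps_le_mono_list D) (auto simp: M_def)
    then have le: "Poly_Mapping.lookup m i \<le> (?d + 1) * (N * D)" for i
      using m len by (simp add: exps_le_def)
    have "(?d + 1) * (N * D) < C * N" by (simp add: C_def N_def algebra_simps)
    then show "m \<in> expbox (\<lambda>_. C * N)" using le by (auto simp: expbox_def intro: le_less_trans)
  qed
  then have sp: "mon_eval ys ` M \<subseteq> mp.span ?F" by blast
  have "(C * N) ^ ?d < N ^ (?d + 1)"
  proof -
    have "C ^ ?d * N ^ ?d < N * N ^ ?d" by (intro mult_strict_right_mono) (auto simp: N_def)
    then show ?thesis by (simp add: power_mult_distrib)
  qed
  then have "\<not> card M \<le> card ?F" using F M by simp
  then have "\<exists>c. (\<Sum>a\<in>M. mconst (c a) * mon_eval ys a) = 0 \<and> \<not> (\<forall>a\<in>M. c a = 0)"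
    using mp.family_card_le[OF M(1) _ sp F(1)] by blast
  then obtain c where c: "(\<Sum>a\<in>M. mconst (c a) * mon_eval ys a) = 0" "\<exists>a\<in>M. c a \<noteq> 0" by blast
  have "length a = length ys" if "a \<in> M" for a using that len by (simp add: M_def)
  then show ?thesis using that M(1) c by blast
qed

context lin_group
begin

definition r_prime :: "('n, 'k) mpoly set \<Rightarrow> bool" where
  "r_prime P \<longleftrightarrow> r_ideal P \<and> 1 \<notin> P \<and> (\<forall>a\<in>invs G. \<forall>b\<in>invs G. a * b \<in> P \<longrightarrow> a \<in> P \<or> b \<in> P)"

lemma r_prime_power: "r_prime P \<Longrightarrow> a \<in> invs G \<Longrightarrow> b \<in> invs G \<Longrightarrow> a ^ n * b \<in> P \<Longrightarrow> a \<notin> P \<Longrightarrow> b \<in> P"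
proof (induction n)
  case (Suc n)
  then have "a * (a ^ n * b) \<in> P" by (simp add: mult.assoc)
  moreover have "a ^ n * b \<in> invs G" using Suc.prems by (intro invs_mult invs_power)
  ultimately have "a ^ n * b \<in> P" using Suc.prems unfolding r_prime_def by blast
  then show ?case using Suc by blast
qed simp

lemma r_ideal_sum: "r_ideal P \<Longrightarrow> (\<And>x. x \<in> B \<Longrightarrow> f x \<in> P) \<Longrightarrow> sum f B \<in> P"
  by (induction B rule: infinite_finite_induct) (auto simp: r_idealD)

lemma mono_invs: "set ys \<subseteq> invs G \<Longrightarrow> mon_eval ys a \<in> invs G"
  by (induction ys a rule: mon_eval.induct) (auto intro: invs_mult invs_power invs_1)

text \<open>Elements which witness the strict inclusions of a chain of primes are algebraically independent. In a relation modulo the first prime, the smallest power of the first element can be cancelled, because that element lies outside this prime. Modulo the next prime, which contains the element, only the terms with exactly that power remain, and they form a relation between the other elements.\<close>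

lemma prime_chain_independent:
  assumes "\<And>i. i \<le> length ys \<Longrightarrow> r_prime (P i)" "\<And>i. i < length ys \<Longrightarrow> P i \<subseteq> P (Suc i)"
    and "\<And>i. i < length ys \<Longrightarrow> ys ! i \<in> P (Suc i) - P i"
    and "finite M" "\<And>a. a \<in> M \<Longrightarrow> length a = length ys" "(\<Sum>a\<in>M. mconst (c a) * mon_eval ys a) \<in> P 0" "a \<in> M"
  shows "c a = 0"
  using assms
proof (induction ys arbitrary: P M c a)
  case Nil
  then have M: "M = {[]}" "a = []" by auto
  have P: "r_prime (P 0)" using Nil.prems(1)[of 0] by simp
  show ?case
  proof (rule ccontr)
    assume "c a \<noteq> 0"
    then have "mconst (inverse (c a)) * mconst (c a) = (1 :: ('n, 'k) mpoly)" by (simp flip: mconst_simps)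
    moreover have "mconst (inverse (c a)) * mconst (c a) \<in> P 0"
      using Nil.prems(6) P M by (intro r_idealD(4)) (auto simp: r_prime_def invs_mconst)
    ultimately show False using P by (simp add: r_prime_def)
  qed
next
  case (Cons y ys)
  note P = Cons.prems(1)
  have P0: "r_prime (P 0)" "r_ideal (P 0)" and P1: "r_prime (P 1)" "r_ideal (P 1)" "P 0 \<subseteq> P 1"
    using P[of 0] P[of 1] Cons.prems(2)[of 0] by (auto simp: r_prime_def)
  have y: "y \<in> P 1" "y \<notin> P 0" "y \<in> invs G"
    using Cons.prems(3)[of 0] r_idealD(1)[OF P1(2)] by auto
  have ysP: "ys ! i \<in> P (Suc (Suc i)) - P (Suc i)" if "i < length ys" for i
    using Cons.prems(3)[of "Suc i"] that by simp
  have ys: "set ys \<subseteq> invs G"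
  proof
    fix x assume "x \<in> set ys"
    then obtain i where "i < length ys" "x = ys ! i" by (auto simp: in_set_conv_nth)
    then show "x \<in> invs G" using ysP[of i] P[of "Suc (Suc i)"] r_idealD(1)[of "P (Suc (Suc i))"] by (auto simp: r_prime_def)
  qed
  show ?case
  proof (rule ccontr)
    assume ca: "c a \<noteq> 0"
    define M' where "M' = {a \<in> M. c a \<noteq> 0}"
    have M': "finite M'" "a \<in> M'" using Cons.prems(4,7) ca by (auto simp: M'_def)
    have len: "length b = Suc (length ys)" if "b \<in> M'" for b using Cons.prems(5)[of b] that by (simp add: M'_def)
    define n0 where "n0 = Min (hd ` M')"
    have n0: "n0 \<in> hd ` M'" "\<And>b. b \<in> M' \<Longrightarrow> n0 \<le> hd b"
      using M' by (auto simp: n0_def intro!: Min_in)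
    let ?t = "\<lambda>b. mconst (c b) * (y ^ (hd b - n0) * mon_eval ys (tl b))"
    have t_inv: "?t b \<in> invs G" for b
      using y ys by (intro invs_mult invs_mconst invs_power mono_invs)
    have "(\<Sum>b\<in>M. mconst (c b) * mon_eval (y # ys) b) = (\<Sum>b\<in>M'. mconst (c b) * mon_eval (y # ys) b)"
      by (rule sum.mono_neutral_right) (use Cons.prems(4) in \<open>auto simp: M'_def mconst_simps\<close>)
    also have "\<dots> = (\<Sum>b\<in>M'. y ^ n0 * ?t b)"
    proof (rule sum.cong[OF refl])
      fix b assume b: "b \<in> M'"
      obtain n ns where bn: "b = n # ns" using len[OF b] by (cases b) auto
      have "y ^ n = y ^ n0 * y ^ (n - n0)" using n0(2)[OF b] bn by (simp flip: power_add)
      then show "mconst (c b) * mon_eval (y # ys) b = y ^ n0 * ?t b" by (simp add: bn ac_simps)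
    qed
    also have "\<dots> = y ^ n0 * (\<Sum>b\<in>M'. ?t b)" by (simp add: sum_distrib_left)
    finally have "y ^ n0 * (\<Sum>b\<in>M'. ?t b) \<in> P 0" using Cons.prems(6) by simp
    then have "(\<Sum>b\<in>M'. ?t b) \<in> P 0"
      by (rule r_prime_power[OF P0(1) y(3) invs_sum[OF t_inv] _ y(2)])
    then have all: "(\<Sum>b\<in>M'. ?t b) \<in> P 1" using P1(3) by blast
    define M0 where "M0 = {b \<in> M'. hd b = n0}"
    have rest: "(\<Sum>b\<in>M' - M0. ?t b) \<in> P 1"
    proof (rule r_ideal_sum[OF P1(2)])
      fix b assume "b \<in> M' - M0"
      then have "n0 < hd b" using n0(2)[of b] by (auto simp: M0_def)
      then obtain k where "hd b - n0 = Suc k" by (metis Suc_diff_Suc)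
      then have "?t b = (mconst (c b) * (y ^ k * mon_eval ys (tl b))) * y" by (simp add: ac_simps)
      also have "\<dots> \<in> P 1"
        using y ys by (intro r_idealD(4)[OF P1(2)] invs_mult invs_mconst invs_power mono_invs)
      finally show "?t b \<in> P 1" .
    qed
    have "(\<Sum>b\<in>M'. ?t b) = (\<Sum>b\<in>M' - M0. ?t b) + (\<Sum>b\<in>M0. ?t b)"
      by (rule sum.subset_diff) (use M' in \<open>auto simp: M0_def\<close>)
    then have eq: "(\<Sum>b\<in>M0. ?t b) = (\<Sum>b\<in>M'. ?t b) + - (\<Sum>b\<in>M' - M0. ?t b)" by simp
    have M0P: "(\<Sum>b\<in>M0. ?t b) \<in> P 1"
      unfolding eq by (rule r_idealD(3)[OF P1(2) all r_idealD(5)[OF P1(2) rest]])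
    have M0_form: "b = n0 # tl b" if "b \<in> M0" for b
      using that len[of b] by (cases b) (auto simp: M0_def)
    have inj: "inj_on tl M0" by (rule inj_onI) (metis M0_form)
    have "(\<Sum>b\<in>M0. ?t b) = (\<Sum>b\<in>M0. mconst (c (n0 # tl b)) * mon_eval ys (tl b))"
      by (rule sum.cong[OF refl]) (use M0_form in \<open>auto simp: M0_def\<close>)
    also have "\<dots> = (\<Sum>b\<in>tl ` M0. mconst (c (n0 # b)) * mon_eval ys b)"
      by (simp add: sum.reindex[OF inj])
    finally have sm: "(\<Sum>b\<in>tl ` M0. mconst (c (n0 # b)) * mon_eval ys b) \<in> P 1" using M0P by simp
    obtain b where b: "b \<in> M0" using n0(1) by (auto simp: M0_def)
    have "c (n0 # tl b) = 0"
    proof (rule Cons.IH[where P = "\<lambda>i. P (Suc i)" and M = "tl ` M0" and c = "\<lambda>b. c (n0 # b)"])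
      show "r_prime (P (Suc i))" if "i \<le> length ys" for i using P[of "Suc i"] that by simp
      show "P (Suc i) \<subseteq> P (Suc (Suc i))" if "i < length ys" for i using Cons.prems(2)[of "Suc i"] that by simp
      show "ys ! i \<in> P (Suc (Suc i)) - P (Suc i)" if "i < length ys" for i by (rule ysP[OF that])
      show "finite (tl ` M0)" using M' by (simp add: M0_def)
      show "length b' = length ys" if "b' \<in> tl ` M0" for b' using that len by (auto simp: M0_def)
      show "(\<Sum>b\<in>tl ` M0. mconst (c (n0 # b)) * mon_eval ys b) \<in> P (Suc 0)" using sm by simp
      show "tl b \<in> tl ` M0" using b by simp
    qed
    then show False using M0_form[OF b] b by (simp add: M0_def M'_def)
  qed
qed

text \<open>The contraction of an ideal of the local ring to the invariants.\<close>

definition contr :: "(('n, 'k) mpoly \<times> ('n, 'k) mpoly) set set \<Rightarrow> ('n, 'k) mpoly set" where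
  "contr I = {r \<in> invs G. lfrac r 1 \<in> I}"

lemma lfrac_split: "r \<in> invs G \<Longrightarrow> s \<in> den \<Longrightarrow> lfrac r s = lfrac 1 s \<otimes>\<^bsub>A\<^esub> lfrac r 1"
  by (simp add: mult_A inv_closed)

lemma lfrac_in_ideal_iff:
  assumes I: "ideal I A" and r: "r \<in> invs G" "s \<in> den"
  shows "lfrac r s \<in> I \<longleftrightarrow> r \<in> contr I"
proof
  assume "lfrac r s \<in> I"
  then have "lfrac s 1 \<otimes>\<^bsub>A\<^esub> lfrac r s \<in> I"
    using ideal.I_l_closed[OF I] r by (simp add: lfrac_in_A inv_closed)
  moreover have "lfrac s 1 \<otimes>\<^bsub>A\<^esub> lfrac r s = lfrac r 1"
    using r by (simp add: mult_A lfrac_eq_iff inv_closed mult.commute)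
  ultimately show "r \<in> contr I" using r by (simp add: contr_def)
next
  assume "r \<in> contr I"
  then have "lfrac 1 s \<otimes>\<^bsub>A\<^esub> lfrac r 1 \<in> I"
    using r by (intro ideal.I_l_closed[OF I]) (auto simp: contr_def intro: lfrac_in_A invs_1)
  then show "lfrac r s \<in> I" by (subst lfrac_split[OF r])
qed

lemma r_ideal_contr: "ideal I A \<Longrightarrow> r_ideal (contr I)"
proof -
  assume I: "ideal I A"
  have aI: "additive_subgroup I A" using I by (simp add: ideal_def)
  show ?thesis
    unfolding r_ideal_def
  proof (intro conjI ballI)
    show "contr I \<subseteq> invs G" by (auto simp: contr_def)
    show "0 \<in> contr I" using additive_subgroup.zero_closed[OF aI] by (simp add: contr_def zero_A inv_closed)
    fix a b assume "a \<in> contr I" "b \<in> contr I"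
    then show "a + b \<in> contr I"
      using additive_subgroup.a_closed[OF aI, of "lfrac a 1" "lfrac b 1"] by (simp add: contr_def add_A inv_closed)
  next
    fix r a assume "r \<in> invs G" "a \<in> contr I"
    then show "r * a \<in> contr I"
      using ideal.I_l_closed[OF I, of "lfrac a 1" "lfrac r 1"] by (simp add: contr_def mult_A inv_closed lfrac_in_A)
  qed
qed

lemma r_prime_contr: "primeideal I A \<Longrightarrow> r_prime (contr I)"
proof -
  assume P: "primeideal I A"
  then have I: "ideal I A" by (simp add: primeideal_def)
  have ne: "carrier A \<noteq> I" using primeideal.I_notcarr[OF P] .
  show ?thesis
    unfolding r_prime_def
  proof (intro conjI ballI impI)
    show "r_ideal (contr I)" by (rule r_ideal_contr[OF I])
    show "1 \<notin> contr I" using ideal.one_imp_carrier[OF I] ne by (auto simp: contr_def one_A)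
    fix a b assume "a \<in> invs G" "b \<in> invs G" "a * b \<in> contr I"
    then show "a \<in> contr I \<or> b \<in> contr I"
      using primeideal.I_prime[OF P, of "lfrac a 1" "lfrac b 1"] by (simp add: contr_def mult_A lfrac_in_A inv_closed)
  qed
qed

lemma contr_strict_mono:
  assumes I: "ideal I A" "ideal J A" "I \<subset> J"
  shows "contr I \<subset> contr J"
proof -
  obtain x where x: "x \<in> J" "x \<notin> I" using I(3) by blast
  have "x \<in> carrier A" using x I(2) additive_subgroup.a_subset ideal.axioms(1) by blast
  then obtain r s where r: "x = lfrac r s" "r \<in> invs G" "s \<in> den" by (rule A_cases)
  then have "r \<in> contr J" "r \<notin> contr I" using x lfrac_in_ideal_iff I by auto
  moreover have "contr I \<subseteq> contr J" using I(3) by (auto simp: contr_def)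
  ultimately show ?thesis by blast
qed

lemma prime_chain_length:
  assumes P: "\<forall>i\<le>n. primeideal (P i) A" "\<forall>i<n. P i \<subset> P (Suc i)"
  shows "n \<le> CARD('n)"
proof (rule ccontr)
  assume n: "\<not> n \<le> CARD('n)"
  let ?d = "CARD('n)"
  define Q where "Q i = contr (P i)" for i
  have Q: "r_prime (Q i)" if "i \<le> ?d + 1" for i using P(1) n that by (simp add: Q_def r_prime_contr)
  have "Q i \<subset> Q (Suc i)" if "i < ?d + 1" for i
    using P n that by (simp add: Q_def contr_strict_mono primeideal.axioms(1))
  then have strict: "Q i \<subseteq> Q (Suc i)" "\<exists>y. y \<in> Q (Suc i) - Q i" if "i < ?d + 1" for i
    using that by blast+
  then obtain y where y: "\<And>i. i < ?d + 1 \<Longrightarrow> y i \<in> Q (Suc i) - Q i" by metis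
  define ys where "ys = map y [0..<?d + 1]"
  have len: "length ys = ?d + 1" by (simp add: ys_def)
  have nth: "ys ! i = y i" if "i < ?d + 1" for i using that by (simp add: ys_def nth_map_upt del: upt_Suc)
  obtain M c where M: "finite M" "\<And>a. a \<in> M \<Longrightarrow> length a = length ys"
    "(\<Sum>a\<in>M. mconst (c a) * mon_eval ys a) = 0" "\<exists>a\<in>M. c a \<noteq> 0"
    by (rule algebraic_dependence[OF len]) blast
  have "c a = 0" if "a \<in> M" for a
  proof (rule prime_chain_independent[where P = Q, OF _ _ _ M(1,2) _ that])
    show "(\<Sum>a\<in>M. mconst (c a) * mon_eval ys a) \<in> Q 0"
      using Q[of 0] M(3) by (simp add: r_prime_def r_idealD)
  qed (use Q strict(1) y len nth in auto)
  then show False using M(4) by blast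
qed

text \<open>Primes of the polynomial ring, given as kernels of \<open>\<phi>\<close> and \<open>\<psi>\<close>, cannot be strictly nested and have the same contraction to the invariants, if \<open>f\<close> separates them and is a root of a monic polynomial over the invariants. The constant coefficient lies in the larger prime, hence in the smaller one, and \<open>f\<close> can be cancelled from the rest.\<close>

lemma incomparability:
  fixes U :: "('n, 'k) mpoly poly" and \<phi> \<psi> :: "('n, 'k) mpoly \<Rightarrow> ('n, 'k) mpoly"
  assumes \<phi>: "ring_map \<phi>" and \<psi>: "ring_map \<psi>" and ker: "\<And>x. \<phi> x = 0 \<Longrightarrow> \<psi> x = 0"
    and inv: "\<And>r. r \<in> invs G \<Longrightarrow> \<psi> r = 0 \<Longrightarrow> \<phi> r = 0" and f: "\<phi> f \<noteq> 0" "\<psi> f = 0"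
  shows "\<lbrakk>Polynomial.lead_coeff U = 1; \<And>i. Polynomial.coeff U i \<in> invs G\<rbrakk> \<Longrightarrow> \<phi> (poly U f) \<noteq> 0"
proof (induction U)
  case 0
  then show ?case by simp
next
  case (pCons c U)
  show ?case
  proof
    assume 0: "\<phi> (poly (pCons c U) f) = 0"
    have "\<psi> (c + f * poly U f) = 0" using ker[OF 0] by simp
    then have "\<psi> c = 0" by (simp add: ring_map_add[OF \<psi>] ring_map_mult[OF \<psi>] f)
    moreover have "c \<in> invs G" using pCons.prems(2)[of 0] by simp
    ultimately have c: "\<phi> c = 0" using inv by blast
    show False
    proof (cases "U = 0")
      case True
      then have "c = 1" using pCons.prems(1) by simp
      then show False using c ring_map_1[OF \<phi>] by simp
    next
      case False
      have "\<phi> f * \<phi> (poly U f) = 0" using 0 c by (simp add: ring_map_add[OF \<phi>] ring_map_mult[OF \<phi>])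
      then have "\<phi> (poly U f) = 0" using f by (simp add: mpoly_mult_eq_0)
      moreover have "\<phi> (poly U f) \<noteq> 0"
      proof (rule pCons.IH)
        show "Polynomial.lead_coeff U = 1" using pCons.prems(1) False by simp
        show "Polynomial.coeff U i \<in> invs G" for i using pCons.prems(2)[of "Suc i"] by simp
      qed
      ultimately show False by simp
    qed
  qed
qed

text \<open>Every polynomial is integral over the invariants, being a root of this one.\<close>

definition char_poly :: "('n, 'k) mpoly \<Rightarrow> ('n, 'k) mpoly poly" where
  "char_poly f = (\<Prod>g\<in>G. [:- act g f, 1:])"

lemma lead_coeff_prod_monic:
  fixes a :: "'i \<Rightarrow> 'a::comm_ring_1"
  shows "finite B \<Longrightarrow> Polynomial.lead_coeff (\<Prod>b\<in>B. [:a b, 1:]) = 1"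
proof (induction B rule: finite_induct)
  case (insert b B)
  let ?Q = "\<Prod>b\<in>B. [:a b, 1:]"
  have "?Q \<noteq> 0" using insert.IH by auto
  have "[:a b, 1:] * ?Q = Polynomial.smult (a b) ?Q + pCons 0 ?Q" by simp
  moreover have "Polynomial.degree (Polynomial.smult (a b) ?Q) < Polynomial.degree (pCons 0 ?Q)"
    using \<open>?Q \<noteq> 0\<close> by (auto intro: le_less_trans[OF degree_smult_le])
  ultimately have "Polynomial.lead_coeff ([:a b, 1:] * ?Q) = Polynomial.lead_coeff (pCons 0 ?Q)"
    by (simp only: lead_coeff_add_le)
  then show ?case using insert \<open>?Q \<noteq> 0\<close> by simp
qed simp

lemma char_poly_props:
  "Polynomial.lead_coeff (char_poly f) = 1" "Polynomial.coeff (char_poly f) i \<in> invs G" "poly (char_poly f) f = 0"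
proof -
  show "Polynomial.lead_coeff (char_poly f) = 1"
    unfolding char_poly_def by (rule lead_coeff_prod_monic[OF finG])
  show "poly (char_poly f) f = 0"
    using mat_1_in finG by (auto simp: char_poly_def poly_prod mpoly_prod_eq_0 act_mat_1 intro!: bexI[of _ "mat 1"])
  have "act h (Polynomial.coeff (char_poly f) i) = Polynomial.coeff (char_poly f) i" if h: "h \<in> G" for h
  proof -
    have "map_poly (act h) (char_poly f) = (\<Prod>g\<in>G. [:- act (h ** g) f, 1:])"
      by (simp add: char_poly_def map_poly_prod_ring_map[OF ring_map_act] map_poly_pCons act_0 act_1 act_minus act_act)
    also have "\<dots> = char_poly f"
      unfolding char_poly_def by (rule prod.reindex_bij_betw[OF bij_left_mult[OF h]])
    finally show ?thesis by (metis coeff_map_poly[of "act h", OF act_0])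
  qed
  then show "Polynomial.coeff (char_poly f) i \<in> invs G" by (simp add: invs_def)
qed

lemma primeideal_loc:
  assumes P: "r_prime P" "P \<subseteq> inv_max"
  shows "primeideal (loc P) A" "r \<in> invs G \<Longrightarrow> s \<in> den \<Longrightarrow> lfrac r s \<in> loc P \<longleftrightarrow> r \<in> P"
proof -
  have rP: "r_ideal P" using P by (simp add: r_prime_def)
  have I: "ideal (loc P) A" by (rule ideal_loc[OF rP])
  show iff: "lfrac r s \<in> loc P \<longleftrightarrow> r \<in> P" if "r \<in> invs G" "s \<in> den" for r s
  proof
    assume "lfrac r s \<in> loc P"
    then obtain r' s' where r': "lfrac r s = lfrac r' s'" "r' \<in> P" "s' \<in> den" by (auto simp: loc_def)
    then have "r * s' = r' * s" using that r_idealD(1)[OF rP] by (simp add: lfrac_eq_iff)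
    then have "r * s' \<in> P" using r_idealD(4)[OF rP, of s r'] r' that by (simp add: mult.commute den_invs)
    moreover have "s' \<notin> P" using r' P(2) by (auto simp: inv_max_def den_def)
    ultimately show "r \<in> P" using P(1) that r' den_invs by (auto simp: r_prime_def)
  qed (use that in \<open>auto simp: loc_def\<close>)
  show "primeideal (loc P) A"
  proof (rule primeidealI[OF I cring_A])
    show "carrier A \<noteq> loc P"
    proof
      assume "carrier A = loc P"
      then have "lfrac 1 1 \<in> loc P" using lfrac_in_A[OF invs_1 den_1] by simp
      then show False using iff[OF invs_1 den_1] P(1) by (simp add: r_prime_def)
    qed
    fix a b assume a: "a \<in> carrier A" and b: "b \<in> carrier A" and ab: "a \<otimes>\<^bsub>A\<^esub> b \<in> loc P"
    obtain r s where a: "a = lfrac r s" "r \<in> invs G" "s \<in> den" using a by (rule A_cases)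
    obtain r' s' where b: "b = lfrac r' s'" "r' \<in> invs G" "s' \<in> den" using b by (rule A_cases)
    have "r * r' \<in> P" using ab a b by (simp add: mult_A iff inv_closed)
    then show "a \<in> loc P \<or> b \<in> loc P" using P(1) a b by (auto simp: iff r_prime_def)
  qed
qed

text \<open>The primes generated by the first \<open>i\<close> variables have different contractions to the invariants by incomparability, and all of them lie below the maximal ideal.\<close>

lemma prime_chain_exists:
  "\<exists>P. (\<forall>i\<le>CARD('n). primeideal (P i) A) \<and> (\<forall>i<CARD('n). P i \<subset> P (Suc i))"
proof -
  let ?d = "CARD('n)"
  obtain b :: "'n \<Rightarrow> nat" where b: "bij_betw b UNIV {0..<?d}"
    using ex_bij_betw_finite_nat[of "UNIV :: 'n set"] by auto
  define \<phi> :: "nat \<Rightarrow> ('n, 'k) mpoly \<Rightarrow> ('n, 'k) mpoly"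
    where "\<phi> i = poly_ev mconst (\<lambda>j. if b j < i then 0 else mvar j)" for i
  define Q where "Q i = {f \<in> invs G. \<phi> i f = 0}" for i
  have h: "ring_map (\<phi> i)" for i unfolding \<phi>_def by (rule ring_map_poly_ev[OF ring_map_mconst])
  have \<phi>_mvar: "\<phi> i (mvar j) = (if b j < i then 0 else mvar j)" for i j
    by (simp add: \<phi>_def poly_ev_mvar ring_map_mconst)
  have \<phi>_mconst: "\<phi> i (mconst c) = mconst c" for i c
    by (simp add: \<phi>_def poly_ev_mconst ring_map_mconst)
  have comp: "\<phi> (Suc i) (\<phi> i f) = \<phi> (Suc i) f" for i f
    by (rule ring_map_eqI[OF ring_map_compose[OF h h] h])
      (auto simp: \<phi>_mconst \<phi>_mvar ring_map_0[OF h])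
  have ker: "\<phi> (Suc i) f = 0" if "\<phi> i f = 0" for i f
    using comp[of i f] that by (simp add: ring_map_0[OF h])
  have ct: "cterm (\<phi> i f) = cterm f" for i f
    by (rule ring_map_eqI[OF ring_map_compose[OF ring_map_cterm h] ring_map_cterm])
      (auto simp: \<phi>_mconst \<phi>_mvar)
  have Qp: "r_prime (Q i)" for i
    unfolding r_prime_def r_ideal_def Q_def
    by (auto simp: inv_closed ring_map_0[OF h] ring_map_add[OF h] ring_map_mult[OF h] ring_map_1[OF h] mpoly_mult_eq_0)
  have Qm: "Q i \<subseteq> inv_max" for i
  proof
    fix f assume "f \<in> Q i"
    then show "f \<in> inv_max" using ct[of i f] by (simp add: Q_def inv_max_def)
  qed
  have strict: "loc (Q i) \<subset> loc (Q (Suc i))" if i: "i < ?d" for i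
  proof -
    obtain j where j: "b j = i" using b i by (metis atLeast0LessThan bij_betw_iff_bijections lessThan_iff)
    have mv: "mvar j \<noteq> (0 :: ('n, 'k) mpoly)" by (simp add: mvar_def) (metis lookup_single_eq lookup_zero zero_neq_one)
    have f: "\<phi> i (mvar j) \<noteq> 0" "\<phi> (Suc i) (mvar j) = 0" using j mv by (auto simp: \<phi>_mvar)
    have "\<exists>r. r \<in> invs G \<and> \<phi> (Suc i) r = 0 \<and> \<phi> i r \<noteq> 0"
    proof (rule ccontr)
      assume "\<not> ?thesis"
      then have inv: "\<phi> i r = 0" if "r \<in> invs G" "\<phi> (Suc i) r = 0" for r using that by blast
      have "\<phi> i (poly (char_poly (mvar j)) (mvar j)) \<noteq> 0"
        by (rule incomparability[OF h h ker inv f char_poly_props(1,2)])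
      then show False by (simp add: char_poly_props(3) ring_map_0[OF h])
    qed
    then obtain r where r: "r \<in> invs G" "r \<in> Q (Suc i)" "r \<notin> Q i" by (auto simp: Q_def)
    have "lfrac r 1 \<in> loc (Q (Suc i))" "lfrac r 1 \<notin> loc (Q i)"
      using r primeideal_loc(2)[OF Qp Qm, of r 1] by (auto simp: inv_closed)
    moreover have "loc (Q i) \<subseteq> loc (Q (Suc i))" using ker by (auto simp: loc_def Q_def)
    ultimately show ?thesis by blast
  qed
  show ?thesis
    by (rule exI[of _ "\<lambda>i. loc (Q i)"]) (use primeideal_loc(1)[OF Qp Qm] strict in auto)
qed

theorem krull_dim_A: "krull_dim A = enat CARD('n)"
  unfolding krull_dim_def
proof (rule antisym)
  show "Sup {enat n | n. \<exists>P. (\<forall>i\<le>n. primeideal (P i) A) \<and> (\<forall>i<n. P i \<subset> P (Suc i))} \<le> enat CARD('n)"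
    by (rule Sup_least) (use prime_chain_length in auto)
  show "enat CARD('n) \<le> Sup {enat n | n. \<exists>P. (\<forall>i\<le>n. primeideal (P i) A) \<and> (\<forall>i<n. P i \<subset> P (Suc i))}"
    by (rule Sup_upper) (use prime_chain_exists in blast)
qed

end

section \<open>Extending linear maps over the polynomial ring\<close>

context lin_group
begin

text \<open>The polynomial ring, localized at the denominators of the local ring, is a module over the local ring. Its elements are tagged with \<open>Inl\<close> so that they live in the type over which injectivity is tested.\<close>

definition S_frac :: "('n, 'k) mpoly \<Rightarrow> ('n, 'k) mpoly \<Rightarrow> ((('n, 'k) mpoly \<times> ('n, 'k) mpoly) set + 'e) set" where
  "S_frac f s = {Inl {(f', s'). s' \<in> den \<and> f * s' = f' * s}}"

lemma S_frac_eq_iff: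
  assumes "s \<in> den" "s' \<in> den"
  shows "(S_frac f s :: ((('n, 'k) mpoly \<times> ('n, 'k) mpoly) set + 'e) set) = S_frac f' s' \<longleftrightarrow> f * s' = f' * s"
proof
  assume "(S_frac f s :: ((('n, 'k) mpoly \<times> ('n, 'k) mpoly) set + 'e) set) = S_frac f' s'"
  then have "{(f', s'). s' \<in> den \<and> f * s' = f' * s} = {(u, t). t \<in> den \<and> f' * t = u * s'}"
    by (simp add: S_frac_def)
  moreover have "(f', s') \<in> {(u, t). t \<in> den \<and> f' * t = u * s'}" using assms by simp
  ultimately show "f * s' = f' * s" by blast
next
  assume eq: "f * s' = f' * s"
  have "f * t = u * s \<longleftrightarrow> f' * t = u * s'" for u t
  proof -
    have "f * t = u * s \<longleftrightarrow> s' * (f * t) = s' * (u * s)"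
      using den_nonzero[OF assms(2)] by (simp add: mpoly_mult_left_cancel)
    also have "\<dots> \<longleftrightarrow> s * (f' * t) = s * (u * s')"
    proof -
      have "s' * (f * t) = (f * s') * t" by (simp add: ac_simps)
      also have "\<dots> = s * (f' * t)" unfolding eq by (simp add: ac_simps)
      finally have 1: "s' * (f * t) = s * (f' * t)" .
      have 2: "s' * (u * s) = s * (u * s')" by (simp add: ac_simps)
      show ?thesis by (simp only: 1 2)
    qed
    also have "\<dots> \<longleftrightarrow> f' * t = u * s'"
      using den_nonzero[OF assms(1)] by (simp add: mpoly_mult_left_cancel)
    finally show ?thesis .
  qed
  then show "(S_frac f s :: ((('n, 'k) mpoly \<times> ('n, 'k) mpoly) set + 'e) set) = S_frac f' s'" by (simp add: S_frac_def)
qed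

definition nrep :: "((('n, 'k) mpoly \<times> ('n, 'k) mpoly) set + 'e) set \<Rightarrow> ('n, 'k) mpoly \<times> ('n, 'k) mpoly" where
  "nrep x = (SOME fs. snd fs \<in> den \<and> x = S_frac (fst fs) (snd fs))"

lemma nrep_S_frac:
  assumes "s \<in> den"
  obtains f' s' where "nrep (S_frac f s :: ((('n, 'k) mpoly \<times> ('n, 'k) mpoly) set + 'e) set) = (f', s')" "s' \<in> den" "f * s' = f' * s"
proof -
  let ?x = "S_frac f s :: ((('n, 'k) mpoly \<times> ('n, 'k) mpoly) set + 'e) set"
  have "snd (nrep ?x) \<in> den \<and> ?x = S_frac (fst (nrep ?x)) (snd (nrep ?x))"
    unfolding nrep_def by (rule someI[of _ "(f, s)"]) (simp add: assms)
  then have 1: "snd (nrep ?x) \<in> den" and 2: "?x = S_frac (fst (nrep ?x)) (snd (nrep ?x))" by blast+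
  have "f * snd (nrep ?x) = fst (nrep ?x) * s" using 2 S_frac_eq_iff[OF assms 1] by blast
  then show ?thesis by (intro that[of "fst (nrep ?x)" "snd (nrep ?x)"] 1) simp_all
qed

definition arep :: "(('n, 'k) mpoly \<times> ('n, 'k) mpoly) set \<Rightarrow> ('n, 'k) mpoly \<times> ('n, 'k) mpoly" where
  "arep a = (SOME rt. fst rt \<in> invs G \<and> snd rt \<in> den \<and> a = lfrac (fst rt) (snd rt))"

lemma arep_lfrac:
  assumes "r \<in> invs G" "t \<in> den"
  obtains r' t' where "arep (lfrac r t) = (r', t')" "r' \<in> invs G" "t' \<in> den" "r * t' = r' * t"
proof -
  let ?x = "lfrac r t"
  have "fst (arep ?x) \<in> invs G \<and> snd (arep ?x) \<in> den \<and> ?x = lfrac (fst (arep ?x)) (snd (arep ?x))"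
    unfolding arep_def by (rule someI[of _ "(r, t)"]) (simp add: assms)
  then have 1: "fst (arep ?x) \<in> invs G" "snd (arep ?x) \<in> den"
    and 2: "?x = lfrac (fst (arep ?x)) (snd (arep ?x))" by blast+
  have "r * snd (arep ?x) = fst (arep ?x) * t" using 2 lfrac_eq_iff[OF assms 1] by blast
  then show ?thesis by (intro that[of "fst (arep ?x)" "snd (arep ?x)"] 1) simp_all
qed

text \<open>The operations are defined on chosen representatives; \<open>S_loc_add\<close> and \<open>S_loc_smult\<close> show that any representatives may be used.\<close>

definition S_loc :: "((('n, 'k) mpoly \<times> ('n, 'k) mpoly) set, ((('n, 'k) mpoly \<times> ('n, 'k) mpoly) set + 'e) set) module" where
  "S_loc = \<lparr>carrier = {S_frac f s | f s. s \<in> den}, monoid.mult = undefined, one = undefined,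
     ring.zero = S_frac 0 1,
     add = (\<lambda>x y. S_frac (fst (nrep x) * snd (nrep y) + fst (nrep y) * snd (nrep x)) (snd (nrep x) * snd (nrep y))),
     module.smult = (\<lambda>a x. S_frac (fst (arep a) * fst (nrep x)) (snd (arep a) * snd (nrep x)))\<rparr>"

lemma S_loc_carrier: "carrier S_loc = {S_frac f s | f s. s \<in> den}" and S_loc_zero: "\<zero>\<^bsub>S_loc\<^esub> = S_frac 0 1"
  by (simp_all add: S_loc_def)

lemma S_loc_in: "s \<in> den \<Longrightarrow> S_frac f s \<in> carrier S_loc"
  by (auto simp: S_loc_carrier)

lemma S_loc_cases: "x \<in> carrier S_loc \<Longrightarrow> (\<And>f s. x = S_frac f s \<Longrightarrow> s \<in> den \<Longrightarrow> thesis) \<Longrightarrow> thesis"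
  by (auto simp: S_loc_carrier)

lemma S_loc_add:
  assumes "s \<in> den" "s' \<in> den"
  shows "(S_frac f s :: ((('n, 'k) mpoly \<times> ('n, 'k) mpoly) set + 'e) set) \<oplus>\<^bsub>S_loc\<^esub> S_frac f' s' = S_frac (f * s' + f' * s) (s * s')"
proof -
  obtain u t where u: "nrep (S_frac f s :: ((('n, 'k) mpoly \<times> ('n, 'k) mpoly) set + 'e) set) = (u, t)" "t \<in> den" "f * t = u * s"
    using nrep_S_frac[OF assms(1)] .
  obtain u' t' where u': "nrep (S_frac f' s' :: ((('n, 'k) mpoly \<times> ('n, 'k) mpoly) set + 'e) set) = (u', t')" "t' \<in> den" "f' * t' = u' * s'"
    using nrep_S_frac[OF assms(2)] .
  have "(u * t' + u' * t) * (s * s') = (u * s) * (t' * s') + (u' * s') * (t * s)" by (simp add: algebra_simps)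
  also have "\<dots> = (f * t) * (t' * s') + (f' * t') * (t * s)" by (simp only: u(3) u'(3))
  also have "\<dots> = (f * s' + f' * s) * (t * t')" by (simp add: algebra_simps)
  finally show ?thesis
    using u u' assms by (simp add: S_loc_def S_frac_eq_iff den_mult)
qed

lemma S_loc_smult:
  assumes "r \<in> invs G" "t \<in> den" "s \<in> den"
  shows "lfrac r t \<odot>\<^bsub>S_loc\<^esub> (S_frac f s :: ((('n, 'k) mpoly \<times> ('n, 'k) mpoly) set + 'e) set) = S_frac (r * f) (t * s)"
proof -
  obtain u v where u: "nrep (S_frac f s :: ((('n, 'k) mpoly \<times> ('n, 'k) mpoly) set + 'e) set) = (u, v)" "v \<in> den" "f * v = u * s"
    using nrep_S_frac[OF assms(3)] .
  obtain r' t' where r': "arep (lfrac r t) = (r', t')" "t' \<in> den" "r * t' = r' * t"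
    using arep_lfrac[OF assms(1,2)] by metis
  have "(r' * u) * (t * s) = (r' * t) * (u * s)" by (simp add: ac_simps)
  also have "\<dots> = (r * t') * (f * v)" by (simp only: u(3) r'(3))
  also have "\<dots> = (r * f) * (t' * v)" by (simp add: ac_simps)
  finally show ?thesis
    using u r' assms by (simp add: S_loc_def S_frac_eq_iff den_mult)
qed

lemma module_S_loc: "Module.module A (S_loc :: (_, ((('n, 'k) mpoly \<times> ('n, 'k) mpoly) set + 'e) set) module)"
proof (rule moduleI[OF cring_A])
  let ?N = "S_loc :: (_, ((('n, 'k) mpoly \<times> ('n, 'k) mpoly) set + 'e) set) module"
  show "abelian_group ?N"
  proof (rule abelian_groupI)
    fix x y w assume "x \<in> carrier ?N" "y \<in> carrier ?N" "w \<in> carrier ?N"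
    then show "x \<oplus>\<^bsub>?N\<^esub> y \<oplus>\<^bsub>?N\<^esub> w = x \<oplus>\<^bsub>?N\<^esub> (y \<oplus>\<^bsub>?N\<^esub> w)"
      by (auto elim!: S_loc_cases simp: S_loc_add S_frac_eq_iff den_mult algebra_simps)
  next
    fix x assume "x \<in> carrier ?N"
    then obtain f s where x: "x = S_frac f s" "s \<in> den" by (rule S_loc_cases)
    show "\<exists>y\<in>carrier ?N. y \<oplus>\<^bsub>?N\<^esub> x = \<zero>\<^bsub>?N\<^esub>"
      by (rule bexI[of _ "S_frac (- f) s"]) (simp_all add: x S_loc_add S_loc_zero S_frac_eq_iff den_mult den_1 S_loc_in)
  qed (auto elim!: S_loc_cases simp: S_loc_add S_loc_zero S_frac_eq_iff den_mult den_1 S_loc_in algebra_simps)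
next
  let ?N = "S_loc :: (_, ((('n, 'k) mpoly \<times> ('n, 'k) mpoly) set + 'e) set) module"
  fix a b x assume "a \<in> carrier A" "b \<in> carrier A" "x \<in> carrier ?N"
  then obtain r t r' t' f s where v: "a = lfrac r t" "r \<in> invs G" "t \<in> den" "b = lfrac r' t'" "r' \<in> invs G" "t' \<in> den"
    "x = S_frac f s" "s \<in> den" by (elim A_cases S_loc_cases)
  have "(r * t' + r' * t) \<in> invs G" "r * r' \<in> invs G" using v by (auto intro: invs_mult invs_add den_invs)
  then show "(a \<oplus>\<^bsub>A\<^esub> b) \<odot>\<^bsub>?N\<^esub> x = a \<odot>\<^bsub>?N\<^esub> x \<oplus>\<^bsub>?N\<^esub> b \<odot>\<^bsub>?N\<^esub> x"
    "(a \<otimes>\<^bsub>A\<^esub> b) \<odot>\<^bsub>?N\<^esub> x = a \<odot>\<^bsub>?N\<^esub> (b \<odot>\<^bsub>?N\<^esub> x)"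
    using v by (auto simp: add_A mult_A S_loc_add S_loc_smult S_frac_eq_iff den_mult algebra_simps)
next
  let ?N = "S_loc :: (_, ((('n, 'k) mpoly \<times> ('n, 'k) mpoly) set + 'e) set) module"
  fix a x y assume "a \<in> carrier A" "x \<in> carrier ?N" "y \<in> carrier ?N"
  then obtain r t f s f' s' where v: "a = lfrac r t" "r \<in> invs G" "t \<in> den" "x = S_frac f s" "s \<in> den"
    "y = S_frac f' s'" "s' \<in> den" by (elim A_cases S_loc_cases)
  have eq: "(S_frac (r * (f * s' + f' * s)) (t * (s * s')) :: ((('n, 'k) mpoly \<times> ('n, 'k) mpoly) set + 'e) set) =
      S_frac ((r * f) * (t * s') + (r * f') * (t * s)) ((t * s) * (t * s'))"
    using v by (subst S_frac_eq_iff) (auto intro: den_mult simp: algebra_simps)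
  show "a \<odot>\<^bsub>?N\<^esub> (x \<oplus>\<^bsub>?N\<^esub> y) = a \<odot>\<^bsub>?N\<^esub> x \<oplus>\<^bsub>?N\<^esub> a \<odot>\<^bsub>?N\<^esub> y"
    using v eq by (simp add: S_loc_add S_loc_smult den_mult)
qed (auto elim!: A_cases S_loc_cases simp: one_A S_loc_add S_loc_smult S_frac_eq_iff den_mult den_1 invs_1 S_loc_in algebra_simps)

lemma submodule_S_loc:
  assumes H: "0 \<in> H" "\<And>a b. a \<in> H \<Longrightarrow> b \<in> H \<Longrightarrow> a + b \<in> H" "\<And>r a. r \<in> invs G \<Longrightarrow> a \<in> H \<Longrightarrow> r * a \<in> H"
  shows "submodule {S_frac h s | h s. h \<in> H \<and> s \<in> den} A (S_loc :: (_, ((('n, 'k) mpoly \<times> ('n, 'k) mpoly) set + 'e) set) module)"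
    (is "submodule ?H A ?N")
proof -
  interpret N: Module.module A ?N by (rule module_S_loc)
  have sm: "a \<odot>\<^bsub>?N\<^esub> x \<in> ?H" if a: "a \<in> carrier A" and x: "x \<in> ?H" for a x
  proof -
    obtain r t where a: "a = lfrac r t" "r \<in> invs G" "t \<in> den" using a by (rule A_cases)
    obtain h s where x: "x = S_frac h s" "h \<in> H" "s \<in> den" using x by auto
    show ?thesis using H(3)[OF a(2) x(2)] den_mult[OF a(3) x(3)] a x by (auto simp: S_loc_smult)
  qed
  show ?thesis
  proof (rule N.submoduleI)
    show sub: "?H \<subseteq> carrier ?N" by (auto simp: S_loc_carrier)
    show "\<zero>\<^bsub>?N\<^esub> \<in> ?H" using H(1) den_1 by (auto simp: S_loc_zero)
    fix a assume a: "a \<in> ?H"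
    have "(\<ominus>\<^bsub>A\<^esub> \<one>\<^bsub>A\<^esub>) \<odot>\<^bsub>?N\<^esub> a \<in> ?H" by (rule sm[OF _ a]) simp
    moreover have aN: "a \<in> carrier ?N" using a sub by blast
    ultimately show "\<ominus>\<^bsub>?N\<^esub> a \<in> ?H"
      by (simp only: N.smult_l_minus[OF N.R.one_closed aN] N.smult_one[OF aN])
    fix b assume b: "b \<in> ?H"
    obtain h s where x: "a = S_frac h s" "h \<in> H" "s \<in> den" using a by auto
    obtain h' s' where y: "b = S_frac h' s'" "h' \<in> H" "s' \<in> den" using b by auto
    have "h * s' + h' * s \<in> H"
      using H(2)[OF H(3)[OF den_invs[OF y(3)] x(2)] H(3)[OF den_invs[OF x(3)] y(2)]] by (simp add: mult.commute)
    then show "a \<oplus>\<^bsub>?N\<^esub> b \<in> ?H" using x y den_mult[OF x(3) y(3)] by (auto simp: S_loc_add)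
  qed (rule sm)
qed

lemma inv_moduleI:
  fixes E :: "((('n, 'k) mpoly \<times> ('n, 'k) mpoly) set, 'e) module"
  assumes "Module.module A E"
  shows "inv_module G p E (\<lambda>r x. lfrac r 1 \<odot>\<^bsub>E\<^esub> x)"
proof -
  interpret E: Module.module A E by (rule assms)
  have l: "lfrac r 1 \<in> carrier A" if "r \<in> invs G" for r using that by (simp add: lfrac_in_A den_1)
  show ?thesis
  proof (unfold_locales, goal_cases)
    case (1 r x)
    then show ?case by (simp add: l)
  next
    case (2 r s x)
    then have "lfrac (r + s) 1 = lfrac r 1 \<oplus>\<^bsub>A\<^esub> lfrac s 1" by (simp add: add_A den_1)
    then show ?case using 2 by (simp add: E.smult_l_distr l)
  next
    case (3 r x y)
    then show ?case by (simp add: E.smult_r_distr l)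
  next
    case (4 r s x)
    then have "lfrac (r * s) 1 = lfrac r 1 \<otimes>\<^bsub>A\<^esub> lfrac s 1" by (simp add: mult_A den_1)
    then show ?case using 4 by (simp add: E.smult_assoc1 l)
  next
    case (5 x)
    then show ?case using E.smult_one[of x] by (simp add: one_A)
  qed
qed

text \<open>A linear map defined on a submodule \<open>H\<close> of the polynomial ring extends to the fractions with numerators in \<open>H\<close>, since denominators act invertibly on a module over the local ring. Injectivity over the local ring extends it further to all fractions.\<close>

lemma inv_injectiveI:
  fixes E :: "((('n, 'k) mpoly \<times> ('n, 'k) mpoly) set, 'e) module"
  assumes inj: "injective_module A E"
  shows "inv_injective_module G p E (\<lambda>r x. lfrac r 1 \<odot>\<^bsub>E\<^esub> x)"
proof -
  let ?N = "S_loc :: (_, ((('n, 'k) mpoly \<times> ('n, 'k) mpoly) set + 'e) set) module"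
  have mE: "Module.module A E" using inj by (simp add: injective_module_def)
  interpret E: Module.module A E by (rule mE)
  interpret I: inv_module G p E "\<lambda>r x. lfrac r 1 \<odot>\<^bsub>E\<^esub> x" by (rule inv_moduleI[OF mE])
  note lA = lfrac_in_A
  show ?thesis
  proof (unfold_locales, goal_cases)
    case (1 H f)
    have H: "0 \<in> H" "\<And>a b. a \<in> H \<Longrightarrow> b \<in> H \<Longrightarrow> a + b \<in> H" "\<And>r a. r \<in> invs G \<Longrightarrow> a \<in> H \<Longrightarrow> r * a \<in> H"
      using 1(1) by (auto simp: I.submod_def)
    have f: "\<And>a. a \<in> H \<Longrightarrow> f a \<in> carrier E" "\<And>a b. a \<in> H \<Longrightarrow> b \<in> H \<Longrightarrow> f (a + b) = f a \<oplus>\<^bsub>E\<^esub> f b"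
      "\<And>r a. r \<in> invs G \<Longrightarrow> a \<in> H \<Longrightarrow> f (r * a) = lfrac r 1 \<odot>\<^bsub>E\<^esub> f a"
      using 1(2) by (auto simp: I.lin_map_def)
    let ?H = "{S_frac h s | h s. h \<in> H \<and> s \<in> den} :: ((('n, 'k) mpoly \<times> ('n, 'k) mpoly) set + 'e) set set"
    define f' where "f' x = (THE w. \<exists>h s. h \<in> H \<and> s \<in> den \<and> x = S_frac h s \<and> w = lfrac 1 s \<odot>\<^bsub>E\<^esub> f h)"
      for x :: "((('n, 'k) mpoly \<times> ('n, 'k) mpoly) set + 'e) set"
    have mv: "lfrac r s \<odot>\<^bsub>E\<^esub> f h = lfrac 1 s \<odot>\<^bsub>E\<^esub> f (r * h)" if "r \<in> invs G" "s \<in> den" "h \<in> H" for r s h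
    proof -
      have "lfrac r s = lfrac 1 s \<otimes>\<^bsub>A\<^esub> lfrac r 1" using that by (simp add: mult_A invs_1 den_1)
      then show ?thesis using that f by (simp add: E.smult_assoc1 lA invs_1 den_1)
    qed
    have ext: "lfrac 1 s \<odot>\<^bsub>E\<^esub> f h = lfrac 1 (s * t) \<odot>\<^bsub>E\<^esub> f (t * h)" if "s \<in> den" "t \<in> den" "h \<in> H" for s t h
    proof -
      have "lfrac 1 s = lfrac t (s * t)" using that by (simp add: lfrac_eq_iff invs_1 den_mult den_invs mult.commute)
      then show ?thesis using mv[of t "s * t" h] that by (simp add: den_invs den_mult)
    qed
    have f': "f' (S_frac h s) = lfrac 1 s \<odot>\<^bsub>E\<^esub> f h" if hs: "h \<in> H" "s \<in> den" for h s
      unfolding f'_def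
    proof (rule the_equality)
      show "\<exists>h' s'. h' \<in> H \<and> s' \<in> den \<and> (S_frac h s :: ((('n, 'k) mpoly \<times> ('n, 'k) mpoly) set + 'e) set) = S_frac h' s' \<and>
          lfrac 1 s \<odot>\<^bsub>E\<^esub> f h = lfrac 1 s' \<odot>\<^bsub>E\<^esub> f h'" using hs by blast
      fix w assume "\<exists>h' s'. h' \<in> H \<and> s' \<in> den \<and> (S_frac h s :: ((('n, 'k) mpoly \<times> ('n, 'k) mpoly) set + 'e) set) = S_frac h' s' \<and>
          w = lfrac 1 s' \<odot>\<^bsub>E\<^esub> f h'"
      then obtain h' s' where w: "h' \<in> H" "s' \<in> den" "h * s' = h' * s" "w = lfrac 1 s' \<odot>\<^bsub>E\<^esub> f h'"
        using hs by (auto simp: S_frac_eq_iff)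
      have "w = lfrac 1 (s' * s) \<odot>\<^bsub>E\<^esub> f (s * h')" 
        unfolding w(4) by (rule ext[OF w(2) hs(2) w(1)])
      also have "\<dots> = lfrac 1 (s * s') \<odot>\<^bsub>E\<^esub> f (s' * h)" using w(3) by (simp add: mult.commute)
      also have "\<dots> = lfrac 1 s \<odot>\<^bsub>E\<^esub> f h" by (rule ext[OF hs(2) w(2) hs(1), symmetric])
      finally show "w = lfrac 1 s \<odot>\<^bsub>E\<^esub> f h" .
    qed
    have hom: "f' \<in> module_hom A (?N\<lparr>carrier := ?H\<rparr>) E"
      unfolding module_hom_def hom_def
    proof (intro CollectI conjI ballI)
      show "f' \<in> carrier (add_monoid (?N\<lparr>carrier := ?H\<rparr>)) \<rightarrow> carrier (add_monoid E)"
        by (auto simp: f' f lA invs_1)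
    next
      fix x y assume "x \<in> carrier (add_monoid (?N\<lparr>carrier := ?H\<rparr>))" "y \<in> carrier (add_monoid (?N\<lparr>carrier := ?H\<rparr>))"
      then obtain h s h' s' where x: "x = S_frac h s" "h \<in> H" "s \<in> den" and y: "y = S_frac h' s'" "h' \<in> H" "s' \<in> den" by auto
      have 1: "h * s' \<in> H" "h' * s \<in> H" using H(3)[OF den_invs[OF y(3)] x(2)] H(3)[OF den_invs[OF x(3)] y(2)] by (simp_all add: mult.commute)
      have "f' (x \<oplus>\<^bsub>?N\<^esub> y) = lfrac 1 (s * s') \<odot>\<^bsub>E\<^esub> f (h * s' + h' * s)"
        using x y 1 by (simp add: S_loc_add f' H den_mult)
      also have "\<dots> = lfrac 1 (s * s') \<odot>\<^bsub>E\<^esub> f (s' * h) \<oplus>\<^bsub>E\<^esub> lfrac 1 (s' * s) \<odot>\<^bsub>E\<^esub> f (s * h')"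
        using x y 1 by (simp add: f E.smult_r_distr lA invs_1 den_mult mult.commute)
      also have "\<dots> = f' x \<oplus>\<^bsub>E\<^esub> f' y"
        using x y by (simp only: f' ext[OF x(3) y(3) x(2)] ext[OF y(3) x(3) y(2)])
      finally show "f' (x \<otimes>\<^bsub>add_monoid (?N\<lparr>carrier := ?H\<rparr>)\<^esub> y) = f' x \<otimes>\<^bsub>add_monoid E\<^esub> f' y" by simp
    next
      fix a x assume "a \<in> carrier A" "x \<in> carrier (?N\<lparr>carrier := ?H\<rparr>)"
      then obtain r t h s where x: "a = lfrac r t" "r \<in> invs G" "t \<in> den" "x = S_frac h s" "h \<in> H" "s \<in> den"
        by (auto elim!: A_cases)
      have "f' (a \<odot>\<^bsub>?N\<^esub> x) = lfrac 1 (t * s) \<odot>\<^bsub>E\<^esub> f (r * h)"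
        using x by (simp add: S_loc_smult f' H den_mult)
      also have "\<dots> = lfrac r (t * s) \<odot>\<^bsub>E\<^esub> f h" using x by (simp add: mv den_mult)
      also have "\<dots> = a \<odot>\<^bsub>E\<^esub> f' x"
        using x by (simp add: f' f E.smult_assoc1[symmetric] lA invs_1 mult_A)
      finally show "f' (a \<odot>\<^bsub>?N\<lparr>carrier := ?H\<rparr>\<^esub> x) = a \<odot>\<^bsub>E\<^esub> f' x" by simp
    qed
    from inj have "\<forall>(N :: ((('n, 'k) mpoly \<times> ('n, 'k) mpoly) set, ((('n, 'k) mpoly \<times> ('n, 'k) mpoly) set + 'e) set) module) H f.
        Module.module A N \<longrightarrow> submodule H A N \<longrightarrow> f \<in> module_hom A (N\<lparr>carrier := H\<rparr>) E \<longrightarrow>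
        (\<exists>g \<in> module_hom A N E. \<forall>x \<in> H. g x = f x)"
      unfolding injective_module_def by (rule conjunct2)
    from this[rule_format, OF module_S_loc submodule_S_loc[OF H] hom]
    obtain g where g: "g \<in> module_hom A ?N E" "\<And>x. x \<in> ?H \<Longrightarrow> g x = f' x" by blast
    have g_add: "g (x \<oplus>\<^bsub>?N\<^esub> y) = g x \<oplus>\<^bsub>E\<^esub> g y" "g x \<in> carrier E"
      if "x \<in> carrier ?N" "y \<in> carrier ?N" for x y
      using g(1) that by (auto simp: module_hom_def hom_def)
    have g_smult: "g (a \<odot>\<^bsub>?N\<^esub> x) = a \<odot>\<^bsub>E\<^esub> g x" if "x \<in> carrier ?N" "a \<in> carrier A" for x a
      using g(1) that by (auto simp: module_hom_def)
    have "I.lin_map UNIV (\<lambda>a. g (S_frac a 1))"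
      unfolding I.lin_map_def
    proof (intro conjI ballI)
      fix a b
      show "g (S_frac a 1) \<in> carrier E" using g_add(2) S_loc_in den_1 by blast
      show "g (S_frac (a + b) 1) = g (S_frac a 1) \<oplus>\<^bsub>E\<^esub> g (S_frac b 1)"
        using g_add(1)[of "S_frac a 1" "S_frac b 1"] by (simp add: S_loc_add S_loc_in den_1)
      fix r assume "r \<in> invs G"
      then show "g (S_frac (r * a) 1) = lfrac r 1 \<odot>\<^bsub>E\<^esub> g (S_frac a 1)"
        using g_smult[of "S_frac a 1" "lfrac r 1"] by (simp add: S_loc_smult S_loc_in den_1 lA)
    qed
    moreover have "g (S_frac h 1) = f h" if "h \<in> H" for h
    proof -
      have "g (S_frac h 1) = f' (S_frac h 1)" using g(2) that den_1 by blast
      also have "\<dots> = f h" using E.smult_one[of "f h"] f that den_1 by (simp add: f' one_A)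
      finally show ?thesis .
    qed
    ultimately show ?case by blast
  qed
qed

end

section \<open>Cartier maps\<close>

lemma single_power:
  fixes c :: "'k::field" and a :: "'n::finite \<Rightarrow>\<^sub>0 nat"
  shows "\<exists>a'. (\<forall>i. Poly_Mapping.lookup a' i = n * Poly_Mapping.lookup a i) \<and>
    Poly_Mapping.single a c ^ n = Poly_Mapping.single a' (c ^ n)"
proof (induction n)
  case 0
  show ?case by (intro exI[of _ 0]) simp
next
  case (Suc n)
  then obtain a' where "\<forall>i. Poly_Mapping.lookup a' i = n * Poly_Mapping.lookup a i"
    "Poly_Mapping.single a c ^ n = Poly_Mapping.single a' (c ^ n)" by blast
  then show ?case by (intro exI[of _ "a + a'"]) (simp add: lookup_add mult_single)
qed

definition quot_exp :: "nat \<Rightarrow> ('n::finite \<Rightarrow>\<^sub>0 nat) \<Rightarrow> ('n \<Rightarrow>\<^sub>0 nat)" where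
  "quot_exp q m = Abs_poly_mapping (\<lambda>i. Poly_Mapping.lookup m i div q)"

lemma lookup_quot_exp: "Poly_Mapping.lookup (quot_exp q m) i = Poly_Mapping.lookup m i div q"
  by (simp add: quot_exp_def)

text \<open>The Cartier map sends \<open>x\<close> with exponent \<open>q m + (q - 1)\<close> to \<open>x\<close> with exponent \<open>m\<close> and all other monomials to zero. On coefficients it uses a map \<open>\<pi>\<close> that is linear over the \<open>q\<close>-th powers, which replaces the extraction of roots when the field is not perfect.\<close>

definition cartier_mon :: "('k::field \<Rightarrow> 'k) \<Rightarrow> nat \<Rightarrow> ('n::finite \<Rightarrow>\<^sub>0 nat) \<Rightarrow> 'k \<Rightarrow> ('n, 'k) mpoly" where
  "cartier_mon \<pi> q m c = (if \<forall>i. Poly_Mapping.lookup m i mod q = q - 1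
     then Poly_Mapping.single (quot_exp q m) (\<pi> c) else 0)"

definition cartier :: "('k::field \<Rightarrow> 'k) \<Rightarrow> nat \<Rightarrow> ('n::finite, 'k) mpoly \<Rightarrow> ('n, 'k) mpoly" where
  "cartier \<pi> q f = (\<Sum>m\<in>Poly_Mapping.keys f. cartier_mon \<pi> q m (Poly_Mapping.lookup f m))"

locale cartier_functional =
  fixes \<pi> :: "'k::field \<Rightarrow> 'k" and q :: nat
  assumes \<pi>_add: "\<pi> (a + b) = \<pi> a + \<pi> b" and \<pi>_mult: "\<pi> (c ^ q * b) = c * \<pi> b" and q_pos: "q > 0"
begin

lemma \<pi>_0: "\<pi> 0 = 0"
proof -
  have "\<pi> 0 + \<pi> 0 = \<pi> 0 + 0" using \<pi>_add[of 0 0] by (simp only: add_0_right)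
  then show ?thesis by (simp only: add_left_cancel)
qed

lemma cartier_mon_0: "cartier_mon \<pi> q m 0 = 0"
  by (simp add: cartier_mon_def \<pi>_0)

lemma cartier_mon_add: "cartier_mon \<pi> q m (a + b) = cartier_mon \<pi> q m a + cartier_mon \<pi> q m b"
  by (simp add: cartier_mon_def \<pi>_add single_add)

lemma cartier_superset:
  assumes "finite K" "Poly_Mapping.keys f \<subseteq> K"
  shows "cartier \<pi> q f = (\<Sum>m\<in>K. cartier_mon \<pi> q m (Poly_Mapping.lookup f m))"
  unfolding cartier_def
  by (rule sum.mono_neutral_left) (use assms in \<open>auto simp: in_keys_iff cartier_mon_0\<close>)

lemma cartier_add: "cartier \<pi> q (f + g) = cartier \<pi> q f + cartier \<pi> q g"
proof -
  let ?K = "Poly_Mapping.keys f \<union> Poly_Mapping.keys g"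
  have K: "finite ?K" "Poly_Mapping.keys (f + g) \<subseteq> ?K" by (auto simp: keys_add)
  show ?thesis
    by (subst (1 2 3) cartier_superset[where K = ?K])
      (use K in \<open>auto simp: lookup_add cartier_mon_add sum.distrib keys_add\<close>)
qed

lemma cartier_single: "cartier \<pi> q (Poly_Mapping.single m c) = cartier_mon \<pi> q m c"
  by (cases "c = 0") (auto simp: cartier_def cartier_mon_0)

lemma cartier_mult:
  fixes b f :: "('n::finite, 'k) mpoly"
  assumes frob: "\<And>u v :: ('n, 'k) mpoly. (u + v) ^ q = u ^ q + v ^ q"
  shows "cartier \<pi> q (b ^ q * f) = b * cartier \<pi> q f"
proof (induction b rule: mpoly_induct)
  case (single a c)
  obtain a' where a': "\<And>i. Poly_Mapping.lookup a' i = q * Poly_Mapping.lookup a i"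
    "Poly_Mapping.single a c ^ q = Poly_Mapping.single a' (c ^ q)"
    using single_power by metis
  show ?case
  proof (induction f rule: mpoly_induct)
    case (single m d)
    have 1: "(\<forall>i. Poly_Mapping.lookup (a' + m) i mod q = q - 1) \<longleftrightarrow> (\<forall>i. Poly_Mapping.lookup m i mod q = q - 1)"
      by (simp add: lookup_add a')
    have 2: "quot_exp q (a' + m) = a + quot_exp q m"
      by (rule poly_mapping_eqI) (use q_pos in \<open>simp add: lookup_quot_exp lookup_add a'\<close>)
    show ?case
      unfolding a'(2) mult_single cartier_single cartier_mon_def 1 2 \<pi>_mult by (simp add: mult_single)
  qed (simp add: distrib_left cartier_add)
qed (simp add: frob distrib_right cartier_add)

lemma cterm_cartier:
  assumes "\<And>i. Poly_Mapping.lookup m0 i = q - 1"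
  shows "cterm (cartier \<pi> q f) = \<pi> (Poly_Mapping.lookup f m0)"
proof (induction f rule: mpoly_induct)
  case (single m c)
  show ?case
  proof (cases "m = m0")
    case True
    have "quot_exp q m0 = 0" by (rule poly_mapping_eqI) (use q_pos in \<open>simp add: lookup_quot_exp assms\<close>)
    then show ?thesis using True q_pos by (simp add: cartier_single cartier_mon_def assms)
  next
    case False
    have "quot_exp q m \<noteq> 0" if "\<forall>i. Poly_Mapping.lookup m i mod q = q - 1"
    proof
      assume 0: "quot_exp q m = 0"
      have "Poly_Mapping.lookup m i = Poly_Mapping.lookup m0 i" for i
      proof -
        have "Poly_Mapping.lookup m i div q = 0" using lookup_quot_exp[of q m i] 0 by simp
        then show ?thesis using that assms[of i] div_mult_mod_eq[of "Poly_Mapping.lookup m i" q] by simp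
      qed
      then show False using False by (auto intro: poly_mapping_eqI)
    qed
    then show ?thesis using False by (auto simp: cartier_single cartier_mon_def lookup_single when_def \<pi>_0)
  qed
qed (simp add: cartier_add lookup_add \<pi>_add)

end

lemma lookup_shift: "Poly_Mapping.lookup (Poly_Mapping.single \<mu> 1 * f) (\<mu> + m) = Poly_Mapping.lookup f m"
  for f :: "('n::finite, 'k::field) mpoly"
proof (induction f rule: mpoly_induct)
  case (single m' c)
  show ?case by (simp add: mult_single lookup_single when_def)
qed (simp add: distrib_left lookup_add)

lemma free_group_subset_additive:
  assumes "subgroup N (free_Abelian_group S)"
  shows "additive_subgroup_set N"
proof -
  have sub: "Poly_Mapping.keys x \<subseteq> S" if "x \<in> N" for x
    using subgroup.mem_carrier[OF assms that] by simp
  show ?thesis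
    unfolding additive_subgroup_set_def
    using subgroup.one_closed[OF assms] subgroup.m_closed[OF assms] subgroup.m_inv_closed[OF assms] sub by auto
qed

context lin_group
begin

text \<open>Scalar multiplication through the \<open>p\<^sup>e\<close>-th power makes the field a vector space over itself, and a nonzero vector has a functional with value 1 there.\<close>

lemma p_linear_functional:
  fixes c0 :: 'k
  assumes "c0 \<noteq> 0"
  obtains \<pi> where "cartier_functional \<pi> (p ^ e)" "\<pi> c0 = 1"
proof -
  let ?s = "\<lambda>(a::'k) b. a ^ (p ^ e) * b"
  interpret F: vector_space ?s
    by unfold_locales (auto simp: algebra_simps frob_add_field power_mult_distrib)
  interpret K: vector_space "(*) :: 'k \<Rightarrow> 'k \<Rightarrow> 'k"
    by unfold_locales (auto simp: algebra_simps)
  interpret FK: vector_space_pair ?s "(*) :: 'k \<Rightarrow> 'k \<Rightarrow> 'k" by unfold_locales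
  have "F.independent {c0}" using assms F.dependent_single by simp
  from FK.linear_independent_extend[OF this, of "\<lambda>_. 1"]
  obtain \<pi> where \<pi>: "Vector_Spaces.linear ?s (*) \<pi>" "\<pi> c0 = 1" by auto
  interpret L: Vector_Spaces.linear ?s "(*)" \<pi> by (rule \<pi>(1))
  show ?thesis
  proof (rule that[of \<pi>])
    show "cartier_functional \<pi> (p ^ e)"
      by unfold_locales (use L.add L.scale p_pos in auto)
  qed (rule \<pi>(2))
qed

section \<open>The annihilator of the Frobenius image of the socle\<close>

text \<open>The contraction of the Frobenius power of the maximal ideal to the invariants.\<close>

definition frob_J :: "nat \<Rightarrow> ('n, 'k) mpoly set" where
  "frob_J e = invs G \<inter> frob_ideal (p ^ e)"

lemma r_ideal_frob_J: "r_ideal (frob_J e)"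
  by (auto simp: r_ideal_def frob_J_def inv_closed frob_ideal_0 frob_ideal_add frob_ideal_mult)

abbreviation Fr :: "nat \<Rightarrow> ((('n, 'k) mpoly \<times> ('n, 'k) mpoly) set, (('n, 'k) mpoly \<times> ('n, 'k) mpoly) set) module" where
  "Fr e \<equiv> frobenius_algebra A e"

lemma Fr_simps: "carrier (Fr e) = carrier A" "\<one>\<^bsub>Fr e\<^esub> = \<one>\<^bsub>A\<^esub>" "x \<oplus>\<^bsub>Fr e\<^esub> y = x \<oplus>\<^bsub>A\<^esub> y"
  "x \<otimes>\<^bsub>Fr e\<^esub> y = x \<otimes>\<^bsub>A\<^esub> y" "a \<odot>\<^bsub>Fr e\<^esub> x = (a [^]\<^bsub>A\<^esub> (p ^ e)) \<otimes>\<^bsub>A\<^esub> x"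
  by (simp_all add: frobenius_algebra_def ring_char_A)

end

locale loc_module = lin_group G p + EM: Module.module "invariant_local_ring G" E
  for G :: "('k::field ^ 'n::finite ^ 'n) set" and p :: nat
    and E :: "((('n, 'k) mpoly \<times> ('n, 'k) mpoly) set, 'e) module"
begin

definition relsF :: "nat \<Rightarrow> (((('n, 'k) mpoly \<times> ('n, 'k) mpoly) set \<times> 'e) \<Rightarrow>\<^sub>0 int) set" where
  "relsF e = tensor_relations A (Fr e) E"

text \<open>The bilinearity relations that define the Frobenius functor, with the \<open>p\<^sup>e\<close>-th power in place of the scalar multiplication of the Frobenius algebra.\<close>

definition gensF :: "nat \<Rightarrow> (((('n, 'k) mpoly \<times> ('n, 'k) mpoly) set \<times> 'e) \<Rightarrow>\<^sub>0 int) set" where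
  "gensF e = {frag_of (b \<oplus>\<^bsub>A\<^esub> b', x) - frag_of (b, x) - frag_of (b', x) | b b' x.
         b \<in> carrier A \<and> b' \<in> carrier A \<and> x \<in> carrier E} \<union>
      {frag_of (b, x \<oplus>\<^bsub>E\<^esub> x') - frag_of (b, x) - frag_of (b, x') | b x x'.
         b \<in> carrier A \<and> x \<in> carrier E \<and> x' \<in> carrier E} \<union>
      {frag_of ((a [^]\<^bsub>A\<^esub> (p ^ e)) \<otimes>\<^bsub>A\<^esub> b, x) - frag_of (b, a \<odot>\<^bsub>E\<^esub> x) | a b x.
         a \<in> carrier A \<and> b \<in> carrier A \<and> x \<in> carrier E}"

abbreviation TF where "TF \<equiv> free_Abelian_group (carrier A \<times> carrier E)"

lemma relsF_eq: "relsF e = generate TF (gensF e)"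
  by (simp add: relsF_def tensor_relations_def gensF_def Fr_simps)

lemma gensF_carrier: "gensF e \<subseteq> carrier TF"
proof -
  have k: "Poly_Mapping.keys (frag_of u - frag_of v) \<subseteq> S" if "u \<in> S" "v \<in> S" for u v :: "'z" and S
    using keys_diff[of "frag_of u" "frag_of v"] that by auto
  have k2: "frag_of u - frag_of v \<in> carrier TF"
    if "u \<in> carrier A \<times> carrier E" "v \<in> carrier A \<times> carrier E" for u v
    using k[OF that] by simp
  have k3: "frag_of u - frag_of v - frag_of w \<in> carrier TF"
    if "u \<in> carrier A \<times> carrier E" "v \<in> carrier A \<times> carrier E" "w \<in> carrier A \<times> carrier E" for u v w
    using keys_diff[of "frag_of u - frag_of v" "frag_of w"] k[OF that(1,2)] that by auto
  show ?thesis
    unfolding gensF_def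
    by (intro Un_least subsetI; elim CollectE exE conjE; hypsubst; intro k3 k2; simp)
qed

lemma subgroup_relsF: "subgroup (relsF e) TF"
  unfolding relsF_eq by (rule group.generate_is_subgroup[OF group_free_Abelian_group gensF_carrier])

lemmas relsF = additive_subgroup_setD[OF free_group_subset_additive[OF subgroup_relsF]]

lemma gens_in_relsF: "g \<in> gensF e \<Longrightarrow> g \<in> relsF e"
  unfolding relsF_eq by (rule generate.incl)

lemma relsF_add: "b \<in> carrier A \<Longrightarrow> b' \<in> carrier A \<Longrightarrow> x \<in> carrier E \<Longrightarrow>
    frag_of (b \<oplus>\<^bsub>A\<^esub> b', x) - (frag_of (b, x) + frag_of (b', x)) \<in> relsF e"
  and relsF_add_right: "b \<in> carrier A \<Longrightarrow> x \<in> carrier E \<Longrightarrow> x' \<in> carrier E \<Longrightarrow>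
    frag_of (b, x \<oplus>\<^bsub>E\<^esub> x') - (frag_of (b, x) + frag_of (b, x')) \<in> relsF e"
  and relsF_smult: "a \<in> carrier A \<Longrightarrow> b \<in> carrier A \<Longrightarrow> x \<in> carrier E \<Longrightarrow>
    frag_of ((a [^]\<^bsub>A\<^esub> (p ^ e)) \<otimes>\<^bsub>A\<^esub> b, x) - frag_of (b, a \<odot>\<^bsub>E\<^esub> x) \<in> relsF e"
  unfolding diff_diff_eq[symmetric]
  by (rule gens_in_relsF; unfold gensF_def; blast)+

text \<open>The action of the local ring on the free group that presents the Frobenius functor.\<close>

definition scaleF :: "(('n, 'k) mpoly \<times> ('n, 'k) mpoly) set \<Rightarrow>
    (((('n, 'k) mpoly \<times> ('n, 'k) mpoly) set \<times> 'e) \<Rightarrow>\<^sub>0 int) \<Rightarrow>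
    (((('n, 'k) mpoly \<times> ('n, 'k) mpoly) set \<times> 'e) \<Rightarrow>\<^sub>0 int)" where
  "scaleF c = frag_extend (\<lambda>(b, x). frag_of (c \<otimes>\<^bsub>A\<^esub> b, x))"

lemma scaleF_simps: "scaleF c 0 = 0" "scaleF c (u + v) = scaleF c u + scaleF c v" "scaleF c (u - v) = scaleF c u - scaleF c v"
  "scaleF c (- u) = - scaleF c u" "scaleF c (frag_of (b, x)) = frag_of (c \<otimes>\<^bsub>A\<^esub> b, x)"
  by (simp_all add: scaleF_def frag_extend_add frag_extend_diff frag_extend_minus)

lemma scaleF_relsF:
  assumes c: "c \<in> carrier A" and u: "u \<in> relsF e"
  shows "scaleF c u \<in> relsF e"
proof -
  have gens: "scaleF c g \<in> gensF e" if "g \<in> gensF e" for g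
    using that[unfolded gensF_def]
  proof (elim UnE)
    assume "g \<in> {frag_of (b \<oplus>\<^bsub>A\<^esub> b', x) - frag_of (b, x) - frag_of (b', x) | b b' x.
         b \<in> carrier A \<and> b' \<in> carrier A \<and> x \<in> carrier E}"
    then obtain b b' x where *: "g = frag_of (b \<oplus>\<^bsub>A\<^esub> b', x) - frag_of (b, x) - frag_of (b', x)"
      "b \<in> carrier A" "b' \<in> carrier A" "x \<in> carrier E" by blast
    have "scaleF c g = frag_of ((c \<otimes>\<^bsub>A\<^esub> b) \<oplus>\<^bsub>A\<^esub> (c \<otimes>\<^bsub>A\<^esub> b'), x) - frag_of (c \<otimes>\<^bsub>A\<^esub> b, x) - frag_of (c \<otimes>\<^bsub>A\<^esub> b', x)"
      using * c by (simp add: scaleF_simps EM.R.r_distr)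
    moreover have "c \<otimes>\<^bsub>A\<^esub> b \<in> carrier A" "c \<otimes>\<^bsub>A\<^esub> b' \<in> carrier A" using * c by auto
    ultimately show "scaleF c g \<in> gensF e" using *(4) unfolding gensF_def by blast
  next
    assume "g \<in> {frag_of (b, x \<oplus>\<^bsub>E\<^esub> x') - frag_of (b, x) - frag_of (b, x') | b x x'.
         b \<in> carrier A \<and> x \<in> carrier E \<and> x' \<in> carrier E}"
    then obtain b x x' where *: "g = frag_of (b, x \<oplus>\<^bsub>E\<^esub> x') - frag_of (b, x) - frag_of (b, x')"
      "b \<in> carrier A" "x \<in> carrier E" "x' \<in> carrier E" by blast
    have "scaleF c g = frag_of (c \<otimes>\<^bsub>A\<^esub> b, x \<oplus>\<^bsub>E\<^esub> x') - frag_of (c \<otimes>\<^bsub>A\<^esub> b, x) - frag_of (c \<otimes>\<^bsub>A\<^esub> b, x')"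
      using * c by (simp add: scaleF_simps)
    moreover have "c \<otimes>\<^bsub>A\<^esub> b \<in> carrier A" using * c by auto
    ultimately show "scaleF c g \<in> gensF e" using *(3,4) unfolding gensF_def by blast
  next
    assume "g \<in> {frag_of ((a [^]\<^bsub>A\<^esub> (p ^ e)) \<otimes>\<^bsub>A\<^esub> b, x) - frag_of (b, a \<odot>\<^bsub>E\<^esub> x) | a b x.
         a \<in> carrier A \<and> b \<in> carrier A \<and> x \<in> carrier E}"
    then obtain a b x where *: "g = frag_of ((a [^]\<^bsub>A\<^esub> (p ^ e)) \<otimes>\<^bsub>A\<^esub> b, x) - frag_of (b, a \<odot>\<^bsub>E\<^esub> x)"
      "a \<in> carrier A" "b \<in> carrier A" "x \<in> carrier E" by blast
    have "scaleF c g = frag_of ((a [^]\<^bsub>A\<^esub> (p ^ e)) \<otimes>\<^bsub>A\<^esub> (c \<otimes>\<^bsub>A\<^esub> b), x) - frag_of (c \<otimes>\<^bsub>A\<^esub> b, a \<odot>\<^bsub>E\<^esub> x)"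
      using * c by (simp add: scaleF_simps EM.R.m_lcomm)
    moreover have "c \<otimes>\<^bsub>A\<^esub> b \<in> carrier A" using * c by auto
    ultimately show "scaleF c g \<in> gensF e" using *(2,4) unfolding gensF_def by blast
  qed
  show ?thesis
    using u unfolding relsF_eq
  proof induction
    case one
    show ?case using generate.one[of TF "gensF e"] by (simp add: scaleF_simps)
  next
    case (incl h)
    then show ?case by (intro generate.incl gens)
  next
    case (inv h)
    have k: "Poly_Mapping.keys h \<subseteq> carrier A \<times> carrier E" "Poly_Mapping.keys (scaleF c h) \<subseteq> carrier A \<times> carrier E"
      using subsetD[OF gensF_carrier inv] subsetD[OF gensF_carrier gens[OF inv]] by simp_all
    have "inv\<^bsub>TF\<^esub> (scaleF c h) \<in> generate TF (gensF e)" by (intro generate.inv gens inv)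
    then show ?case using k by (simp add: scaleF_simps)
  next
    case (eng h1 h2)
    then show ?case using generate.eng[of "scaleF c h1" TF "gensF e" "scaleF c h2"] by (simp add: scaleF_simps)
  qed
qed

text \<open>The annihilator is decided in the free abelian group: the relations are stable under \<open>scaleF\<close>, so the union of cosets which defines the action is a single coset.\<close>

lemma annihilator_frobenius_iff:
  assumes z: "z \<in> carrier E" and a: "a \<in> carrier A"
  shows "a \<in> annihilator A (frobenius_functor A e E) (frobenius_map A e E z) \<longleftrightarrow> frag_of (a, z) \<in> relsF e"
proof -
  let ?N = "relsF e"
  let ?one = "frag_of (\<one>\<^bsub>A\<^esub>, z)"
  have coset: "?N #>\<^bsub>TF\<^esub> w = {n + w | n. n \<in> ?N}" for w
    by (auto simp: r_coset_def)
  have sm: "a \<odot>\<^bsub>frobenius_functor A e E\<^esub> (frobenius_map A e E z) =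
      (\<Union>u\<in>?N #>\<^bsub>TF\<^esub> ?one. ?N #>\<^bsub>TF\<^esub> scaleF a u)"
    by (simp add: frobenius_functor_def extend_scalars_def Let_def frobenius_map_def pure_tensor_def
        Fr_simps scaleF_def flip: relsF_def)
  have zero: "\<zero>\<^bsub>frobenius_functor A e E\<^esub> = ?N"
    by (simp add: frobenius_functor_def extend_scalars_def Let_def flip: relsF_def)
  have az: "scaleF a ?one = frag_of (a, z)" using a by (simp add: scaleF_simps)
  have "(\<Union>u\<in>?N #>\<^bsub>TF\<^esub> ?one. ?N #>\<^bsub>TF\<^esub> scaleF a u) = ?N \<longleftrightarrow> frag_of (a, z) \<in> ?N"
  proof
    assume eq: "(\<Union>u\<in>?N #>\<^bsub>TF\<^esub> ?one. ?N #>\<^bsub>TF\<^esub> scaleF a u) = ?N"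
    have "?one \<in> ?N #>\<^bsub>TF\<^esub> ?one" unfolding coset using relsF(1)[of e] by force
    moreover have "frag_of (a, z) \<in> ?N #>\<^bsub>TF\<^esub> scaleF a ?one"
      unfolding az coset using relsF(1)[of e] by force
    ultimately show "frag_of (a, z) \<in> ?N" using eq by blast
  next
    assume fz: "frag_of (a, z) \<in> ?N"
    have "?N #>\<^bsub>TF\<^esub> scaleF a u = ?N" if u: "u \<in> ?N #>\<^bsub>TF\<^esub> ?one" for u
    proof -
      obtain n where n: "n \<in> ?N" "u = n + ?one" using u coset by auto
      then have w: "scaleF a u \<in> ?N" using scaleF_relsF[OF a n(1)] fz az relsF(2) by (simp add: scaleF_simps)
      show ?thesis
      proof (intro equalityI subsetI)
        fix y assume "y \<in> ?N #>\<^bsub>TF\<^esub> scaleF a u"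
        then show "y \<in> ?N" using w relsF(2) by (auto simp: coset)
      next
        fix y assume "y \<in> ?N"
        then have "y - scaleF a u \<in> ?N" using w relsF(4) by blast
        then show "y \<in> ?N #>\<^bsub>TF\<^esub> scaleF a u" unfolding coset by (intro CollectI exI[of _ "y - scaleF a u"]) simp
      qed
    qed
    moreover have "?one \<in> ?N #>\<^bsub>TF\<^esub> ?one" unfolding coset using relsF(1)[of e] by force
    ultimately show "(\<Union>u\<in>?N #>\<^bsub>TF\<^esub> ?one. ?N #>\<^bsub>TF\<^esub> scaleF a u) = ?N" by blast
  qed
  then show ?thesis by (simp add: annihilator_def a sm zero)
qed

text \<open>For fixed \<open>s\<close>, sending \<open>f\<close> and \<open>x\<close> to the tensor of \<open>reyn (s f\<^sup>q)\<close> and \<open>x\<close> is balanced, because the Reynolds operator is linear over the invariants and \<open>q\<close>-th powers are additive. It kills \<open>x\<^sub>i\<close> and \<open>z\<close> by \<open>mvar_tensor_socle_zero\<close>. An invariant \<open>r\<close> in the Frobenius power is a sum of terms \<open>s\<^sub>i x\<^sub>i\<^sup>q\<close>, and \<open>reyn r = r\<close>.\<close>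

lemma frob_J_kills:
  assumes inj: "injective_module A E" and np: "\<forall>g\<in>G. \<not> pseudo_reflection g"
    and z: "z \<in> carrier E" "\<And>r. r \<in> invs G \<Longrightarrow> cterm r = 0 \<Longrightarrow> lfrac r 1 \<odot>\<^bsub>E\<^esub> z = \<zero>\<^bsub>E\<^esub>"
    and r: "r \<in> frob_J e" and t: "t \<in> den"
  shows "frag_of (lfrac r t, z) \<in> relsF e"
proof -
  interpret I: inv_injective_module G p E "\<lambda>r x. lfrac r 1 \<odot>\<^bsub>E\<^esub> x" by (rule inv_injectiveI[OF inj])
  have N: "additive_subgroup_set (relsF e)" by (rule free_group_subset_additive[OF subgroup_relsF])
  have lA: "lfrac r 1 \<in> carrier A" if "r \<in> invs G" for r using that by (simp add: lfrac_in_A den_1)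
  have ladd: "lfrac (r + s) 1 = lfrac r 1 \<oplus>\<^bsub>A\<^esub> lfrac s 1" if "r \<in> invs G" "s \<in> invs G" for r s
    using that by (simp add: add_A den_1)
  have one: "frag_of (lfrac (reyn (s * mvar i ^ (p ^ e))) 1, z) \<in> relsF e" for s i
  proof -
    let ?\<beta> = "\<lambda>f x. frag_of (lfrac (reyn (s * f ^ (p ^ e))) 1, x)"
    have "I.balanced (relsF e) ?\<beta>"
      unfolding I.balanced_def
    proof (intro conjI allI ballI)
      fix f f' x assume x: "x \<in> carrier E"
      show "?\<beta> (f + f') x - (?\<beta> f x + ?\<beta> f' x) \<in> relsF e"
        using relsF_add[OF lA[OF reyn_invs] lA[OF reyn_invs] x]
        by (simp add: frob_add distrib_left reyn_add ladd reyn_invs)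
      fix x' assume x': "x' \<in> carrier E"
      show "?\<beta> f (x \<oplus>\<^bsub>E\<^esub> x') - (?\<beta> f x + ?\<beta> f x') \<in> relsF e"
        by (rule relsF_add_right[OF lA[OF reyn_invs] x x'])
    next
      fix r f x assume r: "r \<in> invs G" and x: "x \<in> carrier E"
      have "reyn (s * (r * f) ^ (p ^ e)) = r ^ (p ^ e) * reyn (s * f ^ (p ^ e))"
        using reyn_mult[OF invs_power[OF r], of "p ^ e" "s * f ^ (p ^ e)"] by (simp add: power_mult_distrib mult.left_commute)
      then have "lfrac (reyn (s * (r * f) ^ (p ^ e))) 1 = (lfrac r 1 [^]\<^bsub>A\<^esub> (p ^ e)) \<otimes>\<^bsub>A\<^esub> lfrac (reyn (s * f ^ (p ^ e))) 1"
        using r by (simp add: power_A mult_A invs_power reyn_invs den_1)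
      then show "?\<beta> (r * f) x - ?\<beta> f (lfrac r 1 \<odot>\<^bsub>E\<^esub> x) \<in> relsF e"
        using relsF_smult[OF lA[OF r] lA[OF reyn_invs] x] by simp
    qed
    from I.mvar_tensor_socle_zero[OF np N z this] show ?thesis .
  qed
  obtain s where s: "r = (\<Sum>i\<in>UNIV. s i * mvar i ^ (p ^ e))"
    using r frob_ideal_decomp unfolding frob_J_def by blast
  have "frag_of (lfrac (\<Sum>i\<in>B. reyn (s i * mvar i ^ (p ^ e))) 1, z) \<in> relsF e" if "finite B" for B
    using that
  proof induction
    case empty
    have "frag_of (lfrac (0 + 0) 1, z) - (frag_of (lfrac 0 1, z) + frag_of (lfrac 0 1, z)) \<in> relsF e"
      unfolding ladd[OF invs_0 invs_0] by (rule relsF_add[OF lA lA z(1)]) (simp_all add: invs_0)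
    from relsF(3)[OF this] show ?case by simp
  next
    case (insert i B)
    let ?u = "reyn (s i * mvar i ^ (p ^ e))" and ?v = "\<Sum>i\<in>B. reyn (s i * mvar i ^ (p ^ e))"
    have v: "?v \<in> invs G" by (intro invs_sum reyn_invs)
    have "frag_of (lfrac (?u + ?v) 1, z) - (frag_of (lfrac ?u 1, z) + frag_of (lfrac ?v 1, z)) \<in> relsF e"
      unfolding ladd[OF reyn_invs v] by (rule relsF_add[OF lA[OF reyn_invs] lA[OF v] z(1)])
    from relsF(2)[OF this relsF(2)[OF one[of "s i" i] insert.IH]] show ?case using insert.hyps by simp
  qed
  from this[of UNIV] have "frag_of (lfrac (reyn r) 1, z) \<in> relsF e" by (simp add: s reyn_sum)
  then have 1: "frag_of (lfrac r 1, z) \<in> relsF e" using r by (simp add: frob_J_def reyn_of_invs)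
  have ri: "r \<in> invs G" using r by (simp add: frob_J_def)
  have "scaleF (lfrac 1 t) (frag_of (lfrac r 1, z)) \<in> relsF e"
    by (rule scaleF_relsF[OF _ 1]) (simp add: lfrac_in_A invs_1 t)
  then show ?thesis using ri t by (simp add: scaleF_simps mult_A invs_1 den_1)
qed

text \<open>If \<open>r\<close> is not in the Frobenius power, some monomial of \<open>r\<close> has all exponents below \<open>q\<close>. After multiplication by a monomial the Cartier map moves its coefficient to the constant term, and the Reynolds operator makes the result invariant. This gives a map \<open>\<Phi>\<close> of the local ring with \<open>\<Phi>(a\<^sup>q b) = a \<Phi>(b)\<close> that sends \<open>r\<close> to a unit. The balanced map \<open>(b, x) \<mapsto> \<Phi>(b) x\<close> then shows that the tensor of \<open>r\<close> and \<open>z\<close> is not zero.\<close>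

lemma frob_J_only:
  assumes z: "z \<in> carrier E" "z \<noteq> \<zero>\<^bsub>E\<^esub>"
    and r: "r \<in> invs G" and t: "t \<in> den" and kill: "frag_of (lfrac r t, z) \<in> relsF e"
  shows "r \<in> frob_J e"
proof (rule ccontr)
  assume "r \<notin> frob_J e"
  then obtain m where m: "m \<in> expbox (\<lambda>_. p ^ e)" "Poly_Mapping.lookup r m \<noteq> 0"
    using r by (auto simp: frob_J_def frob_ideal_def)
  define q where "q = p ^ e"
  have q: "q > 0" using p_pos by (simp add: q_def)
  obtain \<pi> where \<pi>: "cartier_functional \<pi> q" "\<pi> (Poly_Mapping.lookup r m) = 1"
    using p_linear_functional[OF m(2), of e] by (auto simp: q_def)
  interpret C: cartier_functional \<pi> q by (rule \<pi>(1))
  define m0 :: "'n \<Rightarrow>\<^sub>0 nat" where "m0 = Abs_poly_mapping (\<lambda>_. q - 1)"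
  have m0: "Poly_Mapping.lookup m0 i = q - 1" for i by (simp add: m0_def)
  have m0m: "(m0 - m) + m = m0"
    using m(1) by (intro poly_mapping_eqI) (auto simp: lookup_add lookup_minus m0 expbox_def q_def Suc_le_eq)
  define \<phi> where "\<phi> f = reyn (cartier \<pi> q (Poly_Mapping.single (m0 - m) 1 * f))" for f
  have \<phi>_inv: "\<phi> f \<in> invs G" for f by (simp add: \<phi>_def reyn_invs)
  have \<phi>_add: "\<phi> (f + g) = \<phi> f + \<phi> g" for f g by (simp add: \<phi>_def distrib_left C.cartier_add reyn_add)
  have \<phi>_mult: "\<phi> (b ^ q * f) = b * \<phi> f" if "b \<in> invs G" for b f
  proof -
    have "cartier \<pi> q (Poly_Mapping.single (m0 - m) 1 * (b ^ q * f)) =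
        cartier \<pi> q (b ^ q * (Poly_Mapping.single (m0 - m) 1 * f))" by (simp add: mult.left_commute)
    also have "\<dots> = b * cartier \<pi> q (Poly_Mapping.single (m0 - m) 1 * f)"
      by (rule C.cartier_mult) (simp add: q_def frob_add)
    finally show ?thesis by (simp add: \<phi>_def reyn_mult that)
  qed
  have \<phi>_r: "cterm (\<phi> r) = 1"
    using lookup_shift[of "m0 - m" r m] by (simp add: \<phi>_def cterm_reyn C.cterm_cartier[OF m0] m0m \<pi>(2))
  \<comment> \<open>the denominator is completed to a \<open>q\<close>-th power, which \<open>\<phi>\<close> can extract\<close>
  define \<Phi> where "\<Phi> x = (THE w. \<exists>r t. r \<in> invs G \<and> t \<in> den \<and> x = lfrac r t \<and> w = lfrac (\<phi> (r * t ^ (q - 1))) t)" for x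
  have tq: "t * t ^ (q - 1) = t ^ q" for t :: "('n, 'k) mpoly" using q by (simp flip: power_Suc)
  have \<Phi>: "\<Phi> (lfrac r t) = lfrac (\<phi> (r * t ^ (q - 1))) t" if rt: "r \<in> invs G" "t \<in> den" for r t
    unfolding \<Phi>_def
  proof (rule the_equality)
    show "\<exists>r' t'. r' \<in> invs G \<and> t' \<in> den \<and> lfrac r t = lfrac r' t' \<and> lfrac (\<phi> (r * t ^ (q - 1))) t = lfrac (\<phi> (r' * t' ^ (q - 1))) t'"
      using rt by blast
    fix w assume "\<exists>r' t'. r' \<in> invs G \<and> t' \<in> den \<and> lfrac r t = lfrac r' t' \<and> w = lfrac (\<phi> (r' * t' ^ (q - 1))) t'"
    then obtain r' t' where w: "r' \<in> invs G" "t' \<in> den" "r * t' = r' * t" "w = lfrac (\<phi> (r' * t' ^ (q - 1))) t'"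
      using rt by (auto simp: lfrac_eq_iff)
    have "t * \<phi> (r' * t' ^ (q - 1)) = \<phi> (t ^ q * (r' * t' ^ (q - 1)))" by (simp add: \<phi>_mult den_invs rt)
    also have "t ^ q * (r' * t' ^ (q - 1)) = (r' * t) * (t ^ (q - 1) * t' ^ (q - 1))" by (simp add: ac_simps flip: tq)
    also have "\<dots> = t' ^ q * (r * t ^ (q - 1))" by (simp add: ac_simps flip: tq w(3))
    also have "\<phi> \<dots> = t' * \<phi> (r * t ^ (q - 1))" by (simp add: \<phi>_mult den_invs w)
    finally show "w = lfrac (\<phi> (r * t ^ (q - 1))) t"
      unfolding w(4) using w rt by (subst lfrac_eq_iff) (auto simp: \<phi>_inv mult.commute)
  qed
  have \<Phi>_closed: "\<Phi> x \<in> carrier A" if "x \<in> carrier A" for x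
    using that by (elim A_cases) (simp add: \<Phi> lfrac_in_A \<phi>_inv)
  have \<Phi>_add: "\<Phi> (x \<oplus>\<^bsub>A\<^esub> y) = \<Phi> x \<oplus>\<^bsub>A\<^esub> \<Phi> y" if xy: "x \<in> carrier A" "y \<in> carrier A" for x y
  proof -
    obtain r t where x: "x = lfrac r t" "r \<in> invs G" "t \<in> den" using xy(1) by (rule A_cases)
    obtain r' t' where y: "y = lfrac r' t'" "r' \<in> invs G" "t' \<in> den" using xy(2) by (rule A_cases)
    have s: "r * t' + r' * t \<in> invs G" 
      using den_invs[OF x(3)] den_invs[OF y(3)] x y by (auto intro: invs_add invs_mult)
    have "(r * t' + r' * t) * (t * t') ^ (q - 1) = t' ^ q * (r * t ^ (q - 1)) + t ^ q * (r' * t' ^ (q - 1))"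
      by (simp add: power_mult_distrib algebra_simps flip: tq)
    then have "\<phi> ((r * t' + r' * t) * (t * t') ^ (q - 1)) = t' * \<phi> (r * t ^ (q - 1)) + t * \<phi> (r' * t' ^ (q - 1))"
      using x y by (simp add: \<phi>_add \<phi>_mult den_invs)
    then show ?thesis using x y s by (simp add: add_A \<Phi> \<phi>_inv den_mult mult.commute)
  qed
  have \<Phi>_mult: "\<Phi> ((a [^]\<^bsub>A\<^esub> q) \<otimes>\<^bsub>A\<^esub> x) = a \<otimes>\<^bsub>A\<^esub> \<Phi> x" if ax: "a \<in> carrier A" "x \<in> carrier A" for a x
  proof -
    obtain r t where x: "x = lfrac r t" "r \<in> invs G" "t \<in> den" using ax(2) by (rule A_cases)
    obtain u v where a: "a = lfrac u v" "u \<in> invs G" "v \<in> den" using ax(1) by (rule A_cases)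
    have uq: "u ^ q * r \<in> invs G" "v ^ q * t \<in> den" using a x by (auto intro: invs_mult invs_power den_mult den_power)
    have "(u ^ q * r) * (v ^ q * t) ^ (q - 1) = (u * v ^ (q - 1)) ^ q * (r * t ^ (q - 1))"
      by (simp add: power_mult_distrib mult.commute ac_simps flip: power_mult)
    then have 1: "\<phi> ((u ^ q * r) * (v ^ q * t) ^ (q - 1)) = u * v ^ (q - 1) * \<phi> (r * t ^ (q - 1))"
      using a by (simp add: \<phi>_mult invs_mult invs_power den_invs)
    have 2: "(a [^]\<^bsub>A\<^esub> q) \<otimes>\<^bsub>A\<^esub> x = lfrac (u ^ q * r) (v ^ q * t)"
      using a x by (simp add: power_A mult_A invs_power den_power)
    have "\<Phi> ((a [^]\<^bsub>A\<^esub> q) \<otimes>\<^bsub>A\<^esub> x) = lfrac (u * v ^ (q - 1) * \<phi> (r * t ^ (q - 1))) (v ^ q * t)"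
      by (simp only: 2 \<Phi>[OF uq] 1)
    also have "\<dots> = lfrac (u * \<phi> (r * t ^ (q - 1))) (v * t)"
    proof (subst lfrac_eq_iff)
      show "u * v ^ (q - 1) * \<phi> (r * t ^ (q - 1)) * (v * t) = u * \<phi> (r * t ^ (q - 1)) * (v ^ q * t)"
        by (simp add: ac_simps flip: tq)
    qed (use a x uq \<phi>_inv den_invs[OF a(3)] in \<open>auto intro: invs_mult invs_power den_mult\<close>)
    also have "\<dots> = a \<otimes>\<^bsub>A\<^esub> \<Phi> x" using a x by (simp add: \<Phi> mult_A \<phi>_inv)
    finally show ?thesis .
  qed
  \<comment> \<open>the induced map on the tensor product\<close>
  have "(\<lambda>(b, x). \<Phi> b \<odot>\<^bsub>E\<^esub> x) ` (carrier A \<times> carrier E) \<subseteq> carrier (add_monoid E)"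
    using \<Phi>_closed by auto
  then obtain h where h: "h \<in> hom TF (add_monoid E)"
    "\<And>y. y \<in> carrier A \<times> carrier E \<Longrightarrow> h (frag_of y) = (\<lambda>(b, x). \<Phi> b \<odot>\<^bsub>E\<^esub> x) y"
    by (rule comm_group.free_Abelian_group_universal[OF EM.M.a_comm_group]) blast
  have hf: "h (frag_of (b, x)) = \<Phi> b \<odot>\<^bsub>E\<^esub> x" if "b \<in> carrier A" "x \<in> carrier E" for b x
    using h(2)[of "(b, x)"] that by simp
  interpret gh: group_hom TF "add_monoid E" h
    by (intro group_hom.intro group_hom_axioms.intro h group_free_Abelian_group EM.M.a_group)
  have h_diff: "h (u - v) = h u \<ominus>\<^bsub>E\<^esub> h v" if "Poly_Mapping.keys u \<subseteq> carrier A \<times> carrier E" "Poly_Mapping.keys v \<subseteq> carrier A \<times> carrier E" for u v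
  proof -
    have "h (u - v) = h (u \<otimes>\<^bsub>TF\<^esub> inv\<^bsub>TF\<^esub> v)" using that by simp
    also have "\<dots> = h u \<otimes>\<^bsub>add_monoid E\<^esub> h (inv\<^bsub>TF\<^esub> v)"
      by (rule gh.hom_mult) (use that in simp_all)
    also have "h (inv\<^bsub>TF\<^esub> v) = inv\<^bsub>add_monoid E\<^esub> (h v)"
      by (rule gh.hom_inv) (use that in simp)
    finally show ?thesis by (simp add: a_minus_def a_inv_def)
  qed
  have ker: "h g = \<zero>\<^bsub>E\<^esub>" if "g \<in> gensF e" for g
    using that[unfolded gensF_def]
  proof (elim UnE)
    assume "g \<in> {frag_of (b \<oplus>\<^bsub>A\<^esub> b', x) - frag_of (b, x) - frag_of (b', x) | b b' x.
         b \<in> carrier A \<and> b' \<in> carrier A \<and> x \<in> carrier E}"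
    then obtain b b' x where *: "g = frag_of (b \<oplus>\<^bsub>A\<^esub> b', x) - frag_of (b, x) - frag_of (b', x)"
      "b \<in> carrier A" "b' \<in> carrier A" "x \<in> carrier E" by blast
    have k: "Poly_Mapping.keys (frag_of (b \<oplus>\<^bsub>A\<^esub> b', x) - frag_of (b, x)) \<subseteq> carrier A \<times> carrier E"
      using keys_diff[of "frag_of (b \<oplus>\<^bsub>A\<^esub> b', x)" "frag_of (b, x)"] * by auto
    have "h g = (\<Phi> b \<oplus>\<^bsub>A\<^esub> \<Phi> b') \<odot>\<^bsub>E\<^esub> x \<ominus>\<^bsub>E\<^esub> \<Phi> b \<odot>\<^bsub>E\<^esub> x \<ominus>\<^bsub>E\<^esub> \<Phi> b' \<odot>\<^bsub>E\<^esub> x"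
      using * k by (simp add: h_diff hf \<Phi>_add)
    also have "\<dots> = \<zero>\<^bsub>E\<^esub>"
      using * \<Phi>_closed by (simp add: EM.smult_l_distr EM.M.minus_eq EM.M.a_ac EM.M.r_neg EM.M.r_neg1 EM.M.r_neg2)
    finally show ?thesis .
  next
    assume "g \<in> {frag_of (b, x \<oplus>\<^bsub>E\<^esub> x') - frag_of (b, x) - frag_of (b, x') | b x x'.
         b \<in> carrier A \<and> x \<in> carrier E \<and> x' \<in> carrier E}"
    then obtain b x x' where *: "g = frag_of (b, x \<oplus>\<^bsub>E\<^esub> x') - frag_of (b, x) - frag_of (b, x')"
      "b \<in> carrier A" "x \<in> carrier E" "x' \<in> carrier E" by blast
    have k: "Poly_Mapping.keys (frag_of (b, x \<oplus>\<^bsub>E\<^esub> x') - frag_of (b, x)) \<subseteq> carrier A \<times> carrier E"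
      using keys_diff[of "frag_of (b, x \<oplus>\<^bsub>E\<^esub> x')" "frag_of (b, x)"] * by auto
    have "h g = \<Phi> b \<odot>\<^bsub>E\<^esub> (x \<oplus>\<^bsub>E\<^esub> x') \<ominus>\<^bsub>E\<^esub> \<Phi> b \<odot>\<^bsub>E\<^esub> x \<ominus>\<^bsub>E\<^esub> \<Phi> b \<odot>\<^bsub>E\<^esub> x'"
      using * k by (simp add: h_diff hf)
    also have "\<dots> = \<zero>\<^bsub>E\<^esub>"
      using * \<Phi>_closed by (simp add: EM.smult_r_distr EM.M.minus_eq EM.M.a_ac EM.M.r_neg EM.M.r_neg1 EM.M.r_neg2)
    finally show ?thesis .
  next
    assume "g \<in> {frag_of ((a [^]\<^bsub>A\<^esub> (p ^ e)) \<otimes>\<^bsub>A\<^esub> b, x) - frag_of (b, a \<odot>\<^bsub>E\<^esub> x) | a b x.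
         a \<in> carrier A \<and> b \<in> carrier A \<and> x \<in> carrier E}"
    then obtain a b x where *: "g = frag_of ((a [^]\<^bsub>A\<^esub> q) \<otimes>\<^bsub>A\<^esub> b, x) - frag_of (b, a \<odot>\<^bsub>E\<^esub> x)"
      "a \<in> carrier A" "b \<in> carrier A" "x \<in> carrier E" by (auto simp: q_def)
    have "h g = (a \<otimes>\<^bsub>A\<^esub> \<Phi> b) \<odot>\<^bsub>E\<^esub> x \<ominus>\<^bsub>E\<^esub> \<Phi> b \<odot>\<^bsub>E\<^esub> (a \<odot>\<^bsub>E\<^esub> x)"
      using * by (simp add: h_diff hf \<Phi>_mult)
    also have "(a \<otimes>\<^bsub>A\<^esub> \<Phi> b) = \<Phi> b \<otimes>\<^bsub>A\<^esub> a" using * \<Phi>_closed EM.R.m_comm by simp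
    finally show ?thesis using * \<Phi>_closed by (simp add: EM.smult_assoc1 EM.M.minus_eq EM.M.r_neg)
  qed
  have "relsF e \<subseteq> kernel TF (add_monoid E) h"
    unfolding relsF_eq
    by (rule group.generate_subgroup_incl[OF group_free_Abelian_group _ gh.subgroup_kernel])
      (use ker subsetD[OF gensF_carrier] in \<open>simp add: kernel_def subset_iff\<close>)
  moreover have "scaleF (lfrac t 1) (frag_of (lfrac r t, z)) \<in> relsF e"
    by (rule scaleF_relsF[OF _ kill]) (simp add: lfrac_in_A den_invs t den_1)
  moreover have "lfrac t 1 \<otimes>\<^bsub>A\<^esub> lfrac r t = lfrac r 1"
    using r t by (simp add: mult_A lfrac_eq_iff inv_closed mult.commute)
  ultimately have "h (frag_of (lfrac r 1, z)) = \<zero>\<^bsub>E\<^esub>" by (auto simp: scaleF_simps kernel_def)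
  then have 0: "lfrac (\<phi> r) 1 \<odot>\<^bsub>E\<^esub> z = \<zero>\<^bsub>E\<^esub>" using z r by (simp add: hf lfrac_in_A den_1 \<Phi>)
  have d: "\<phi> r \<in> den" using \<phi>_r \<phi>_inv by (simp add: den_def)
  have "lfrac 1 (\<phi> r) \<otimes>\<^bsub>A\<^esub> lfrac (\<phi> r) 1 = \<one>\<^bsub>A\<^esub>"
    using d by (simp add: mult_A one_A lfrac_eq_iff inv_closed)
  then have "z = (lfrac 1 (\<phi> r) \<otimes>\<^bsub>A\<^esub> lfrac (\<phi> r) 1) \<odot>\<^bsub>E\<^esub> z"
    using EM.smult_one[OF z(1)] by simp
  also have "\<dots> = \<zero>\<^bsub>E\<^esub>"
    using d z 0 by (simp add: EM.smult_assoc1 lfrac_in_A inv_closed)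
  finally show False using z by simp
qed

theorem annihilator_frobenius:
  assumes inj: "injective_module A E" and np: "\<forall>g\<in>G. \<not> pseudo_reflection g"
    and z: "z \<in> carrier E" "z \<noteq> \<zero>\<^bsub>E\<^esub>" "\<And>r. r \<in> invs G \<Longrightarrow> cterm r = 0 \<Longrightarrow> lfrac r 1 \<odot>\<^bsub>E\<^esub> z = \<zero>\<^bsub>E\<^esub>"
  shows "annihilator A (frobenius_functor A e E) (frobenius_map A e E z) = loc (frob_J e)"
proof (intro equalityI subsetI)
  fix a assume a: "a \<in> annihilator A (frobenius_functor A e E) (frobenius_map A e E z)"
  then have aA: "a \<in> carrier A" by (simp add: annihilator_def)
  then obtain r t where rt: "a = lfrac r t" "r \<in> invs G" "t \<in> den" by (rule A_cases)
  have "frag_of (lfrac r t, z) \<in> relsF e" using a annihilator_frobenius_iff[OF z(1) aA] rt by simp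
  then have "r \<in> frob_J e" using frob_J_only[OF z(1,2) rt(2,3)] by blast
  then show "a \<in> loc (frob_J e)" using rt by (auto simp: loc_def)
next
  fix a assume "a \<in> loc (frob_J e)"
  then obtain r t where rt: "a = lfrac r t" "r \<in> frob_J e" "t \<in> den" by (auto simp: loc_def)
  have aA: "a \<in> carrier A" using rt by (simp add: frob_J_def lfrac_in_A)
  have "frag_of (lfrac r t, z) \<in> relsF e" by (rule frob_J_kills[OF inj np z(1,3) rt(2,3)])
  then show "a \<in> annihilator A (frobenius_functor A e E) (frobenius_map A e E z)"
    using annihilator_frobenius_iff[OF z(1) aA] rt(1) by simp
qed

end

section \<open>The length of the quotient\<close>

definition order_ge :: "nat \<Rightarrow> ('n::finite, 'k::field) mpoly \<Rightarrow> bool" where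
  "order_ge j f \<longleftrightarrow> (\<forall>m\<in>Poly_Mapping.keys f. j \<le> (\<Sum>i\<in>UNIV. Poly_Mapping.lookup m i))"

lemma order_ge_0: "order_ge 0 f"
  by (simp add: order_ge_def)

lemma order_ge_mult: "order_ge a f \<Longrightarrow> order_ge b g \<Longrightarrow> order_ge (a + b) (f * g)"
  unfolding order_ge_def
proof
  fix m
  assume f: "\<forall>m\<in>Poly_Mapping.keys f. a \<le> (\<Sum>i\<in>UNIV. Poly_Mapping.lookup m i)"
    and g: "\<forall>m\<in>Poly_Mapping.keys g. b \<le> (\<Sum>i\<in>UNIV. Poly_Mapping.lookup m i)"
    and m: "m \<in> Poly_Mapping.keys (f * g)"
  obtain u v where "m = u + v" "u \<in> Poly_Mapping.keys f" "v \<in> Poly_Mapping.keys g"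
    using keys_mult[of f g] m by auto
  then show "a + b \<le> (\<Sum>i\<in>UNIV. Poly_Mapping.lookup m i)"
    using f g by (simp add: lookup_add sum.distrib add_mono)
qed

lemma order_ge_1: "cterm f = 0 \<Longrightarrow> order_ge 1 f"
  unfolding order_ge_def
proof
  fix m assume "cterm f = 0" "m \<in> Poly_Mapping.keys f"
  then have "m \<noteq> 0" by (auto simp: in_keys_iff)
  then obtain i where "Poly_Mapping.lookup m i \<noteq> 0" by (metis lookup_zero poly_mapping_eqI)
  then have "1 \<le> Poly_Mapping.lookup m i" by simp
  also have "\<dots> \<le> (\<Sum>i\<in>UNIV. Poly_Mapping.lookup m i)" by (rule member_le_sum) auto
  finally show "1 \<le> (\<Sum>i\<in>UNIV. Poly_Mapping.lookup m i)" .
qed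

lemma order_ge_power: "cterm f = 0 \<Longrightarrow> order_ge n (f ^ n)"
proof (induction n)
  case (Suc n)
  then show ?case using order_ge_mult[OF order_ge_1, of f n "f ^ n"] by simp
qed (rule order_ge_0)

lemma order_ge_frob_ideal:
  fixes f :: "('n::finite, 'k::field) mpoly"
  assumes "order_ge (CARD('n) * q) f"
  shows "f \<in> frob_ideal q"
  unfolding frob_ideal_def
proof (intro CollectI ballI)
  fix m :: "'n \<Rightarrow>\<^sub>0 nat" assume "m \<in> expbox (\<lambda>_. q)"
  then have "(\<Sum>i\<in>UNIV. Poly_Mapping.lookup m i) < (\<Sum>i\<in>(UNIV::'n set). q)"
    by (intro sum_strict_mono) (auto simp: expbox_def)
  then have "m \<notin> Poly_Mapping.keys f" using assms by (auto simp: order_ge_def)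
  then show "Poly_Mapping.lookup f m = 0" by (simp add: in_keys_iff)
qed

context lin_group
begin

lemma diff_A: "r \<in> invs G \<Longrightarrow> s \<in> den \<Longrightarrow> r' \<in> invs G \<Longrightarrow> s' \<in> den \<Longrightarrow>
    lfrac r s \<ominus>\<^bsub>A\<^esub> lfrac r' s' = lfrac (r * s' - r' * s) (s * s')"
  by (simp add: a_minus_def minus_A add_A inv_closed)

lemma quot_module_simps:
  assumes I: "ideal I A"
  shows "carrier (quot_module A I) = {I +>\<^bsub>A\<^esub> x | x. x \<in> carrier A}"
    "\<And>x y. x \<in> carrier A \<Longrightarrow> y \<in> carrier A \<Longrightarrow> (I +>\<^bsub>A\<^esub> x) \<oplus>\<^bsub>quot_module A I\<^esub> (I +>\<^bsub>A\<^esub> y) = I +>\<^bsub>A\<^esub> (x \<oplus>\<^bsub>A\<^esub> y)"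
    "\<And>a x. a \<in> carrier A \<Longrightarrow> x \<in> carrier A \<Longrightarrow> a \<odot>\<^bsub>quot_module A I\<^esub> (I +>\<^bsub>A\<^esub> x) = I +>\<^bsub>A\<^esub> (a \<otimes>\<^bsub>A\<^esub> x)"
    "\<And>x y. x \<in> carrier A \<Longrightarrow> y \<in> carrier A \<Longrightarrow> I +>\<^bsub>A\<^esub> x = I +>\<^bsub>A\<^esub> y \<longleftrightarrow> x \<ominus>\<^bsub>A\<^esub> y \<in> I"
    "\<zero>\<^bsub>quot_module A I\<^esub> = I +>\<^bsub>A\<^esub> \<zero>\<^bsub>A\<^esub>"
proof -
  interpret R: cring A by (rule cring_A)
  interpret I: ideal I A by (rule I)
  show "carrier (quot_module A I) = {I +>\<^bsub>A\<^esub> x | x. x \<in> carrier A}"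
    by (auto simp: quot_module_def A_RCOSETS_def')
  show "(I +>\<^bsub>A\<^esub> x) \<oplus>\<^bsub>quot_module A I\<^esub> (I +>\<^bsub>A\<^esub> y) = I +>\<^bsub>A\<^esub> (x \<oplus>\<^bsub>A\<^esub> y)"
    if "x \<in> carrier A" "y \<in> carrier A" for x y
    using I.a_rcos_sum[OF that] by (simp add: quot_module_def)
  show "a \<odot>\<^bsub>quot_module A I\<^esub> (I +>\<^bsub>A\<^esub> x) = I +>\<^bsub>A\<^esub> (a \<otimes>\<^bsub>A\<^esub> x)"
    if "a \<in> carrier A" "x \<in> carrier A" for a x
    using I.rcoset_mult_add[OF that] by (simp add: quot_module_def)
  show "I +>\<^bsub>A\<^esub> x = I +>\<^bsub>A\<^esub> y \<longleftrightarrow> x \<ominus>\<^bsub>A\<^esub> y \<in> I" if "x \<in> carrier A" "y \<in> carrier A" for x y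
    using R.quotient_eq_iff_same_a_r_cos[OF I that] by simp
  show "\<zero>\<^bsub>quot_module A I\<^esub> = I +>\<^bsub>A\<^esub> \<zero>\<^bsub>A\<^esub>"
    using R.a_coset_add_zero[OF I.a_subset] by (simp add: quot_module_def)
qed

lemma module_quot_module:
  assumes I: "ideal I A"
  shows "Module.module A (quot_module A I)"
proof -
  interpret R: cring A by (rule cring_A)
  note q = quot_module_simps[OF I]
  interpret Q: ring "A Quot I" by (rule ideal.quotient_is_ring[OF I])
  have eq: "carrier (quot_module A I) = carrier (A Quot I)" "add (quot_module A I) = add (A Quot I)"
    "\<zero>\<^bsub>quot_module A I\<^esub> = \<zero>\<^bsub>A Quot I\<^esub>"
    by (simp_all add: quot_module_def FactRing_def)
  have ag: "abelian_group (quot_module A I)"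
  proof (rule abelian_groupI)
    fix x assume "x \<in> carrier (quot_module A I)"
    then show "\<exists>y\<in>carrier (quot_module A I). y \<oplus>\<^bsub>quot_module A I\<^esub> x = \<zero>\<^bsub>quot_module A I\<^esub>"
      unfolding eq using Q.l_neg Q.a_inv_closed by blast
  qed (simp_all add: eq Q.a_ac)
  have rep: "\<exists>u. x = I +>\<^bsub>A\<^esub> u \<and> u \<in> carrier A" if "x \<in> carrier (quot_module A I)" for x
    using that q(1) by auto
  show ?thesis
  proof (rule moduleI[OF cring_A ag])
    fix a x assume "a \<in> carrier A" "x \<in> carrier (quot_module A I)"
    then show "a \<odot>\<^bsub>quot_module A I\<^esub> x \<in> carrier (quot_module A I)" using rep[of x] by (auto simp: q)
  next
    fix x assume "x \<in> carrier (quot_module A I)"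
    then show "\<one>\<^bsub>A\<^esub> \<odot>\<^bsub>quot_module A I\<^esub> x = x" using rep[of x] by (auto simp: q(3))
  next
    fix a b x assume *: "a \<in> carrier A" "b \<in> carrier A" "x \<in> carrier (quot_module A I)"
    then obtain u where u: "x = I +>\<^bsub>A\<^esub> u" "u \<in> carrier A" using rep by blast
    show "(a \<oplus>\<^bsub>A\<^esub> b) \<odot>\<^bsub>quot_module A I\<^esub> x = a \<odot>\<^bsub>quot_module A I\<^esub> x \<oplus>\<^bsub>quot_module A I\<^esub> b \<odot>\<^bsub>quot_module A I\<^esub> x"
      using * u by (simp add: q(2,3) R.l_distr)
    show "(a \<otimes>\<^bsub>A\<^esub> b) \<odot>\<^bsub>quot_module A I\<^esub> x = a \<odot>\<^bsub>quot_module A I\<^esub> (b \<odot>\<^bsub>quot_module A I\<^esub> x)"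
      using * u by (simp add: q(2,3) R.m_assoc)
  next
    fix a x y assume *: "a \<in> carrier A" "x \<in> carrier (quot_module A I)" "y \<in> carrier (quot_module A I)"
    obtain u where u: "x = I +>\<^bsub>A\<^esub> u" "u \<in> carrier A" using rep *(2) by blast
    obtain v where v: "y = I +>\<^bsub>A\<^esub> v" "v \<in> carrier A" using rep *(3) by blast
    show "a \<odot>\<^bsub>quot_module A I\<^esub> (x \<oplus>\<^bsub>quot_module A I\<^esub> y) = a \<odot>\<^bsub>quot_module A I\<^esub> x \<oplus>\<^bsub>quot_module A I\<^esub> a \<odot>\<^bsub>quot_module A I\<^esub> y"
      using * u v by (simp add: q(2,3) R.r_distr)
  qed
qed

text \<open>The invariants whose classes lie in a given submodule form, after truncation, a subspace which determines the submodule. A strict chain of submodules gives a strict chain of subspaces.\<close>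

lemma submodule_chain_bound:
  assumes H: "\<forall>i\<le>n. submodule (H i) A (quot_module A (loc (frob_J e)))" "\<forall>i<n. H i \<subset> H (Suc i)"
  shows "n \<le> ldim e"
proof -
  let ?I = "loc (frob_J e)"
  let ?M = "quot_module A ?I"
  let ?q = "p ^ e"
  have I: "ideal ?I A" by (rule ideal_loc[OF r_ideal_frob_J])
  note q = quot_module_simps[OF I]
  interpret R: cring A by (rule cring_A)
  interpret M: Module.module A ?M by (rule module_quot_module[OF I])
  have Hsub: "H i \<subseteq> carrier ?M" and Hadd: "\<And>a b. a \<in> H i \<Longrightarrow> b \<in> H i \<Longrightarrow> a \<oplus>\<^bsub>?M\<^esub> b \<in> H i"
    and Hsm: "\<And>a x. a \<in> carrier A \<Longrightarrow> x \<in> H i \<Longrightarrow> a \<odot>\<^bsub>?M\<^esub> x \<in> H i" and Hne: "H i \<noteq> {}" if "i \<le> n" for i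
    using M.submoduleE[of "H i"] H(1) that by blast+
  have l: "lfrac r 1 \<in> carrier A" if "r \<in> invs G" for r using that by (simp add: lfrac_in_A den_1)
  define D where "D i = {r \<in> invs G. ?I +>\<^bsub>A\<^esub> lfrac r 1 \<in> H i}" for i
  have D_mult: "s * r \<in> D i" if "i \<le> n" "s \<in> invs G" "r \<in> D i" for i r s
    using Hsm[OF that(1) l[OF that(2)], of "?I +>\<^bsub>A\<^esub> lfrac r 1"] that
    by (simp add: D_def q l mult_A den_1 invs_mult)
  have D_add: "r + s \<in> D i" if "i \<le> n" "r \<in> D i" "s \<in> D i" for i r s
    using Hadd[OF that(1), of "?I +>\<^bsub>A\<^esub> lfrac r 1" "?I +>\<^bsub>A\<^esub> lfrac s 1"] that
    by (simp add: D_def q l add_A den_1 invs_add)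
  have D_all: "lfrac r t \<in> carrier A \<and> (?I +>\<^bsub>A\<^esub> lfrac r t \<in> H i \<longleftrightarrow> r \<in> D i)" if "i \<le> n" "r \<in> invs G" "t \<in> den" for i r t
  proof (intro conjI iffI)
    show c: "lfrac r t \<in> carrier A" using that by (simp add: lfrac_in_A)
    have t: "lfrac t 1 \<in> carrier A" "lfrac 1 t \<in> carrier A" using that by (simp_all add: lfrac_in_A inv_closed)
    have 1: "lfrac t 1 \<otimes>\<^bsub>A\<^esub> lfrac r t = lfrac r 1" using that by (simp add: mult_A lfrac_eq_iff inv_closed mult.commute)
    have 2: "lfrac 1 t \<otimes>\<^bsub>A\<^esub> lfrac r 1 = lfrac r t" using that by (simp add: mult_A inv_closed)
    show "r \<in> D i" if *: "?I +>\<^bsub>A\<^esub> lfrac r t \<in> H i"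
      using Hsm[OF \<open>i \<le> n\<close> t(1) *] c t \<open>r \<in> invs G\<close> by (simp add: q 1 D_def)
    show "?I +>\<^bsub>A\<^esub> lfrac r t \<in> H i" if *: "r \<in> D i"
      using Hsm[OF \<open>i \<le> n\<close> t(2), of "?I +>\<^bsub>A\<^esub> lfrac r 1"] l[OF \<open>r \<in> invs G\<close>] t * by (simp add: q 2 D_def)
  qed
  have D_trunc: "s \<in> D i" if "i \<le> n" "r \<in> D i" "s \<in> invs G" "trunc ?q s = trunc ?q r" for i r s
  proof -
    have "s - r \<in> frob_J e" using that by (auto simp: frob_J_def trunc_eq_iff D_def invs_diff)
    then have "lfrac s 1 \<ominus>\<^bsub>A\<^esub> lfrac r 1 \<in> ?I"
      using that den_1 by (auto simp: diff_A D_def loc_def)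
    then have "?I +>\<^bsub>A\<^esub> lfrac s 1 = ?I +>\<^bsub>A\<^esub> lfrac r 1" using that by (simp add: q l D_def)
    then show ?thesis using that by (simp add: D_def)
  qed
  have D_0: "0 \<in> D i" if i: "i \<le> n" for i
  proof -
    obtain x where "x \<in> H i" using Hne[OF i] by blast
    then obtain u where "x = ?I +>\<^bsub>A\<^esub> u" "u \<in> carrier A" using Hsub[OF i] q(1) by auto
    then obtain r t where "?I +>\<^bsub>A\<^esub> lfrac r t \<in> H i" "r \<in> invs G" "t \<in> den" using \<open>x \<in> H i\<close> by (auto elim: A_cases)
    then have "r \<in> D i" using D_all i by blast
    then show ?thesis using D_mult[OF i invs_0] by fastforce
  qed
  have D_sub: "D i \<subseteq> invs G" for i by (auto simp: D_def)
  have sp: "mp.subspace (trunc ?q ` D i)" if "i \<le> n" for i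
    unfolding mp.subspace_def
  proof (intro conjI ballI allI)
    show "0 \<in> trunc ?q ` D i" using D_0[OF that] by (intro image_eqI[of _ _ 0]) auto
    fix x y c assume x: "x \<in> trunc ?q ` D i"
    obtain r where r: "x = trunc ?q r" "r \<in> D i" using x by auto
    show "mconst c * x \<in> trunc ?q ` D i"
      using D_mult[OF that invs_mconst r(2)] by (intro image_eqI[of _ _ "mconst c * r"]) (auto simp: r trunc_scale)
    assume y: "y \<in> trunc ?q ` D i"
    obtain s where s: "y = trunc ?q s" "s \<in> D i" using y by auto
    show "x + y \<in> trunc ?q ` D i"
      using D_add[OF that r(2) s(2)] by (intro image_eqI[of _ _ "r + s"]) (auto simp: r s trunc_add)
  qed
  have "\<exists>W. finite W \<and> card W = i \<and> mp.independent W \<and> W \<subseteq> trunc ?q ` D i" if "i \<le> n" for i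
    using that
  proof (induction i)
    case 0
    show ?case by (intro exI[of _ "{}"]) (simp add: mp.independent_empty)
  next
    case (Suc i)
    then obtain W where W: "finite W" "card W = i" "mp.independent W" "W \<subseteq> trunc ?q ` D i" by auto
    have strict: "H i \<subset> H (Suc i)" using H(2) Suc.prems by simp
    then obtain x where x: "x \<in> H (Suc i)" "x \<notin> H i" by blast
    obtain u where u: "x = ?I +>\<^bsub>A\<^esub> u" "u \<in> carrier A" using x Hsub[OF Suc.prems] q(1) by auto
    obtain r t where r: "u = lfrac r t" "r \<in> invs G" "t \<in> den" using u(2) by (rule A_cases)
    have rD: "r \<in> D (Suc i)" "r \<notin> D i" using D_all[OF Suc.prems r(2,3)] D_all[of i, OF _ r(2,3)] Suc.prems x u r by auto
    have notin: "trunc ?q r \<notin> mp.span W"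
    proof
      assume "trunc ?q r \<in> mp.span W"
      then have "trunc ?q r \<in> trunc ?q ` D i"
        using mp.span_minimal[OF W(4) sp] Suc.prems by auto
      then obtain s where "s \<in> D i" "trunc ?q r = trunc ?q s" by auto
      then show False using D_trunc[of i s r] Suc.prems r rD by auto
    qed
    have "D i \<subseteq> D (Suc i)" using strict by (auto simp: D_def)
    then have "insert (trunc ?q r) W \<subseteq> trunc ?q ` D (Suc i)" using W(4) rD by blast
    moreover have "mp.independent (insert (trunc ?q r) W)" by (rule mp.independent_insertI[OF notin W(3)])
    moreover have "card (insert (trunc ?q r) W) = Suc i" using W notin mp.span_base[of _ W] by (subst card_insert_disjoint) auto
    ultimately show ?case using W(1) by (intro exI[of _ "insert (trunc ?q r) W"]) simp
  qed
  from this[of n] obtain W where W: "card W = n" "mp.independent W" "W \<subseteq> trunc ?q ` D n" by auto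
  obtain B where B: "finite B" "trunc ?q ` invs G \<subseteq> mp.span B" "card B = ldim e"
    using trunc_invs_basis[of ?q] unfolding ldim_def by metis
  have "W \<subseteq> mp.span B" using W(3) B(2) D_sub by blast
  from mp.independent_span_bound[OF B(1) W(2) this] show ?thesis using W B by simp
qed

text \<open>Modulo the Frobenius power an invariant without constant term is nilpotent, so every denominator is invertible modulo \<open>J\<close>, by a geometric series.\<close>

lemma cancel_den:
  assumes J: "r_ideal J" "frob_J e \<subseteq> J" and b: "b \<in> invs G" "s \<in> den" "b * s \<in> J"
  shows "b \<in> J"
proof -
  note J' = r_idealD[OF J(1)]
  define c :: "('n, 'k) mpoly" where "c = mconst (inverse (cterm s))"
  define y where "y = 1 - c * s"
  define N where "N = CARD('n) * p ^ e"
  have c: "c \<in> invs G" by (simp add: c_def invs_mconst)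
  have y: "y \<in> invs G" using b c by (simp add: y_def inv_closed)
  have cy: "cterm y = 0"
    using b(2) by (simp add: y_def c_def lookup_minus ring_map_1[OF ring_map_cterm] ring_map_mult[OF ring_map_cterm] den_def)
  have "y ^ N \<in> frob_ideal (p ^ e)"
    unfolding N_def by (rule order_ge_frob_ideal[OF order_ge_power[OF cy]])
  then have "y ^ N \<in> J" using J(2) y by (auto simp: frob_J_def invs_power)
  then have 1: "b * y ^ N \<in> J" by (rule J'(4)[OF b(1)])
  have sum: "(\<Sum>i<N. y ^ i) \<in> invs G" by (intro invs_sum invs_power y)
  have "1 - y = c * s" by (simp add: y_def)
  then have "1 - y ^ N = (c * s) * (\<Sum>i<N. y ^ i)" using one_diff_power_eq[of y N] by simp
  then have 2: "b * (1 - y ^ N) = (c * (\<Sum>i<N. y ^ i)) * (b * s)" by (simp only: ac_simps)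
  have "b = b * y ^ N + b * (1 - y ^ N)" by (simp add: algebra_simps)
  then have "b = b * y ^ N + (c * (\<Sum>i<N. y ^ i)) * (b * s)" by (simp only: 2)
  moreover have "(c * (\<Sum>i<N. y ^ i)) * (b * s) \<in> J"
    by (rule J'(4)[OF _ b(3)]) (intro invs_mult c sum)
  ultimately show ?thesis using J'(3)[OF 1] by metis
qed

text \<open>Filter the invariants by the order of vanishing at the origin. If \<open>v\<close> has the largest order possible outside \<open>J\<close>, then its products with invariants without constant term have higher order and lie in \<open>J\<close>. So the span of \<open>J\<close> and \<open>v\<close> is an ideal again.\<close>

lemma r_ideal_extend:
  assumes J: "r_ideal J" "frob_J e \<subseteq> J" "J \<noteq> invs G"
  obtains v where "v \<in> invs G" "v \<notin> J" "r_ideal {b + mconst c * v | b c. b \<in> J}"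
proof -
  note J' = r_idealD[OF J(1)]
  \<comment> \<open>the invariants that vanish at the origin to order at least \<open>j\<close>\<close>
  define V where "V j = {f \<in> invs G. order_ge j f}" for j
  have V0: "\<not> V 0 \<subseteq> J" using J(3) J'(1) by (auto simp: V_def order_ge_0)
  have VN: "V (CARD('n) * p ^ e) \<subseteq> J"
    using J(2) order_ge_frob_ideal[of "p ^ e"] by (auto simp: V_def frob_J_def)
  have "\<exists>j. \<not> V j \<subseteq> J \<and> V (Suc j) \<subseteq> J"
  proof (rule ccontr)
    assume *: "\<not> ?thesis"
    have "\<not> V j \<subseteq> J" for j by (induction j) (use V0 * in blast)+
    then show False using VN by blast
  qed
  then obtain j where j: "\<not> V j \<subseteq> J" "V (Suc j) \<subseteq> J" by blast
  then obtain v where v: "v \<in> invs G" "order_ge j v" "v \<notin> J" by (auto simp: V_def)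
  have mv: "r * v \<in> J" if "r \<in> invs G" "cterm r = 0" for r
  proof -
    have "order_ge (Suc j) (r * v)" using order_ge_mult[OF order_ge_1[OF that(2)] v(2)] by simp
    then show ?thesis using j(2) that v by (auto simp: V_def invs_mult)
  qed
  have "r_ideal {b + mconst c * v | b c. b \<in> J}" (is "r_ideal ?K")
    unfolding r_ideal_def
  proof (intro conjI ballI)
    show "?K \<subseteq> invs G" using J'(1) v by (auto intro: invs_add invs_mult invs_mconst)
    show "0 \<in> ?K" using J'(2) by (intro CollectI exI[of _ 0]) (simp add: mconst_simps)
    fix a b assume "a \<in> ?K" "b \<in> ?K"
    then obtain x c x' c' where a: "a = x + mconst c * v" "x \<in> J" and b: "b = x' + mconst c' * v" "x' \<in> J" by blast
    have "a + b = (x + x') + mconst (c + c') * v" by (simp add: a b mconst_simps algebra_simps)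
    then show "a + b \<in> ?K" using J'(3)[OF a(2) b(2)] by blast
  next
    fix r a assume r: "r \<in> invs G" and "a \<in> ?K"
    then obtain x c where a: "a = x + mconst c * v" "x \<in> J" by blast
    let ?r = "r - mconst (cterm r)"
    have "r * a = (r * x + mconst c * (?r * v)) + mconst (c * cterm r) * v" by (simp add: a mconst_simps algebra_simps)
    moreover have rv: "?r * v \<in> J" by (rule mv) (use r in \<open>auto simp: invs_diff invs_mconst lookup_minus\<close>)
    have "r * x + mconst c * (?r * v) \<in> J"
      by (rule J'(3)[OF J'(4)[OF r a(2)] J'(4)[OF invs_mconst rv]])
    ultimately show "r * a \<in> ?K" by blast
  qed
  then show ?thesis using that v by blast
qed

text \<open>Each step adds a single vector to the space of truncations, so the steps can be continued at least up to the dimension.\<close>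

lemma ideal_chain_exists:
  "i \<le> ldim e \<Longrightarrow> \<exists>B. (\<forall>l\<le>i. r_ideal (B l) \<and> frob_J e \<subseteq> B l) \<and> (\<forall>l<i. B l \<subset> B (Suc l)) \<and>
     (\<exists>W. finite W \<and> card W \<le> i \<and> trunc (p ^ e) ` B i \<subseteq> mp.span W)"
proof (induction i)
  case 0
  show ?case
  proof (intro exI[of _ "\<lambda>_. frob_J e"] conjI)
    show "\<exists>W. finite W \<and> card W \<le> 0 \<and> trunc (p ^ e) ` frob_J e \<subseteq> mp.span W"
      by (intro exI[of _ "{}"]) (auto simp: frob_J_def trunc_eq_0_iff)
  qed (auto simp: r_ideal_frob_J)
next
  case (Suc i)
  have "i \<le> ldim e" using Suc.prems by simp
  from Suc.IH[OF this] obtain B W where B0: "\<forall>l\<le>i. r_ideal (B l) \<and> frob_J e \<subseteq> B l" "\<forall>l<i. B l \<subset> B (Suc l)"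
    and W: "finite W" "card W \<le> i" "trunc (p ^ e) ` B i \<subseteq> mp.span W" by (elim exE conjE) rule
  have B: "r_ideal (B l)" "frob_J e \<subseteq> B l" if "l \<le> i" for l using B0(1) that by blast+
  have B3: "B l \<subset> B (Suc l)" if "l < i" for l using B0(2) that by blast
  have ne: "B i \<noteq> invs G"
  proof
    assume "B i = invs G"
    then have "mp.dim (trunc (p ^ e) ` invs G) \<le> card W" using mp.dim_le_card[OF W(3,1)] by simp
    then show False using W(2) Suc.prems by (simp add: ldim_def)
  qed
  obtain v where v: "v \<in> invs G" "v \<notin> B i" "r_ideal {b + mconst c * v | b c. b \<in> B i}"
    using r_ideal_extend[OF B(1)[OF order_refl] B(2)[OF order_refl] ne] .
  let ?K = "{b + mconst c * v | b c. b \<in> B i}"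
  have 1: "B i \<subseteq> ?K"
  proof
    fix b assume "b \<in> B i"
    moreover have "b = b + mconst 0 * v" by (simp add: mconst_simps)
    ultimately show "b \<in> ?K" by blast
  qed
  have "v = 0 + mconst 1 * v" by (simp add: mconst_simps)
  then have 2: "v \<in> ?K" using r_idealD(2)[OF B(1)[OF order_refl]] by blast
  define B' where "B' = B(Suc i := ?K)"
  have sp: "trunc (p ^ e) ` ?K \<subseteq> mp.span (insert (trunc (p ^ e) v) W)"
  proof
    fix x assume "x \<in> trunc (p ^ e) ` ?K"
    then obtain b c where x: "x = trunc (p ^ e) b + mconst c * trunc (p ^ e) v" "b \<in> B i"
      by (auto simp: trunc_add trunc_scale)
    have bW: "trunc (p ^ e) b \<in> mp.span (insert (trunc (p ^ e) v) W)"
      using W(3) x(2) mp.span_mono[of W "insert (trunc (p ^ e) v) W"] by blast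
    show "x \<in> mp.span (insert (trunc (p ^ e) v) W)"
      unfolding x(1) by (rule mp.span_add[OF bW mp.span_scale[OF mp.span_base]]) simp
  qed
  show ?case
  proof (intro exI[of _ B'] conjI)
    show "\<forall>l\<le>Suc i. r_ideal (B' l) \<and> frob_J e \<subseteq> B' l"
    proof (intro allI impI)
      fix l assume "l \<le> Suc i"
      then consider "l \<le> i" | "l = Suc i" by linarith
      then show "r_ideal (B' l) \<and> frob_J e \<subseteq> B' l"
      proof cases
        case 1
        then show ?thesis using B[of l] by (simp add: B'_def)
      next
        case 2
        have "frob_J e \<subseteq> ?K" using B(2)[OF order_refl] \<open>B i \<subseteq> ?K\<close> by (rule subset_trans)
        then show ?thesis using 2 v(3) by (simp add: B'_def)
      qed
    qed
    show "\<forall>l<Suc i. B' l \<subset> B' (Suc l)"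
    proof (intro allI impI)
      fix l assume "l < Suc i"
      then consider "l < i" | "l = i" by linarith
      then show "B' l \<subset> B' (Suc l)"
      proof cases
        case 1
        then show ?thesis using B3[of l] by (simp add: B'_def)
      next
        case 2
        have "B i \<subset> ?K" using \<open>B i \<subseteq> ?K\<close> \<open>v \<in> ?K\<close> v(2) by blast
        then show ?thesis using 2 by (simp add: B'_def)
      qed
    qed
    show "\<exists>W. finite W \<and> card W \<le> Suc i \<and> trunc (p ^ e) ` B' (Suc i) \<subseteq> mp.span W"
      using sp W(1,2) by (intro exI[of _ "insert (trunc (p ^ e) v) W"]) (simp add: B'_def card_insert_if)
  qed
qed

lemma submodule_chain_exists:
  "\<exists>H. (\<forall>i\<le>ldim e. submodule (H i) A (quot_module A (loc (frob_J e)))) \<and> (\<forall>i<ldim e. H i \<subset> H (Suc i))"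
proof -
  let ?I = "loc (frob_J e)"
  let ?M = "quot_module A ?I"
  have I: "ideal ?I A" by (rule ideal_loc[OF r_ideal_frob_J])
  note q = quot_module_simps[OF I]
  interpret R: cring A by (rule cring_A)
  interpret M: Module.module A ?M by (rule module_quot_module[OF I])
  obtain B where B: "\<And>l. l \<le> ldim e \<Longrightarrow> r_ideal (B l)" "\<And>l. l \<le> ldim e \<Longrightarrow> frob_J e \<subseteq> B l" "\<And>l. l < ldim e \<Longrightarrow> B l \<subset> B (Suc l)"
    using ideal_chain_exists[of "ldim e" e] by auto
  define H where "H l = (\<lambda>x. ?I +>\<^bsub>A\<^esub> x) ` loc (B l)" for l
  have "submodule (H l) A ?M" if l: "l \<le> ldim e" for l
  proof -
    interpret L: ideal "loc (B l)" A by (rule ideal_loc[OF B(1)[OF l]])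
    have sm: "a \<odot>\<^bsub>?M\<^esub> x \<in> H l" if a: "a \<in> carrier A" and x: "x \<in> H l" for a x
    proof -
      obtain u where u: "x = ?I +>\<^bsub>A\<^esub> u" "u \<in> loc (B l)" using x by (auto simp: H_def)
      have "a \<odot>\<^bsub>?M\<^esub> x = ?I +>\<^bsub>A\<^esub> (a \<otimes>\<^bsub>A\<^esub> u)" using u a L.Icarr by (simp add: q)
      then show ?thesis using L.I_l_closed[OF u(2) a] by (auto simp: H_def)
    qed
    show ?thesis
    proof (rule M.submoduleI)
      show sub: "H l \<subseteq> carrier ?M" using L.Icarr by (auto simp: H_def q)
      show "\<zero>\<^bsub>?M\<^esub> \<in> H l" using L.zero_closed by (auto simp: H_def q)
      fix x assume x: "x \<in> H l"
      then have xM: "x \<in> carrier ?M" using sub by blast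
      have "(\<ominus>\<^bsub>A\<^esub> \<one>\<^bsub>A\<^esub>) \<odot>\<^bsub>?M\<^esub> x \<in> H l" by (rule sm[OF _ x]) simp
      then show "\<ominus>\<^bsub>?M\<^esub> x \<in> H l"
        by (simp only: M.smult_l_minus[OF R.one_closed xM] M.smult_one[OF xM])
      fix y assume y: "y \<in> H l"
      obtain u v where "x = ?I +>\<^bsub>A\<^esub> u" "u \<in> loc (B l)" "y = ?I +>\<^bsub>A\<^esub> v" "v \<in> loc (B l)"
        using x y by (auto simp: H_def)
      then show "x \<oplus>\<^bsub>?M\<^esub> y \<in> H l" using L.a_closed L.Icarr by (auto simp: H_def q)
    qed (rule sm)
  qed
  moreover have "H l \<subset> H (Suc l)" if l: "l < ldim e" for l
  proof -
    have Bl: "r_ideal (B l)" "frob_J e \<subseteq> B l" "r_ideal (B (Suc l))" using B l by auto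
    obtain b where b: "b \<in> B (Suc l)" "b \<notin> B l" using B(3)[OF l] by blast
    have bi: "b \<in> invs G" using r_idealD(1)[OF Bl(3) b(1)] .
    have "H l \<subseteq> H (Suc l)" using B(3)[OF l] by (auto simp: H_def loc_def)
    moreover have "?I +>\<^bsub>A\<^esub> lfrac b 1 \<in> H (Suc l)" using b den_1 by (auto simp: H_def loc_def)
    moreover have "?I +>\<^bsub>A\<^esub> lfrac b 1 \<notin> H l"
    proof
      assume "?I +>\<^bsub>A\<^esub> lfrac b 1 \<in> H l"
      then obtain b' s where bs: "b' \<in> B l" "s \<in> den" "?I +>\<^bsub>A\<^esub> lfrac b 1 = ?I +>\<^bsub>A\<^esub> lfrac b' s"
        by (auto simp: H_def loc_def)
      have b'i: "b' \<in> invs G" using r_idealD(1)[OF Bl(1) bs(1)] .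
      have "lfrac b 1 \<ominus>\<^bsub>A\<^esub> lfrac b' s \<in> ?I"
        using bs b'i bi by (simp add: q(4)[symmetric] lfrac_in_A den_1)
      then have "lfrac (b * s - b') s \<in> ?I" using bs b'i bi by (simp add: diff_A den_1)
      then obtain r t where r: "lfrac (b * s - b') s = lfrac r t" "r \<in> frob_J e" "t \<in> den" by (auto simp: loc_def)
      have inv: "b * s - b' \<in> invs G" "r \<in> invs G" using bi b'i bs r by (auto simp: frob_J_def intro: invs_diff invs_mult den_invs)
      have eq: "(b * s - b') * t = r * s" using r bs inv by (simp add: lfrac_eq_iff)
      have "b * (s * t) = s * r + t * b'" using eq by (simp add: algebra_simps)
      moreover have "s * r \<in> B l" using r_idealD(4)[OF Bl(1) den_invs[OF bs(2)]] r(2) Bl(2) by blast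
      moreover have "t * b' \<in> B l" by (rule r_idealD(4)[OF Bl(1) den_invs[OF r(3)] bs(1)])
      ultimately have "b * (s * t) \<in> B l" using r_idealD(3)[OF Bl(1)] by metis
      then have "b \<in> B l" using cancel_den[OF Bl(1,2) bi den_mult[OF bs(2) r(3)]] by blast
      then show False using b by blast
    qed
    ultimately show ?thesis by blast
  qed
  ultimately show ?thesis by blast
qed

theorem length_quotient: "module_length A (quot_module A (loc (frob_J e))) = enat (ldim e)"
  unfolding module_length_def
proof (rule antisym)
  show "Sup {enat n | n. \<exists>H. (\<forall>i\<le>n. submodule (H i) A (quot_module A (loc (frob_J e)))) \<and> (\<forall>i<n. H i \<subset> H (Suc i))} \<le> enat (ldim e)"
    by (rule Sup_least) (use submodule_chain_bound in auto)
  show "enat (ldim e) \<le> Sup {enat n | n. \<exists>H. (\<forall>i\<le>n. submodule (H i) A (quot_module A (loc (frob_J e)))) \<and> (\<forall>i<n. H i \<subset> H (Suc i))}"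
    by (rule Sup_upper, rule CollectI, rule exI[of _ "ldim e"], rule conjI[OF refl submodule_chain_exists])
qed

text \<open>The class of 1 in the residue field has a nonzero image in the injective hull, and this image lies in the socle. So a generator of the socle cannot be zero.\<close>

lemma socle_generator_props:
  fixes E :: "((('n, 'k) mpoly \<times> ('n, 'k) mpoly) set, 'e) module"
  assumes hull: "injective_hull A (quot_module A (max_ideal A)) E" and z: "socle_generator A E z"
  shows "injective_module A E" "z \<in> carrier E" "z \<noteq> \<zero>\<^bsub>E\<^esub>"
    "\<And>r. r \<in> invs G \<Longrightarrow> cterm r = 0 \<Longrightarrow> lfrac r 1 \<odot>\<^bsub>E\<^esub> z = \<zero>\<^bsub>E\<^esub>"
proof -
  let ?I = "loc inv_max"
  let ?M = "quot_module A ?I"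
  show inj: "injective_module A E" using hull by (simp add: injective_hull_def)
  interpret E: Module.module A E using inj by (simp add: injective_module_def)
  have I: "ideal ?I A" by (rule ideal_loc[OF r_ideal_inv_max])
  note q = quot_module_simps[OF I]
  show zE: "z \<in> carrier E" using z by (auto simp: socle_generator_def socle_def)
  show "lfrac r 1 \<odot>\<^bsub>E\<^esub> z = \<zero>\<^bsub>E\<^esub>" if "r \<in> invs G" "cterm r = 0" for r
    using z that frac_in_loc_inv_max[OF that(1) den_1]
    by (auto simp: socle_generator_def socle_def max_ideal_A)
  obtain \<iota> where \<iota>: "\<iota> \<in> module_hom A ?M E" "inj_on \<iota> (carrier ?M)"
    using hull by (auto simp: injective_hull_def max_ideal_A)
  have \<iota>_smult: "\<iota> (a \<odot>\<^bsub>?M\<^esub> x) = a \<odot>\<^bsub>E\<^esub> \<iota> x" "\<iota> x \<in> carrier E" if "a \<in> carrier A" "x \<in> carrier ?M" for a x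
    using \<iota>(1) that by (auto simp: module_hom_def hom_def)
  define w where "w = \<iota> (?I +>\<^bsub>A\<^esub> \<one>\<^bsub>A\<^esub>)"
  have c1: "?I +>\<^bsub>A\<^esub> \<one>\<^bsub>A\<^esub> \<in> carrier ?M" "?I +>\<^bsub>A\<^esub> \<zero>\<^bsub>A\<^esub> \<in> carrier ?M" by (auto simp: q)
  have wE: "w \<in> carrier E" using \<iota>_smult(2)[OF E.R.one_closed c1(1)] by (simp add: w_def)
  have aw: "a \<odot>\<^bsub>E\<^esub> w = \<iota> (?I +>\<^bsub>A\<^esub> a)" if "a \<in> carrier A" for a
    using \<iota>_smult(1)[OF that c1(1)] that by (simp add: w_def q)
  have zero: "\<iota> (?I +>\<^bsub>A\<^esub> \<zero>\<^bsub>A\<^esub>) = \<zero>\<^bsub>E\<^esub>" using aw[of "\<zero>\<^bsub>A\<^esub>"] wE by simp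
  have "w \<in> socle A E"
    unfolding socle_def max_ideal_A
  proof (intro CollectI conjI ballI wE)
    fix a assume a: "a \<in> ?I"
    then have aA: "a \<in> carrier A" using ideal.Icarr[OF I] by blast
    have "a \<ominus>\<^bsub>A\<^esub> \<zero>\<^bsub>A\<^esub> = a" using aA by (simp add: E.R.minus_eq)
    then have "?I +>\<^bsub>A\<^esub> a = ?I +>\<^bsub>A\<^esub> \<zero>\<^bsub>A\<^esub>" using q(4)[OF aA E.R.zero_closed] a by simp
    then show "a \<odot>\<^bsub>E\<^esub> w = \<zero>\<^bsub>E\<^esub>" using aw[OF aA] zero by simp
  qed
  moreover have "w \<noteq> \<zero>\<^bsub>E\<^esub>"
  proof
    assume "w = \<zero>\<^bsub>E\<^esub>"
    then have "?I +>\<^bsub>A\<^esub> \<one>\<^bsub>A\<^esub> = ?I +>\<^bsub>A\<^esub> \<zero>\<^bsub>A\<^esub>"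
      using inj_onD[OF \<iota>(2) _ c1] zero by (simp add: w_def)
    then have "\<one>\<^bsub>A\<^esub> \<ominus>\<^bsub>A\<^esub> \<zero>\<^bsub>A\<^esub> \<in> ?I" using q(4)[OF E.R.one_closed E.R.zero_closed] by simp
    then have "\<one>\<^bsub>A\<^esub> \<in> ?I" by (simp add: E.R.minus_eq)
    then show False using ideal.one_imp_carrier[OF I] loc_inv_max_proper by simp
  qed
  ultimately show "z \<noteq> \<zero>\<^bsub>E\<^esub>"
    using z by (auto simp: socle_generator_def)
qed

end

section \<open>The minimal Hilbert-Kunz multiplicity\<close>

theorem theorem4p2:
  fixes G :: "('k::field ^ 'n::finite ^ 'n) set"
    and p :: nat
    and E :: "((('n, 'k) mpoly \<times> ('n, 'k) mpoly) set, 'e) module"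
    and z :: 'e
  assumes "p > 0" and "CHAR('k) = p"
    and "subgroup G GL" and "finite G"
    and "\<not> p dvd card G"
    and "\<forall>g\<in>G. \<not> pseudo_reflection g"
    and "injective_hull (invariant_local_ring G)
           (quot_module (invariant_local_ring G) (max_ideal (invariant_local_ring G))) E"
    and "socle_generator (invariant_local_ring G) E z"
  shows "m_HK (invariant_local_ring G) E z = ereal (1 / real (card G))"
proof -
  interpret L: lin_group G p by (rule lin_group.intro[OF assms(1-5)])
  note sg = L.socle_generator_props[OF assms(7,8)]
  interpret M: loc_module G p E
    by (intro loc_module.intro L.lin_group_axioms) (use sg(1) in \<open>simp add: injective_module_def\<close>)
  have q: "real (p ^ (e * CARD('n))) \<noteq> 0" for e using assms(1) by simp
  have "(\<lambda>e. ereal (real (L.ldim e) / real (p ^ (e * CARD('n))))) \<longlonglongrightarrow> ereal (1 / real (card G))"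
    using L.ldim_asymptotics by simp
  then have "liminf (\<lambda>e. ereal (real (L.ldim e) / real (p ^ (e * CARD('n))))) = ereal (1 / real (card G))"
    by (intro lim_imp_Liminf) auto
  moreover have "ereal_of_enat (module_length (invariant_local_ring G) (quot_module (invariant_local_ring G)
        (annihilator (invariant_local_ring G) (frobenius_functor (invariant_local_ring G) e E)
          (frobenius_map (invariant_local_ring G) e E z)))) / ereal (real (p ^ (e * CARD('n)))) =
      ereal (real (L.ldim e) / real (p ^ (e * CARD('n))))" for e
  proof -
    have "annihilator (invariant_local_ring G) (frobenius_functor (invariant_local_ring G) e E)
        (frobenius_map (invariant_local_ring G) e E z) = L.loc (L.frob_J e)"
      by (rule M.annihilator_frobenius[OF sg(1) assms(6) sg(2-4)])
    then show ?thesis using q[of e] by (simp add: L.length_quotient)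
  qed
  ultimately show ?thesis
    by (simp only: m_HK_def L.ring_char_A L.krull_dim_A the_enat.simps)
qed

end
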